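(* Let $\mathcal H$ be a finite-dimensional complex Hilbert space and let $T:B(\mathcal H)\to B(\mathcal H)$ be a pure operation. Then $T$ is completely positive if and only if $T$ is orientation-preserving.
   Context: $B(\mathcal H)$ is the real vector space of Hermitian operators on $\mathcal H$, with scalar product $(X,Y)\mapsto \mathrm{Tr}(XY)$; $B^+(\mathcal H)$ is the cone of positive semi-definite operators; $K(\mathcal H)$ is the convex set of $W\in B^+(\mathcal H)$ with $\mathrm{Tr}\,W=1$. For a unit vector $\varphi$, $P_\varphi=|\varphi\rangle\langle\varphi|$. An operation is a real-linear map $T:B(\mathcal H)\to B(\mathcal H)$ that is monotone, i.e. $T(B^+(\mathcal H))\subset B^+(\mathcal H)$ (trace preservation is not required). $T$ is completely positive if it is monotone and for every $n\in\mathbb N$ the map $T\otimes \mathrm{id}_{B(\mathbb C^n)}$ on $B(\mathcal H)\otimes B(\mathbb C^n)\cong B(\mathcal H\otimes\mathbb C^n)$ is monotone. An operation $T$ is pure if for every unit vector $\varphi\in\mathcal H$ there are a unit vector $\psi\in\mathcal H$ and a real $\lambda\ge 0$ with $T(P_\varphi)=\lambda P_\psi$. $\mathcal F_3$ is the set of three-dimensional faces of $K(\mathcal H)$; these correspond bijectively to the two-dimensional subspaces $\mathcal H_2\subset\mathcal H$, the face $F$ of $\mathcal H_2$ consisting of all $W\in K(\mathcal H)$ with support contained in $\mathcal H_2$. $B(F)$ is the 4-dimensional real subspace of $B(\mathcal H)$ spanned by $F$, i.e. all Hermitian operators with support contained in $\mathcal H_2$. For an orthonormal basis $(\varphi,\psi)$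 of $\mathcal H_2$, the standard basis of $B(F)$ is $\sigma_0(F)=\tfrac1{\sqrt2}(|\varphi\rangle\langle\varphi|+|\psi\rangle\langle\psi|)$, $\sigma_1(F)=\tfrac1{\sqrt2}(|\varphi\rangle\langle\psi|+|\psi\rangle\langle\varphi|)$, $\sigma_2(F)=\tfrac{i}{\sqrt2}(-|\varphi\rangle\langle\psi|+|\psi\rangle\langle\varphi|)$, $\sigma_3(F)=\tfrac1{\sqrt2}(|\varphi\rangle\langle\varphi|-|\psi\rangle\langle\psi|)$. $\mathrm{Det}:B(F)^4\to\mathbb R$ is the unique 4-linear alternating map with $\mathrm{Det}(\sigma_0(F),\sigma_1(F),\sigma_2(F),\sigma_3(F))=1$; it does not depend on the choice of the orthonormal basis $(\varphi,\psi)$. An operation $T$ is orientation-preserving if: (1) for every $F\in\mathcal F_3$ there is $F'\in\mathcal F_3$ with $T(B(F))\subset B(F')$; and (2) for all $F\in\mathcal F_3$ and $X_0,\dots,X_3\in B(F)$, $\mathrm{Det}(X_0,X_1,X_2,X_3)\ge0$ implies $\mathrm{Det}(TX_0,TX_1,TX_2,TX_3)\ge0$, the latter $\mathrm{Det}$ being that of $B(F')$ with $F'$ as in (1) (if $F'$ is not unique, this value is $0$ for every choice of $F'$). *)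

theory Defs
  imports "HOL-Analysis.Analysis"
begin

section \<open>Finite-dimensional complex Hilbert spaces\<close>

text \<open>The distribution has no class of complex inner product spaces. We extend \<^class>\<open>real_inner\<close>,
  whose inner product is the real part of the complex one, so that norm and topology are the usual
  ones. The complex inner product is linear in its second argument. The zero space is allowed;
  completeness is automatic in finite dimension.\<close>

class fin_dim_complex_hilbert = real_inner +
  fixes scaleC :: "complex \<Rightarrow> 'a \<Rightarrow> 'a"  (infixr \<open>*\<^sub>C\<close> 75)
    and cinner :: "'a \<Rightarrow> 'a \<Rightarrow> complex"
  assumes scaleC_add_right: "c *\<^sub>C (x + y) = c *\<^sub>C x + c *\<^sub>C y"
    and scaleC_add_left: "(c + d) *\<^sub>C x = c *\<^sub>C x + d *\<^sub>C x"
    and scaleC_scaleC: "c *\<^sub>C (d *\<^sub>C x) = (c * d) *\<^sub>C x"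
    and scaleR_scaleC: "r *\<^sub>R x = complex_of_real r *\<^sub>C x"
    and cinner_add_right: "cinner x (y + z) = cinner x y + cinner x z"
    and cinner_scaleC_right: "cinner x (c *\<^sub>C y) = c * cinner x y"
    and cinner_commute: "cinner x y = cnj (cinner y x)"
    and inner_eq_Re_cinner: "inner x y = Re (cinner x y)"
    and finite_dimensional: "\<exists>B. finite B \<and> (\<forall>x. \<exists>u. x = (\<Sum>b\<in>B. u b *\<^sub>C b))"

lemma scaleC_one: "1 *\<^sub>C x = (x :: 'h::fin_dim_complex_hilbert)"
  using scaleR_scaleC[of 1 x] by simp

global_interpretation cvec: vector_space "scaleC :: complex \<Rightarrow> 'h::fin_dim_complex_hilbert \<Rightarrow> 'h"
  by unfold_locales (simp_all add: scaleC_add_right scaleC_add_left scaleC_scaleC scaleC_one)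

lemma cinner_add_left: "cinner (x + y) z = cinner x z + cinner y z"
  for x y z :: "'h::fin_dim_complex_hilbert"
  by (metis cinner_add_right cinner_commute complex_cnj_add)

lemma cinner_scaleC_left: "cinner (c *\<^sub>C x) y = cnj c * cinner x y"
  for x y :: "'h::fin_dim_complex_hilbert"
  by (metis cinner_scaleC_right cinner_commute complex_cnj_mult)

lemma norm_scaleC: "norm (c *\<^sub>C x) = cmod c * norm x"
  for x :: "'h::fin_dim_complex_hilbert"
proof -
  have "Im (cinner x x) = 0"
    using cinner_commute[of x x] by (simp add: complex_eq_iff)
  moreover have "c * cnj c = complex_of_real ((cmod c)\<^sup>2)"
    by (simp only: complex_norm_square)
  then have "cinner (c *\<^sub>C x) (c *\<^sub>C x) = complex_of_real ((cmod c)\<^sup>2) * cinner x x"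
    by (metis cinner_scaleC_left cinner_scaleC_right mult.assoc)
  ultimately have "inner (c *\<^sub>C x) (c *\<^sub>C x) = (cmod c)\<^sup>2 * inner x x"
    by (simp add: inner_eq_Re_cinner)
  then show ?thesis
    by (simp add: norm_eq_sqrt_inner real_sqrt_mult)
qed

lemma Im_cinner: "Im (cinner x y) = inner (\<i> *\<^sub>C x) y"
  for x y :: "'h::fin_dim_complex_hilbert"
  by (simp add: inner_eq_Re_cinner cinner_scaleC_left)

lemma bounded_linear_scaleC: "bounded_linear (\<lambda>x. c *\<^sub>C (x :: 'h::fin_dim_complex_hilbert))"
  by (rule bounded_linear_intro[where K = "cmod c"])
    (simp_all add: scaleC_add_right scaleR_scaleC scaleC_scaleC norm_scaleC mult.commute)

lemma bounded_linear_ketbra: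
  "bounded_linear (\<lambda>x. cinner y x *\<^sub>C (z :: 'h::fin_dim_complex_hilbert))"
proof (rule bounded_linear_intro[where K = "2 * norm y * norm z"])
  fix x :: 'a
  have "cmod (cinner y x) \<le> \<bar>inner y x\<bar> + \<bar>inner (\<i> *\<^sub>C y) x\<bar>"
    by (metis cmod_le Im_cinner inner_eq_Re_cinner)
  also have "\<dots> \<le> norm y * norm x + norm (\<i> *\<^sub>C y) * norm x"
    by (intro add_mono Cauchy_Schwarz_ineq2)
  finally have "cmod (cinner y x) \<le> 2 * (norm y * norm x)"
    by (simp add: norm_scaleC mult.commute)
  then show "norm (cinner y x *\<^sub>C z) \<le> norm x * (2 * norm y * norm z)"
    using mult_right_mono[of "cmod (cinner y x)" "2 * (norm y * norm x)" "norm z"]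
    by (simp add: norm_scaleC mult_ac)
qed (simp_all add: cinner_add_right scaleC_add_left scaleR_scaleC cinner_scaleC_right scaleC_scaleC)

text \<open>The class contains the spaces \<open>\<complex>\<^sup>n\<close>.\<close>

instantiation complex :: fin_dim_complex_hilbert
begin

definition "scaleC c x = c * (x :: complex)"
definition "cinner x y = cnj x * (y :: complex)"

instance
proof
  show "\<exists>B. finite B \<and> (\<forall>x :: complex. \<exists>u. x = (\<Sum>b\<in>B. u b *\<^sub>C b))"
    by (intro exI[of _ "{1}"]) (auto simp: scaleC_complex_def)
qed (auto simp: scaleC_complex_def cinner_complex_def inner_complex_def algebra_simps scaleR_conv_of_real)

end

instantiation vec :: (fin_dim_complex_hilbert, finite) fin_dim_complex_hilbert
begin

definition "scaleC c x = (\<chi> i. c *\<^sub>C (x $ i))"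
definition "cinner x y = (\<Sum>i\<in>UNIV. cinner (x $ i) (y $ i))"

instance
proof
  obtain B0 :: "'a set" where B0: "finite B0" "\<And>x. \<exists>u. x = (\<Sum>b\<in>B0. u b *\<^sub>C b)"
    using finite_dimensional by metis
  define B where "B = B0 - {0}"
  have B: "finite B" "\<exists>u. x = (\<Sum>b\<in>B. u b *\<^sub>C b)" for x
    using B0(1) B0(2)[of x] by (simp_all add: B_def sum_diff1)
  define f where "f = (\<lambda>(i :: 'b, b :: 'a). axis i b)"
  have inj: "inj_on f (UNIV \<times> B)"
    by (auto simp: inj_on_def f_def B_def axis_eq_axis)
  have "\<exists>w. x = (\<Sum>c\<in>f ` (UNIV \<times> B). w c *\<^sub>C c)" for x :: "'a ^ 'b"
  proof -
    obtain u where u: "\<And>i. x $ i = (\<Sum>b\<in>B. u i b *\<^sub>C b)"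
      using choice[of "\<lambda>i v. x $ i = (\<Sum>b\<in>B. v b *\<^sub>C b)"] B(2) by blast
    define w where "w = (\<lambda>(i, b). u i b) \<circ> inv_into (UNIV \<times> B) f"
    have "(\<Sum>c\<in>f ` (UNIV \<times> B). w c *\<^sub>C c) $ k = x $ k" for k
    proof -
      have "(\<Sum>c\<in>f ` (UNIV \<times> B). w c *\<^sub>C c) $ k
          = (\<Sum>p\<in>UNIV \<times> B. u (fst p) (snd p) *\<^sub>C (f p $ k))"
        using inj by (simp add: sum.reindex w_def scaleC_vec_def split_beta)
      also have "\<dots> = (\<Sum>i\<in>UNIV. \<Sum>b\<in>B. u i b *\<^sub>C (if k = i then b else 0))"
        by (simp add: sum.cartesian_product split_beta f_def axis_def)
      also have "\<dots> = (\<Sum>i\<in>UNIV. if k = i then x $ i else 0)"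
        by (intro sum.cong refl) (simp add: u)
      finally show ?thesis
        by simp
    qed
    then show ?thesis
      by (metis vec_eq_iff)
  qed
  then show "\<exists>B. finite B \<and> (\<forall>x :: 'a ^ 'b. \<exists>u. x = (\<Sum>b\<in>B. u b *\<^sub>C b))"
    using B(1) by (intro exI[of _ "f ` (UNIV \<times> B)"]) auto
qed (simp_all add: vec_eq_iff scaleC_vec_def cinner_vec_def scaleC_add_right scaleC_add_left
    scaleC_scaleC scaleR_scaleC cinner_add_right cinner_scaleC_right sum.distrib sum_distrib_left
    inner_vec_def inner_eq_Re_cinner cnj_sum flip: cinner_commute)

end


section \<open>Hermitian operators, states and operations\<close>

text \<open>Operators on \<open>\<H>\<close> live in \<open>'h \<Rightarrow>\<^sub>L 'h\<close>; in finite dimension boundedness is no restriction.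
  That type only requires real linearity, so complex linearity is stated separately.\<close>

type_synonym 'h op = "'h \<Rightarrow>\<^sub>L 'h"

definition clinear_op :: "'h::fin_dim_complex_hilbert op \<Rightarrow> bool" where
  "clinear_op X \<longleftrightarrow> (\<forall>c x. X (c *\<^sub>C x) = c *\<^sub>C X x)"

definition herm :: "'h::fin_dim_complex_hilbert op set" where
  "herm = {X. clinear_op X \<and> (\<forall>x y. cinner (X x) y = cinner x (X y))}"

definition pos_herm :: "'h::fin_dim_complex_hilbert op set" where
  "pos_herm = {X \<in> herm. \<forall>x. 0 \<le> Re (cinner x (X x))}"

definition orthonormal_basis :: "'h::fin_dim_complex_hilbert set \<Rightarrow> bool" where
  "orthonormal_basis B \<longleftrightarrow> finite B \<and> cvec.span B = UNIV \<and>
     (\<forall>x\<in>B. \<forall>y\<in>B. cinner x y = (if x = y then 1 else 0))"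

definition op_trace :: "'h::fin_dim_complex_hilbert op \<Rightarrow> complex" where
  "op_trace X = (\<Sum>b\<in>(SOME B. orthonormal_basis B). cinner b (X b))"

definition states :: "'h::fin_dim_complex_hilbert op set" where
  "states = {W \<in> pos_herm. op_trace W = 1}"

definition scaleC_op :: "complex \<Rightarrow> 'h::fin_dim_complex_hilbert op \<Rightarrow> 'h op" where
  "scaleC_op c X = Blinfun (\<lambda>x. c *\<^sub>C X x)"

definition ketbra :: "'h::fin_dim_complex_hilbert \<Rightarrow> 'h \<Rightarrow> 'h op" where
  "ketbra \<phi> \<psi> = Blinfun (\<lambda>x. cinner \<psi> x *\<^sub>C \<phi>)"

lemma scaleC_op_apply [simp]: "scaleC_op c X x = c *\<^sub>C X x"
  unfolding scaleC_op_def
  by (simp add: bounded_linear_Blinfun_apply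
      bounded_linear_compose[OF bounded_linear_scaleC blinfun.bounded_linear_right])

lemma ketbra_apply [simp]: "ketbra \<phi> \<psi> x = cinner \<psi> x *\<^sub>C \<phi>"
  by (simp add: ketbra_def bounded_linear_Blinfun_apply bounded_linear_ketbra)

text \<open>A map on \<open>B(\<H>)\<close> is a function on all operators of which only the values on
  \<^const>\<open>herm\<close> matter.\<close>

definition operation :: "('h::fin_dim_complex_hilbert op \<Rightarrow> 'h op) \<Rightarrow> bool" where
  "operation T \<longleftrightarrow>
     T ` herm \<subseteq> herm \<and>
     (\<forall>X\<in>herm. \<forall>Y\<in>herm. T (X + Y) = T X + T Y) \<and>
     (\<forall>r. \<forall>X\<in>herm. T (r *\<^sub>R X) = r *\<^sub>R T X) \<and>
     T ` pos_herm \<subseteq> pos_herm"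

definition pure_operation :: "('h::fin_dim_complex_hilbert op \<Rightarrow> 'h op) \<Rightarrow> bool" where
  "pure_operation T \<longleftrightarrow> operation T \<and>
     (\<forall>\<phi>. norm \<phi> = 1 \<longrightarrow> (\<exists>\<psi> r. norm \<psi> = 1 \<and> 0 \<le> r \<and> T (ketbra \<phi> \<phi>) = r *\<^sub>R ketbra \<psi> \<psi>))"


section \<open>Complete positivity\<close>

text \<open>The space \<open>\<H> \<otimes> \<complex>\<^sup>n\<close> is \<open>\<H>\<^sup>n\<close>: the vector \<open>\<Sum>i<n. v i \<otimes> e\<^sub>i\<close> is represented by \<open>v\<close>, and the
  operator \<open>\<Sum>i<n. \<Sum>j<n. A i j \<otimes> |e\<^sub>i\<rangle>\<langle>e\<^sub>j|\<close> by the family of blocks \<open>A\<close>.\<close>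

type_synonym 'h block_op = "nat \<Rightarrow> nat \<Rightarrow> 'h op"

definition block_herm :: "nat \<Rightarrow> 'h::fin_dim_complex_hilbert block_op set" where
  "block_herm n = {A. \<forall>i<n. \<forall>j<n. clinear_op (A i j) \<and>
     (\<forall>x y. cinner (A i j x) y = cinner x (A j i y))}"

definition block_pos :: "nat \<Rightarrow> 'h::fin_dim_complex_hilbert block_op set" where
  "block_pos n = {A \<in> block_herm n. \<forall>v. 0 \<le> Re (\<Sum>i<n. \<Sum>j<n. cinner (v i) (A i j (v j)))}"

definition op_tensor :: "'h::fin_dim_complex_hilbert op \<Rightarrow> (nat \<Rightarrow> nat \<Rightarrow> complex) \<Rightarrow> 'h block_op" where
  "op_tensor X M = (\<lambda>i j. scaleC_op (M i j) X)"

text \<open>The blocks of a Hermitian operator need not be Hermitian, so \<open>T \<otimes> id\<close> acts on them by the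
  complex-linear extension of \<open>T\<close>. Lemma \<open>tensor_id_op_tensor\<close> below states that this is the map
  with \<open>X \<otimes> M \<mapsto> T X \<otimes> M\<close>.\<close>

definition complex_extension ::
  "('h::fin_dim_complex_hilbert op \<Rightarrow> 'h op) \<Rightarrow> 'h op \<Rightarrow> 'h op" where
  "complex_extension T Z =
     (THE W. \<exists>X\<in>herm. \<exists>Y\<in>herm. Z = X + scaleC_op \<i> Y \<and> W = T X + scaleC_op \<i> (T Y))"

definition tensor_id ::
  "('h::fin_dim_complex_hilbert op \<Rightarrow> 'h op) \<Rightarrow> 'h block_op \<Rightarrow> 'h block_op" where
  "tensor_id T A = (\<lambda>i j. complex_extension T (A i j))"

definition completely_positive :: "('h::fin_dim_complex_hilbert op \<Rightarrow> 'h op) \<Rightarrow> bool" where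
  "completely_positive T \<longleftrightarrow> operation T \<and> (\<forall>n. tensor_id T ` block_pos n \<subseteq> block_pos n)"

lemma herm_scaleR: "X \<in> herm \<Longrightarrow> r *\<^sub>R X \<in> herm"
  by (auto simp: herm_def clinear_op_def blinfun.scaleR_left scaleR_scaleC scaleC_scaleC
      cinner_scaleC_left cinner_scaleC_right mult.commute)

lemma herm_decomposition_unique:
  assumes "X \<in> herm" "Y \<in> herm" "X' \<in> herm" "Y' \<in> herm"
    and eq: "X + scaleC_op \<i> Y = X' + scaleC_op \<i> Y'"
  shows "X = X' \<and> Y = Y'"
proof -
  have sa: "cinner (Z x) y = cinner x (Z y)" if "Z \<in> herm" for Z :: "'a op" and x y
    using that by (simp add: herm_def)
  have a: "cinner x (X y) + \<i> * cinner x (Y y) = cinner x (X' y) + \<i> * cinner x (Y' y)" for x y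
    using arg_cong[OF eq, of "\<lambda>Z. cinner x (Z y)"]
    by (simp add: blinfun.add_left cinner_add_right cinner_scaleC_right)
  have b: "cinner x (X y) - \<i> * cinner x (Y y) = cinner x (X' y) - \<i> * cinner x (Y' y)" for x y
    using arg_cong[OF a[of y x], of cnj] assms(1-4)
    by (simp flip: cinner_commute add: sa)
  have X: "cinner x (X y) = cinner x (X' y)" and Y: "cinner x (Y y) = cinner x (Y' y)" for x y
    using a[of x y] b[of x y] by (simp_all add: complex_eq_iff)
  have "inner x (X y) = inner x (X' y)" "inner x (Y y) = inner x (Y' y)" for x y
    by (simp_all add: inner_eq_Re_cinner X Y)
  then have "X y = X' y" "Y y = Y' y" for y
    by (metis vector_eq_rdot inner_commute)+
  then show ?thesis
    by (auto intro: blinfun_eqI)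
qed

lemma complex_extension_eq:
  assumes "X \<in> herm" "Y \<in> herm"
  shows "complex_extension T (X + scaleC_op \<i> Y) = T X + scaleC_op \<i> (T Y)"
  unfolding complex_extension_def using assms herm_decomposition_unique by (intro the_equality) blast+

lemma tensor_id_op_tensor:
  assumes "operation T" "X \<in> herm"
  shows "tensor_id T (op_tensor X M) = op_tensor (T X) M"
proof -
  have *: "scaleC_op c Z = Re c *\<^sub>R Z + scaleC_op \<i> (Im c *\<^sub>R Z)" for c and Z :: "'a op"
    by (rule blinfun_eqI)
      (simp add: blinfun.add_left blinfun.scaleR_left scaleR_scaleC scaleC_scaleC
        flip: scaleC_add_left complex_eq)
  have "complex_extension T (scaleC_op c X) = scaleC_op c (T X)" for c
    using assms by (subst (1 2) *) (simp add: complex_extension_eq herm_scaleR operation_def)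
  then show ?thesis
    by (simp add: tensor_id_def op_tensor_def)
qed


section \<open>Orientation\<close>

text \<open>The affine dimension is spelled out as the dimension of the span of the differences, since
  \<^const>\<open>aff_dim\<close> is restricted to Euclidean spaces.\<close>

definition faces3 :: "'h::fin_dim_complex_hilbert op set set" where
  "faces3 = {F. F face_of states \<and> dim {V - W |V W. V \<in> F \<and> W \<in> F} = 3}"

definition op_support :: "'h::fin_dim_complex_hilbert op \<Rightarrow> 'h set" where
  "op_support X = {y. \<forall>x. X x = 0 \<longrightarrow> cinner x y = 0}"

text \<open>\<open>(\<phi>, \<psi>)\<close> is an orthonormal basis of the two-dimensional subspace to which \<open>F\<close> belongs.\<close>

definition face_basis :: "'h::fin_dim_complex_hilbert op set \<Rightarrow> 'h \<Rightarrow> 'h \<Rightarrow> bool" where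
  "face_basis F \<phi> \<psi> \<longleftrightarrow> norm \<phi> = 1 \<and> norm \<psi> = 1 \<and> cinner \<phi> \<psi> = 0 \<and>
     F = {W \<in> states. op_support W \<subseteq> cvec.span {\<phi>, \<psi>}}"

text \<open>\<open>B(F)\<close> is the real span \<open>span F\<close>. Quadruples are indexed by the type \<^typ>\<open>4\<close>, whose elements
  are \<open>0, 1, 2, 3\<close>.\<close>

definition std_basis :: "'h::fin_dim_complex_hilbert \<Rightarrow> 'h \<Rightarrow> 4 \<Rightarrow> 'h op" where
  "std_basis \<phi> \<psi> j =
    (if j = 0 then (1 / sqrt 2) *\<^sub>R (ketbra \<phi> \<phi> + ketbra \<psi> \<psi>)
     else if j = 1 then (1 / sqrt 2) *\<^sub>R (ketbra \<phi> \<psi> + ketbra \<psi> \<phi>)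
     else if j = 2 then scaleC_op (\<i> / complex_of_real (sqrt 2)) (- ketbra \<phi> \<psi> + ketbra \<psi> \<phi>)
     else (1 / sqrt 2) *\<^sub>R (ketbra \<phi> \<phi> - ketbra \<psi> \<psi>))"

definition alternating_form :: "'v::real_vector set \<Rightarrow> ((4 \<Rightarrow> 'v) \<Rightarrow> real) \<Rightarrow> bool" where
  "alternating_form V D \<longleftrightarrow>
     (\<forall>X\<in>UNIV \<rightarrow> V. \<forall>i. \<forall>Y\<in>V. \<forall>Z\<in>V. D (X(i := Y + Z)) = D (X(i := Y)) + D (X(i := Z))) \<and>
     (\<forall>X\<in>UNIV \<rightarrow> V. \<forall>i. \<forall>r. \<forall>Y\<in>V. D (X(i := r *\<^sub>R Y)) = r * D (X(i := Y))) \<and>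
     (\<forall>X\<in>UNIV \<rightarrow> V. \<forall>i j. i \<noteq> j \<and> X i = X j \<longrightarrow> D X = 0)"

text \<open>Only the values on quadruples from \<open>span F\<close> are determined.\<close>

definition Det :: "'h::fin_dim_complex_hilbert op set \<Rightarrow> (4 \<Rightarrow> 'h op) \<Rightarrow> real" where
  "Det F = (SOME D. alternating_form (span F) D \<and>
     (\<forall>\<phi> \<psi>. face_basis F \<phi> \<psi> \<longrightarrow> D (std_basis \<phi> \<psi>) = 1))"

definition orientation_preserving :: "('h::fin_dim_complex_hilbert op \<Rightarrow> 'h op) \<Rightarrow> bool" where
  "orientation_preserving T \<longleftrightarrow>
     (\<forall>F\<in>faces3. \<exists>F'\<in>faces3. T ` span F \<subseteq> span F') \<and>
     (\<forall>F\<in>faces3. \<forall>F'\<in>faces3. T ` span F \<subseteq> span F' \<longrightarrow>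
        (\<forall>X\<in>UNIV \<rightarrow> span F. 0 \<le> Det F X \<longrightarrow> 0 \<le> Det F' (T \<circ> X)))"

end

theory Submission
  imports Defs
begin

text \<open>Write \<open>L g h\<close> for the complex-linear extension of \<open>T\<close> applied to \<open>|g\<rangle>\<langle>h|\<close>. Purity says that
  \<open>L g g\<close> has rank at most one for every \<open>g\<close>; polarising the vanishing of its \<open>2 \<times> 2\<close> minors gives
  \<open>L a b \<and> L c d = - L a d \<and> L c b\<close>. These relations leave three possibilities: all \<open>L g h\<close> are
  multiples of one \<open>|\<psi>\<rangle>\<langle>\<psi>|\<close>; or \<open>L g h = |A g\<rangle>\<langle>A h|\<close> with \<open>A\<close> linear, that is \<open>T X = A X A\<^sup>*\<close>; or \<open>T\<close> acts
  on some plane as a transposition followed by an invertible congruence. In the first case both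
  properties hold, the determinants being zero. In the second both hold, since \<open>X \<mapsto> A X A\<^sup>*\<close> has
  determinant \<open>|det A|\<^sup>4\<close> on Hermitian \<open>2 \<times> 2\<close> matrices. In the third both fail, since the
  transposition reverses the orientation and is not 2-positive.\<close>

section \<open>Complex inner products and orthonormal bases\<close>

text \<open>A minor of \<open>L g g\<close> is linear in its two kets and antilinear in its two
  bras. Varying the phase of a vector therefore separates the contributions, and the condition on
  the diagonal can be polarised in kets and bras independently. For \<open>a = c\<close> or
  \<open>b = d\<close> the relations say that one value of \<open>L\<close> is tangent, at another
  value, to the set of rank-one operators. Two such tangent spaces have a small intersection. This
  is why two independent values \<open>L e e\<close> and \<open>L f f\<close> determine all others
  up to one binary choice, made by \<open>L e f\<close>. The exponent 4 arises because the Hermitian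
  2 by 2 matrices complexify to the tensor product of a plane with its conjugate, on which the
  congruence acts as \<open>A\<close> tensored with its conjugate; the determinant is (det A)^2
  times its conjugate. Two definitions cost extra work: \<open>Det\<close> is a choice and has to be
  matched with a coordinate formula, and \<open>faces3\<close> only mentions an affine dimension,
  from which the plane has to be recovered.\<close>

lemma cinner_zero_right [simp]: "cinner x (0 :: 'h::fin_dim_complex_hilbert) = 0"
  using cinner_scaleC_right[of x 0 x] by simp

lemma cinner_zero_left [simp]: "cinner (0 :: 'h::fin_dim_complex_hilbert) x = 0"
  using cinner_scaleC_left[of 0 x x] by simp

lemma cinner_minus_right: "cinner x (- y) = - cinner x y"
  for x y :: "'h::fin_dim_complex_hilbert"
  using cinner_add_right[of x y "- y"] by (simp add: add_eq_0_iff)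

lemma cinner_minus_left: "cinner (- x) y = - cinner x y"
  for x y :: "'h::fin_dim_complex_hilbert"
  using cinner_add_left[of x "- x" y] by (simp add: add_eq_0_iff)

lemma cinner_diff_right: "cinner x (y - z) = cinner x y - cinner x z"
  for x y z :: "'h::fin_dim_complex_hilbert"
  by (simp only: diff_conv_add_uminus cinner_add_right cinner_minus_right)

lemma cinner_diff_left: "cinner (x - y) z = cinner x z - cinner y z"
  for x y z :: "'h::fin_dim_complex_hilbert"
  by (simp only: diff_conv_add_uminus cinner_add_left cinner_minus_left)

lemma cinner_scaleR_right: "cinner x (r *\<^sub>R y) = of_real r * cinner x y"
  for x y :: "'h::fin_dim_complex_hilbert"
  by (simp add: scaleR_scaleC cinner_scaleC_right)

lemma cinner_scaleR_left: "cinner (r *\<^sub>R x) y = of_real r * cinner x y"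
  for x y :: "'h::fin_dim_complex_hilbert"
  by (simp add: scaleR_scaleC cinner_scaleC_left)

lemma cinner_sum_right: "cinner x (\<Sum>i\<in>I. f i) = (\<Sum>i\<in>I. cinner x (f i))"
  for x :: "'h::fin_dim_complex_hilbert"
  by (induction I rule: infinite_finite_induct) (simp_all add: cinner_add_right)

lemma cinner_sum_left: "cinner (\<Sum>i\<in>I. f i) x = (\<Sum>i\<in>I. cinner (f i) x)"
  for x :: "'h::fin_dim_complex_hilbert"
  by (induction I rule: infinite_finite_induct) (simp_all add: cinner_add_left)

lemmas cinner_simps = cinner_add_right cinner_add_left cinner_minus_right cinner_minus_left
  cinner_diff_right cinner_diff_left cinner_scaleC_right cinner_scaleC_left
  cinner_scaleR_right cinner_scaleR_left

lemma cinner_self: "cinner x x = of_real ((norm x)\<^sup>2)"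
  for x :: "'h::fin_dim_complex_hilbert"
  using cinner_commute[of x x] inner_eq_Re_cinner[of x x]
  by (simp add: complex_eq_iff dot_square_norm)

lemma cinner_self_eq_0_iff [simp]: "cinner x x = 0 \<longleftrightarrow> x = 0"
  for x :: "'h::fin_dim_complex_hilbert"
  by (simp add: cinner_self)

lemma cinner_ext_right:
  assumes "\<And>z. cinner z x = cinner z y"
  shows "x = (y :: 'h::fin_dim_complex_hilbert)"
  using assms[of "x - y"] cinner_self_eq_0_iff[of "x - y"] by (simp add: cinner_diff_right)

lemma cinner_unit: "norm x = 1 \<Longrightarrow> cinner x x = 1"
  for x :: "'h::fin_dim_complex_hilbert"
  by (simp add: cinner_self)

lemma cinner_orthogonal_commute: "cinner x y = 0 \<Longrightarrow> cinner y x = 0"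
  for x y :: "'h::fin_dim_complex_hilbert"
  by (metis cinner_commute complex_cnj_zero)

lemma cinner_mult_commute: "cinner x y * cinner y x = of_real ((cmod (cinner x y))\<^sup>2)"
  for x y :: "'h::fin_dim_complex_hilbert"
  by (metis cinner_commute complex_norm_square)

section \<open>Gram-Schmidt and a fixed orthonormal basis\<close>

definition orthonormal_set :: "'h::fin_dim_complex_hilbert set \<Rightarrow> bool" where
  "orthonormal_set B \<longleftrightarrow> (\<forall>x\<in>B. \<forall>y\<in>B. cinner x y = (if x = y then 1 else 0))"

lemma gram_schmidt_residual:
  assumes "finite B" "orthonormal_set B" "b \<in> B"
  shows "cinner b (x - (\<Sum>c\<in>B. cinner c x *\<^sub>C c)) = 0"
proof -
  have "(\<Sum>c\<in>B. cinner c x * cinner b c) = (\<Sum>c\<in>B. if b = c then cinner c x else 0)"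
    using assms by (intro sum.cong) (auto simp: orthonormal_set_def)
  then show ?thesis
    using assms by (simp add: cinner_simps cinner_sum_right)
qed

lemma unit_multiple:
  assumes "r \<noteq> (0 :: 'h::fin_dim_complex_hilbert)"
  shows "norm ((1 / of_real (norm r)) *\<^sub>C r) = 1"
  using assms by (simp add: norm_scaleC norm_divide)

lemma gram_schmidt:
  assumes "finite S"
  shows "\<exists>B :: 'h::fin_dim_complex_hilbert set. finite B \<and> orthonormal_set B \<and> S \<subseteq> cvec.span B"
  using assms
proof (induction S)
  case empty
  show ?case by (intro exI[of _ "{}"]) (simp add: orthonormal_set_def)
next
  case (insert x S)
  then obtain B where B: "finite B" "orthonormal_set B" "S \<subseteq> cvec.span B" by blast
  define r where "r = x - (\<Sum>c\<in>B. cinner c x *\<^sub>C c)"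
  have r_orth: "cinner b r = 0" if "b \<in> B" for b
    using gram_schmidt_residual[OF B(1,2) that] by (simp add: r_def)
  have x_eq: "x = r + (\<Sum>c\<in>B. cinner c x *\<^sub>C c)" by (simp add: r_def)
  have sum_in: "(\<Sum>c\<in>B. cinner c x *\<^sub>C c) \<in> cvec.span B"
    by (intro cvec.span_sum cvec.span_scale cvec.span_base)
  show ?case
  proof (cases "r = 0")
    case True
    then show ?thesis using B sum_in x_eq by (intro exI[of _ B]) auto
  next
    case False
    define u where "u = (1 / of_real (norm r)) *\<^sub>C r"
    have r_eq: "r = of_real (norm r) *\<^sub>C u"
      using False by (simp add: u_def scaleC_scaleC scaleC_one)
    have "norm u = 1" using unit_multiple[OF False] by (simp add: u_def)
    then have uu: "cinner u u = 1" by (rule cinner_unit)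
    have bu: "cinner b u = 0" if "b \<in> B" for b
      using r_orth[OF that] by (simp add: u_def cinner_simps)
    then have ub: "cinner u b = 0" if "b \<in> B" for b
      using that cinner_orthogonal_commute by blast
    have "orthonormal_set (insert u B)"
      using B(2) uu bu ub by (auto simp: orthonormal_set_def)
    moreover have "x \<in> cvec.span (insert u B)"
      by (subst x_eq, subst r_eq)
        (intro cvec.span_add cvec.span_scale cvec.span_base insertI1
          subsetD[OF cvec.span_mono[OF subset_insertI] sum_in])
    moreover have "S \<subseteq> cvec.span (insert u B)"
      using B(3) cvec.span_mono[of B "insert u B"] by blast
    ultimately show ?thesis
      using B(1) by (intro exI[of _ "insert u B"]) auto
  qed
qed

lemma ex_orthonormal_basis: "\<exists>B :: 'h::fin_dim_complex_hilbert set. orthonormal_basis B"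
proof -
  obtain S :: "'h set" where S: "finite S" "\<forall>x. \<exists>u. x = (\<Sum>b\<in>S. u b *\<^sub>C b)"
    using finite_dimensional by blast
  obtain B where B: "finite B" "orthonormal_set B" "S \<subseteq> cvec.span B"
    using gram_schmidt[OF S(1)] by blast
  have "x \<in> cvec.span B" for x
  proof -
    obtain u where "x = (\<Sum>b\<in>S. u b *\<^sub>C b)" using S(2) by blast
    then show ?thesis
      using B(3) by (auto intro!: cvec.span_sum cvec.span_scale)
  qed
  then show ?thesis
    using B by (auto simp: orthonormal_basis_def orthonormal_set_def)
qed

definition onb :: "'h::fin_dim_complex_hilbert set" where
  "onb = (SOME B. orthonormal_basis B)"

lemma orthonormal_basis_onb: "orthonormal_basis onb"
  unfolding onb_def by (rule someI_ex[OF ex_orthonormal_basis])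

lemma onb_finite [simp]: "finite onb"
  and onb_orthonormal: "orthonormal_set onb"
  and onb_span: "cvec.span onb = UNIV"
  using orthonormal_basis_onb by (auto simp: orthonormal_basis_def orthonormal_set_def)

lemma onb_expansion: "(\<Sum>b\<in>onb. cinner b x *\<^sub>C b) = x"
proof -
  define r where "r = x - (\<Sum>b\<in>onb. cinner b x *\<^sub>C b)"
  have b: "b \<in> onb \<Longrightarrow> cinner b r = 0" for b
    unfolding r_def by (rule gram_schmidt_residual[OF onb_finite onb_orthonormal])
  have "r \<in> cvec.span onb" by (simp add: onb_span)
  then have "cinner r r = 0"
  proof (rule cvec.span_induct[where P = "\<lambda>y. cinner y r = 0"])
    show "cvec.subspace {y. cinner y r = 0}"
      by (rule cvec.subspaceI) (auto simp: cinner_simps)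
  qed (blast intro: b cinner_orthogonal_commute)
  then show ?thesis by (simp add: r_def)
qed

lemma parseval: "(\<Sum>b\<in>onb. cinner x b * cinner b y) = cinner x y"
proof -
  have "cinner x (\<Sum>b\<in>onb. cinner b y *\<^sub>C b) = (\<Sum>b\<in>onb. cinner x b * cinner b y)"
    by (simp add: cinner_sum_right cinner_simps mult.commute)
  then show ?thesis by (simp add: onb_expansion)
qed

section \<open>Operators\<close>

lemmas op_simps = blinfun.add_left blinfun.diff_left blinfun.minus_left blinfun.scaleR_left
  blinfun.zero_left blinfun.sum_left

lemma ketbra_add_left: "ketbra (x + y) z = ketbra x z + ketbra y z"
  and ketbra_add_right: "ketbra z (x + y) = ketbra z x + ketbra z y"
  and ketbra_scaleC_left: "ketbra (c *\<^sub>C x) z = scaleC_op c (ketbra x z)"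
  and ketbra_scaleC_right: "ketbra z (c *\<^sub>C x) = scaleC_op (cnj c) (ketbra z x)"
  for x y z :: "'h::fin_dim_complex_hilbert"
  by (auto intro!: blinfun_eqI simp: op_simps scaleC_add_right scaleC_add_left scaleC_scaleC
      cinner_simps mult.commute)

lemma scaleC_op_add_right: "scaleC_op c (X + Y) = scaleC_op c X + scaleC_op c Y"
  and scaleC_op_add_left: "scaleC_op (c + d) X = scaleC_op c X + scaleC_op d X"
  and scaleC_op_scaleC_op: "scaleC_op c (scaleC_op d X) = scaleC_op (c * d) X"
  and scaleC_op_of_real: "scaleC_op (of_real r) X = r *\<^sub>R X"
  and scaleC_op_one [simp]: "scaleC_op 1 X = X"
  and scaleC_op_minus_one [simp]: "scaleC_op (- 1) X = - X"
  and scaleC_op_zero [simp]: "scaleC_op 0 X = 0"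
  and scaleC_op_zero_right [simp]: "scaleC_op c 0 = 0"
  and scaleC_op_minus_right: "scaleC_op c (- X) = - scaleC_op c X"
  by (auto intro!: blinfun_eqI simp: op_simps scaleC_add_right scaleC_add_left scaleC_scaleC
      scaleR_scaleC scaleC_one cvec.scale_minus_left cvec.scale_minus_right cvec.scale_zero_left)

lemma clinear_op_add: "clinear_op X \<Longrightarrow> clinear_op Y \<Longrightarrow> clinear_op (X + Y)"
  and clinear_op_scaleC_op: "clinear_op X \<Longrightarrow> clinear_op (scaleC_op c X)"
  and clinear_op_ketbra: "clinear_op (ketbra x y)"
  and clinear_op_zero: "clinear_op 0"
  by (auto simp: clinear_op_def op_simps scaleC_add_right scaleC_scaleC cinner_simps mult.commute)

lemma clinear_op_scaleR: "clinear_op X \<Longrightarrow> clinear_op (r *\<^sub>R X)"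
  using clinear_op_scaleC_op[of X "of_real r"] by (simp add: scaleC_op_of_real)

lemma clinear_op_minus: "clinear_op X \<Longrightarrow> clinear_op (- X)"
  using clinear_op_scaleR[of X "-1"] by simp

lemma clinear_op_diff: "clinear_op X \<Longrightarrow> clinear_op Y \<Longrightarrow> clinear_op (X - Y)"
  using clinear_op_add[of X "- Y"] clinear_op_minus[of Y] by simp

lemma clinear_op_sum: "(\<And>i. i \<in> I \<Longrightarrow> clinear_op (f i)) \<Longrightarrow> clinear_op (\<Sum>i\<in>I. f i)"
  by (induction I rule: infinite_finite_induct) (auto intro: clinear_op_add clinear_op_zero)

lemma op_expansion:
  assumes "clinear_op X"
  shows "X = (\<Sum>b\<in>onb. ketbra (X b) b)"
proof (rule blinfun_eqI)
  fix x
  have "X x = X (\<Sum>b\<in>onb. cinner b x *\<^sub>C b)" by (simp add: onb_expansion)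
  also have "\<dots> = (\<Sum>b\<in>onb. ketbra (X b) b) x"
    using assms by (simp add: blinfun.sum_right blinfun.sum_left clinear_op_def)
  finally show "X x = (\<Sum>b\<in>onb. ketbra (X b) b) x" .
qed

text \<open>A relation rather than an adjoint function: the opposite blocks \<open>A i j\<close> and
  \<open>A j i\<close> of a Hermitian block operator form exactly such a pair, and Hermitian
  operators are paired with themselves.\<close>

definition adj_pair :: "'h::fin_dim_complex_hilbert op \<Rightarrow> 'h op \<Rightarrow> bool" where
  "adj_pair X Y \<longleftrightarrow> clinear_op X \<and> clinear_op Y \<and> (\<forall>x y. cinner (X x) y = cinner x (Y y))"

lemma herm_iff_adj_pair: "X \<in> herm \<longleftrightarrow> adj_pair X X"
  by (simp add: herm_def adj_pair_def)

lemma adj_pair_cinner: "adj_pair X Y \<Longrightarrow> cinner (X x) y = cinner x (Y y)"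
  by (simp add: adj_pair_def)

lemma herm_cinner: "X \<in> herm \<Longrightarrow> cinner (X x) y = cinner x (X y)"
  by (simp add: herm_def)

lemma herm_clinear: "X \<in> herm \<Longrightarrow> clinear_op X"
  by (simp add: herm_def)

lemma adj_pair_add: "adj_pair X X' \<Longrightarrow> adj_pair Y Y' \<Longrightarrow> adj_pair (X + Y) (X' + Y')"
  by (auto simp: adj_pair_def clinear_op_add op_simps cinner_simps)

lemma adj_pair_scaleC_op: "adj_pair X X' \<Longrightarrow> adj_pair (scaleC_op c X) (scaleC_op (cnj c) X')"
  by (auto simp: adj_pair_def clinear_op_scaleC_op cinner_simps)

lemma adj_pair_scaleR: "adj_pair X X' \<Longrightarrow> adj_pair (r *\<^sub>R X) (r *\<^sub>R X')"
  using adj_pair_scaleC_op[of X X' "of_real r"] by (simp add: scaleC_op_of_real)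

lemma adj_pair_commute: "adj_pair X Y \<Longrightarrow> adj_pair Y X"
  unfolding adj_pair_def by (metis cinner_commute)

lemma adj_pair_ketbra: "adj_pair (ketbra x y) (ketbra y x)"
  unfolding adj_pair_def
  by (auto simp: clinear_op_ketbra cinner_simps simp flip: cinner_commute)

lemma adj_pair_zero: "adj_pair 0 0"
  by (simp add: adj_pair_def clinear_op_zero)

lemma adj_pair_sum:
  "(\<And>i. i \<in> I \<Longrightarrow> adj_pair (f i) (g i)) \<Longrightarrow> adj_pair (\<Sum>i\<in>I. f i) (\<Sum>i\<in>I. g i)"
  by (induction I rule: infinite_finite_induct) (auto intro: adj_pair_add adj_pair_zero)

lemma ex_adjoint: "clinear_op X \<Longrightarrow> \<exists>Y. adj_pair X Y"
  using adj_pair_sum[of onb "\<lambda>b. ketbra (X b) b" "\<lambda>b. ketbra b (X b)"] adj_pair_ketbra op_expansion[of X]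
  by metis

lemma herm_add: "X \<in> herm \<Longrightarrow> Y \<in> herm \<Longrightarrow> X + Y \<in> herm"
  by (simp add: herm_iff_adj_pair adj_pair_add)

lemma herm_minus: "X \<in> herm \<Longrightarrow> - X \<in> herm"
  using herm_scaleR[of X "-1"] by simp

lemma herm_diff: "X \<in> herm \<Longrightarrow> Y \<in> herm \<Longrightarrow> X - Y \<in> herm"
  using herm_add[of X "- Y"] by (simp add: herm_minus)

lemma herm_zero: "0 \<in> herm"
  by (simp add: herm_iff_adj_pair adj_pair_zero)

lemma herm_ketbra: "ketbra x x \<in> herm"
  by (simp add: herm_iff_adj_pair adj_pair_ketbra)

lemma pos_herm_ketbra: "ketbra x x \<in> pos_herm"
proof -
  have "cinner y (ketbra x x y) = of_real ((cmod (cinner x y))\<^sup>2)" for y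
    by (simp add: cinner_simps cinner_mult_commute)
  then show ?thesis by (simp add: pos_herm_def herm_ketbra)
qed

lemma pos_herm_scaleR: "X \<in> pos_herm \<Longrightarrow> 0 \<le> r \<Longrightarrow> r *\<^sub>R X \<in> pos_herm"
  by (simp add: pos_herm_def herm_scaleR op_simps cinner_simps)

lemma pos_herm_add: "X \<in> pos_herm \<Longrightarrow> Y \<in> pos_herm \<Longrightarrow> X + Y \<in> pos_herm"
  by (simp add: pos_herm_def herm_add op_simps cinner_simps)

lemma herm_Im_zero: "X \<in> herm \<Longrightarrow> Im (cinner x (X x)) = 0"
  using cinner_commute[of x "X x"] herm_cinner[of X x x] by (simp add: complex_eq_iff)

lemma op_eqI:
  fixes X Y :: "'h::fin_dim_complex_hilbert op"
  assumes "\<And>x y. cinner x (X y) = cinner x (Y y)"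
  shows "X = Y"
  by (rule blinfun_eqI, rule cinner_ext_right, rule assms)

subsection \<open>The complex-linear extension of an operation\<close>

text \<open>The two parts are (Z + Z') / 2 and (Z - Z') / (2 \<i>), the real and imaginary parts of
  \<open>Z\<close>.\<close>

lemma adj_pair_decomposition:
  assumes "adj_pair Z Z'"
  obtains X Y where "X \<in> herm" "Y \<in> herm" "Z = X + scaleC_op \<i> Y" "Z' = X + scaleC_op (- \<i>) Y"
proof
  have "adj_pair ((1/2) *\<^sub>R (Z + Z')) ((1/2) *\<^sub>R (Z' + Z))"
    using assms adj_pair_commute[OF assms] by (intro adj_pair_scaleR adj_pair_add)
  then show "(1/2) *\<^sub>R (Z + Z') \<in> herm" by (simp add: herm_iff_adj_pair add.commute)
  have "adj_pair (scaleC_op (-\<i>/2) Z + scaleC_op (\<i>/2) Z')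
      (scaleC_op (cnj (-\<i>/2)) Z' + scaleC_op (cnj (\<i>/2)) Z)"
    using assms adj_pair_commute[OF assms] by (intro adj_pair_scaleC_op adj_pair_add)
  then show "scaleC_op (-\<i>/2) Z + scaleC_op (\<i>/2) Z' \<in> herm"
    by (simp add: herm_iff_adj_pair add.commute)
  show "Z = (1/2) *\<^sub>R (Z + Z') + scaleC_op \<i> (scaleC_op (-\<i>/2) Z + scaleC_op (\<i>/2) Z')"
    by (rule op_eqI) (simp add: op_simps cinner_simps algebra_simps)
  show "Z' = (1/2) *\<^sub>R (Z + Z') + scaleC_op (-\<i>) (scaleC_op (-\<i>/2) Z + scaleC_op (\<i>/2) Z')"
    by (rule op_eqI) (simp add: op_simps cinner_simps algebra_simps)
qed

lemma clinear_decomposition: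
  assumes "clinear_op Z"
  obtains X Y where "X \<in> herm" "Y \<in> herm" "Z = X + scaleC_op \<i> Y"
  using ex_adjoint[OF assms] adj_pair_decomposition by metis

context
  fixes T :: "'h::fin_dim_complex_hilbert op \<Rightarrow> 'h op"
  assumes T: "operation T"
begin

lemma operation_herm: "X \<in> herm \<Longrightarrow> T X \<in> herm"
  and operation_add: "X \<in> herm \<Longrightarrow> Y \<in> herm \<Longrightarrow> T (X + Y) = T X + T Y"
  and operation_scaleR: "X \<in> herm \<Longrightarrow> T (r *\<^sub>R X) = r *\<^sub>R T X"
  and operation_pos: "X \<in> pos_herm \<Longrightarrow> T X \<in> pos_herm"
  using T by (auto simp: operation_def)

lemma operation_zero: "T 0 = 0"
  using operation_scaleR[OF herm_zero, of 0] by simp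

lemma complex_extension_herm: "X \<in> herm \<Longrightarrow> complex_extension T X = T X"
  using complex_extension_eq[of X 0 T] by (simp add: herm_zero operation_zero)

lemma complex_extension_add:
  assumes "clinear_op Z" "clinear_op W"
  shows "complex_extension T (Z + W) = complex_extension T Z + complex_extension T W"
proof -
  obtain X Y where Z: "X \<in> herm" "Y \<in> herm" "Z = X + scaleC_op \<i> Y"
    using clinear_decomposition[OF assms(1)] .
  obtain X' Y' where W: "X' \<in> herm" "Y' \<in> herm" "W = X' + scaleC_op \<i> Y'"
    using clinear_decomposition[OF assms(2)] .
  have "Z + W = (X + X') + scaleC_op \<i> (Y + Y')"
    by (simp add: Z W scaleC_op_add_right algebra_simps)
  then have "complex_extension T (Z + W) = T (X + X') + scaleC_op \<i> (T (Y + Y'))"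
    by (simp only: complex_extension_eq herm_add Z(1,2) W(1,2))
  then show ?thesis
    using Z W by (simp add: complex_extension_eq operation_add scaleC_op_add_right algebra_simps)
qed

lemma complex_extension_scaleC:
  assumes "clinear_op Z"
  shows "complex_extension T (scaleC_op c Z) = scaleC_op c (complex_extension T Z)"
proof -
  obtain X Y where Z: "X \<in> herm" "Y \<in> herm" "Z = X + scaleC_op \<i> Y"
    using clinear_decomposition[OF assms] .
  have split: "scaleC_op c (U + scaleC_op \<i> V)
      = (Re c *\<^sub>R U + (- Im c) *\<^sub>R V) + scaleC_op \<i> (Re c *\<^sub>R V + Im c *\<^sub>R U)" for U V :: "'h op"
  proof (rule op_eqI)
    fix x y
    show "cinner x (scaleC_op c (U + scaleC_op \<i> V) y) =
      cinner x (((Re c *\<^sub>R U + (- Im c) *\<^sub>R V) + scaleC_op \<i> (Re c *\<^sub>R V + Im c *\<^sub>R U)) y)"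
      by (subst (1) complex_eq[of c]) (simp add: op_simps cinner_simps algebra_simps)
  qed
  have "complex_extension T (scaleC_op c Z) =
      T (Re c *\<^sub>R X + (- Im c) *\<^sub>R Y) + scaleC_op \<i> (T (Re c *\<^sub>R Y + Im c *\<^sub>R X))"
    using Z unfolding Z(3) split by (intro complex_extension_eq herm_add herm_scaleR)
  also have "\<dots> = (Re c *\<^sub>R T X + (- Im c) *\<^sub>R T Y) + scaleC_op \<i> (Re c *\<^sub>R T Y + Im c *\<^sub>R T X)"
    using Z by (simp add: operation_add operation_scaleR herm_scaleR del: scaleR_minus_left)
  also have "\<dots> = scaleC_op c (complex_extension T Z)"
    using Z by (simp only: split complex_extension_eq)
  finally show ?thesis .
qed

lemma complex_extension_sum:
  assumes "\<And>i. i \<in> I \<Longrightarrow> clinear_op (f i)"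
  shows "complex_extension T (\<Sum>i\<in>I. f i) = (\<Sum>i\<in>I. complex_extension T (f i))"
  using assms
  by (induction I rule: infinite_finite_induct)
    (simp_all add: complex_extension_herm herm_zero operation_zero complex_extension_add clinear_op_sum)

lemma adj_pair_complex_extension:
  assumes "adj_pair Z Z'"
  shows "adj_pair (complex_extension T Z) (complex_extension T Z')"
proof -
  obtain X Y where Z: "X \<in> herm" "Y \<in> herm" "Z = X + scaleC_op \<i> Y" "Z' = X + scaleC_op (- \<i>) Y"
    using adj_pair_decomposition[OF assms] .
  have "adj_pair (T X + scaleC_op \<i> (T Y)) (T X + scaleC_op (cnj \<i>) (T Y))"
    using Z operation_herm by (intro adj_pair_add adj_pair_scaleC_op) (auto simp: herm_iff_adj_pair)
  moreover have "complex_extension T Z' = T X + scaleC_op (- \<i>) (T Y)"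
    using Z by (simp add: complex_extension_add complex_extension_scaleC complex_extension_herm
        herm_clinear clinear_op_scaleC_op)
  ultimately show ?thesis
    using Z by (simp add: complex_extension_eq)
qed

lemma tensor_id_block_herm: "A \<in> block_herm n \<Longrightarrow> tensor_id T A \<in> block_herm n"
proof -
  assume A: "A \<in> block_herm n"
  have "adj_pair (tensor_id T A i j) (tensor_id T A j i)" if "i < n" "j < n" for i j
    unfolding tensor_id_def using A that
    by (intro adj_pair_complex_extension) (auto simp: block_herm_def adj_pair_def)
  then show ?thesis by (auto simp: block_herm_def adj_pair_def)
qed

end

section \<open>Pure operations\<close>

text \<open>Three polarisations: phases separate kets from bras, then additivity in the kets gives
  \<open>semi\<close>, and additivity in the bras gives the claim.\<close>

lemma quartic_polarization:
  fixes Q :: "'h::fin_dim_complex_hilbert \<Rightarrow> 'h \<Rightarrow> 'h \<Rightarrow> 'h \<Rightarrow> complex"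
  assumes add1: "\<And>a a' b c d. Q (a + a') b c d = Q a b c d + Q a' b c d"
    and add2: "\<And>a b b' c d. Q a (b + b') c d = Q a b c d + Q a b' c d"
    and scale1: "\<And>z a b c d. Q (z *\<^sub>C a) b c d = z * Q a b c d"
    and scale2: "\<And>z a b c d. Q a (z *\<^sub>C b) c d = cnj z * Q a b c d"
    and sym: "\<And>a b c d. Q a b c d = Q c d a b"
    and diag: "\<And>a. Q a a a a = 0"
  shows "Q a b c d + Q a d c b = 0"
proof -
  have add3: "Q a b (c + c') d = Q a b c d + Q a b c' d" for a b c c' d
    by (metis sym add1)
  have add4: "Q a b c (d + d') = Q a b c d + Q a b c d'" for a b c d' d
    by (metis sym add2)
  have scale3: "Q a b (z *\<^sub>C c) d = z * Q a b c d" for z a b c d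
    by (metis sym scale1)
  have scale4: "Q a b c (z *\<^sub>C d) = cnj z * Q a b c d" for z a b c d
    by (metis sym scale2)
  note Q_simps = add1 add2 add3 add4 scale1 scale2 scale3 scale4
  have pair: "Q a b a b + Q b a b a = 0" for a b
  proof -
    let ?f = "\<lambda>z. Q (a + z *\<^sub>C b) (a + z *\<^sub>C b) (a + z *\<^sub>C b) (a + z *\<^sub>C b)"
    \<comment> \<open>At a fourth root of unity \<open>z\<close>, a term with \<open>b\<close> in m
      kets and n bras carries the factor z^(m-n). The signs keep only the terms with m-n equal to 2
      or -2.\<close>
    have "?f 1 + ?f (- 1) - ?f \<i> - ?f (- \<i>) = 4 * (Q a b a b + Q b a b a)"
      by (simp only: Q_simps) (simp add: algebra_simps)
    then have "4 * (Q a b a b + Q b a b a) = 0" by (simp only: diag) simp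
    then show ?thesis by (simp only: mult_eq_0_iff) simp
  qed
  \<comment> \<open>Scaling \<open>b\<close> by \<open>1 + \<i>\<close> multiplies the two terms of
    \<open>pair\<close> by \<open>- 2 * \<i>\<close> and \<open>2 * \<i>\<close>, so their
    difference vanishes as well as their sum.\<close>
  have square: "Q a b a b = 0" for a b
    using pair[of a b] pair[of a "(1 + \<i>) *\<^sub>C b"]
    by (simp add: Q_simps algebra_simps)
  have semi: "Q a b c b = 0" for a b c
    using sym[of c b a b] square[of "a + c" b] square[of a b] square[of c b]
    by (simp add: Q_simps)
  show ?thesis
    using semi[of a "b + d" c] semi[of a b c] semi[of a d c] by (simp add: Q_simps add.commute)
qed

text \<open>The coefficient of \<open>x \<and> y\<close>, \<open>x' \<and> y'\<close> in the symmetrised \<open>M \<and> N\<close>; it vanishes identically for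
  \<open>M = N\<close> iff \<open>M\<close> has rank at most one.\<close>

definition wedge ::
  "'h::fin_dim_complex_hilbert op \<Rightarrow> 'h op \<Rightarrow> 'h \<Rightarrow> 'h \<Rightarrow> 'h \<Rightarrow> 'h \<Rightarrow> complex" where
  "wedge M N x y x' y' = cinner x (M x') * cinner y (N y') - cinner x (M y') * cinner y (N x')
     - cinner y (M x') * cinner x (N y') + cinner y (M y') * cinner x (N x')"

lemma wedge_commute: "wedge M N x y x' y' = wedge N M x y x' y'"
  by (simp add: wedge_def)

lemma wedge_ketbra_self: "wedge (ketbra p q) (ketbra p q) x y x' y' = 0"
  by (simp add: wedge_def cinner_simps)

section \<open>Independent pairs and tangency to the rank-one operators\<close>

definition independent2 :: "'h::fin_dim_complex_hilbert \<Rightarrow> 'h \<Rightarrow> bool" where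
  "independent2 a b \<longleftrightarrow> a \<noteq> 0 \<and> (\<forall>c. b \<noteq> c *\<^sub>C a)"

text \<open>Dual vectors read off coefficients: later identities are evaluated at \<open>p\<close>
  and \<open>q\<close>. Here \<open>q\<close> is the normalised part of \<open>b\<close> orthogonal
  to \<open>a\<close>, and \<open>p\<close> is a multiple of \<open>a\<close> corrected by a
  multiple of \<open>q\<close>.\<close>

lemma independent2_dual:
  assumes "independent2 a b"
  obtains p q where "cinner p a = 1" "cinner p b = 0" "cinner q a = 0" "cinner q b = 1"
proof -
  define r where "r = b - (cinner a b / cinner a a) *\<^sub>C a"
  have a: "a \<noteq> 0" and r: "r \<noteq> 0" using assms by (auto simp: independent2_def r_def)
  have ra: "cinner r a = 0"
    using a by (simp add: r_def cinner_simps flip: cinner_commute)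
  have "cinner r b = cinner r r"
    using ra by (subst (3) r_def) (simp add: cinner_simps)
  define q where "q = (1 / cinner r r) *\<^sub>C r"
  have q: "cinner q a = 0" "cinner q b = 1"
    using r ra \<open>cinner r b = cinner r r\<close> by (simp_all add: q_def cinner_simps flip: cinner_commute)
  define p where "p = (1 / cinner a a) *\<^sub>C a - (cnj (cinner a b / cinner a a)) *\<^sub>C q"
  have "cinner p a = 1" "cinner p b = 0"
    using a q by (simp_all add: p_def cinner_simps flip: cinner_commute)
  with q that show ?thesis by blast
qed

lemma independent2_commute: "independent2 a b \<Longrightarrow> independent2 b a"
proof -
  assume "independent2 a b"
  then obtain p q where "cinner p a = 1" "cinner p b = 0" "cinner q a = 0" "cinner q b = 1"
    by (rule independent2_dual)
  then show ?thesis by (auto simp: independent2_def cinner_simps)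
qed

lemma orthogonal_complement_line:
  assumes "\<And>x. cinner x a = 0 \<Longrightarrow> cinner x y = 0"
  shows "y = (cinner a y / cinner a a) *\<^sub>C (a :: 'h::fin_dim_complex_hilbert)"
proof (cases "a = 0")
  case True
  then show ?thesis using assms[of y] by simp
next
  case False
  define r where "r = y - (cinner a y / cinner a a) *\<^sub>C a"
  have "cinner r a = 0"
    using False by (simp add: r_def cinner_simps flip: cinner_commute)
  then have "cinner r r = 0"
    using assms[of r] by (subst (2) r_def) (simp add: cinner_simps)
  then show ?thesis by (simp add: r_def)
qed

text \<open>The operators tangent to rank one at \<open>ketbra a c\<close> are the sums of some
  \<open>ketbra a u\<close> and \<open>ketbra w c\<close>. Tangency at both
  \<open>ketbra a a\<close> and \<open>ketbra a b\<close> forces \<open>w\<close> into the line of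
  \<open>a\<close>, since the bras \<open>a\<close> and \<open>b\<close> are independent.\<close>

lemma wedge_zero_range:
  assumes ind: "independent2 a b"
    and wa: "\<And>x y x' y'. wedge M (ketbra a a) x y x' y' = 0"
    and wb: "\<And>x y x' y'. wedge M (ketbra a b) x y x' y' = 0"
  shows "M v = (cinner a (M v) / cinner a a) *\<^sub>C a"
proof (rule orthogonal_complement_line)
  fix x assume x: "cinner x a = 0"
  obtain p q where pq: "cinner p a = 1" "cinner p b = 0" "cinner q a = 0" "cinner q b = 1"
    using independent2_dual[OF ind] .
  have aq: "cinner a q = 0" "cinner b q = 1" using pq by (metis cinner_commute complex_cnj_zero complex_cnj_one)+
  have a: "cinner a a \<noteq> 0" using ind by (simp add: independent2_def)
  have "cinner x (M q) = 0"
    using wa[of x a a q] x aq a by (simp add: wedge_def cinner_simps)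
  then show "cinner x (M v) = 0"
    using wb[of x a v q] x aq a by (simp add: wedge_def cinner_simps)
qed

text \<open>The two points of tangency now differ in ket and in bra, and their tangent spaces meet
  only in the span of \<open>ketbra a b\<close> and \<open>ketbra b a\<close>. This is the origin of
  the alternative between congruence and transposition.\<close>

lemma wedge_zero_cross:
  assumes ind: "independent2 a b"
    and wa: "\<And>x y x' y'. wedge M (ketbra a a) x y x' y' = 0"
    and wb: "\<And>x y x' y'. wedge M (ketbra b b) x y x' y' = 0"
  obtains c d where "M = scaleC_op c (ketbra a b) + scaleC_op d (ketbra b a)"
proof -
  obtain p q where pq: "cinner p a = 1" "cinner p b = 0" "cinner q a = 0" "cinner q b = 1"
    using independent2_dual[OF ind] .
  have qp: "cinner a p = 1" "cinner b p = 0" "cinner a q = 0" "cinner b q = 1"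
    using pq by (metis cinner_commute complex_cnj_zero complex_cnj_one)+
  have A: "cinner x (M v) = cinner a v * cinner x (M p)" if "cinner x a = 0" for x v
    using wa[of x p v p] that pq qp by (simp add: wedge_def cinner_simps)
  have B: "cinner x (M v) = cinner b v * cinner x (M q)" if "cinner x b = 0" for x v
    using wb[of x q v q] that pq qp by (simp add: wedge_def cinner_simps)
  have AB: "cinner x (M v) = 0" if "cinner x a = 0" "cinner x b = 0" for x v
    using A[OF that(1), of v] B[OF that(2), of p] qp by simp
  have eq: "cinner x (M v) = cinner p (M q) * cinner b v * cinner x a
      + cinner q (M p) * cinner a v * cinner x b" for x v
  proof -
    define y where "y = x - cinner a x *\<^sub>C p - cinner b x *\<^sub>C q"
    have x: "x = y + (cinner a x *\<^sub>C p + cinner b x *\<^sub>C q)" by (simp add: y_def)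
    have "cinner y a = 0" "cinner y b = 0"
      using pq by (simp_all add: y_def cinner_simps flip: cinner_commute)
    then have "cinner y (M v) = 0" by (rule AB)
    then have "cinner x (M v) = cinner x a * cinner p (M v) + cinner x b * cinner q (M v)"
      by (subst x) (simp add: cinner_simps flip: cinner_commute)
    then show ?thesis
      using A[OF pq(3), of v] B[OF pq(2), of v] by simp
  qed
  have "M = scaleC_op (cinner p (M q)) (ketbra a b) + scaleC_op (cinner q (M p)) (ketbra b a)"
    by (rule op_eqI, subst eq) (simp add: op_simps cinner_simps)
  with that show ?thesis by blast
qed

section \<open>The values of an operation on ket-bras\<close>

context
  fixes T :: "'h::fin_dim_complex_hilbert op \<Rightarrow> 'h op"
  assumes T: "operation T"
begin

abbreviation L :: "'h \<Rightarrow> 'h \<Rightarrow> 'h op" where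
  "L g h \<equiv> complex_extension T (ketbra g h)"

lemma L_diag: "L g g = T (ketbra g g)"
  by (simp add: complex_extension_herm[OF T] herm_ketbra)

lemma L_add_left: "L (g + g') h = L g h + L g' h"
  and L_add_right: "L g (h + h') = L g h + L g h'"
  and L_scaleC_left: "L (c *\<^sub>C g) h = scaleC_op c (L g h)"
  and L_scaleC_right: "L g (c *\<^sub>C h) = scaleC_op (cnj c) (L g h)"
  by (simp_all add: ketbra_add_left ketbra_add_right ketbra_scaleC_left ketbra_scaleC_right
      complex_extension_add[OF T] complex_extension_scaleC[OF T] clinear_op_ketbra)

lemma L_adj: "cinner (L g h x) y = cinner x (L h g y)"
  using adj_pair_complex_extension[OF T adj_pair_ketbra] by (rule adj_pair_cinner)

lemma L_expansion: "clinear_op Z \<Longrightarrow> complex_extension T Z = (\<Sum>b\<in>onb. L (Z b) b)"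
  by (subst (1) op_expansion) (simp_all add: complex_extension_sum[OF T] clinear_op_ketbra)

lemma L_wedge:
  assumes "\<And>g. \<exists>\<xi>. L g g = ketbra \<xi> \<xi>"
  shows "wedge (L a b) (L c d) x y x' y' = - wedge (L a d) (L c b) x y x' y'"
proof -
  have "wedge (L a b) (L c d) x y x' y' + wedge (L a d) (L c b) x y x' y' = 0"
  proof (rule quartic_polarization[of "\<lambda>a b c d. wedge (L a b) (L c d) x y x' y'"])
    show "wedge (L a a) (L a a) x y x' y' = 0" for a
      using assms[of a] wedge_ketbra_self by metis
  qed (rule wedge_commute
    | simp add: wedge_def L_add_left L_add_right L_scaleC_left L_scaleC_right op_simps cinner_simps
        algebra_simps)+
  then show ?thesis by (simp add: eq_neg_iff_add_eq_0)
qed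

text \<open>Each \<open>L e g\<close> is tangent to rank one at both \<open>ketbra a a\<close> and
  \<open>ketbra a b\<close>, hence has the ket \<open>a\<close>; its bra is \<open>A g\<close>. The
  value \<open>L g h\<close> is then determined because the exchange of bras expresses its wedges
  with the four known operators through \<open>L g e\<close>, \<open>L e h\<close> and their
  analogues for \<open>f\<close>.\<close>

lemma conjugation_form:
  assumes rank_one: "\<And>g. \<exists>\<xi>. L g g = ketbra \<xi> \<xi>"
    and ind: "independent2 a b"
    and ee: "L e e = ketbra a a" and ff: "L f f = ketbra b b" and ef: "L e f = ketbra a b"
  shows "\<exists>A. (\<forall>x y. A (x + y) = A x + A y) \<and> (\<forall>c x. A (c *\<^sub>C x) = c *\<^sub>C A x) \<and>
    (\<forall>g h. L g h = ketbra (A g) (A h))"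
proof -
  note W = L_wedge[OF rank_one]
  have a0: "cinner a a \<noteq> 0" using ind by (simp add: independent2_def)
  have ind': "independent2 b a" using ind by (rule independent2_commute)
  have b0: "cinner b b \<noteq> 0" using ind' by (simp add: independent2_def)
  have fe: "L f e = ketbra b a"
    by (rule op_eqI) (metis L_adj ef adj_pair_ketbra adj_pair_cinner)
  have self: "wedge (L g h) (L g k) x y x' y' = 0" for g h k x y x' y'
    using W[of g h g k x y x' y'] wedge_commute[of "L g h" "L g k" x y x' y'] by simp
  \<comment> \<open>\<open>L g e\<close> turns out to be \<open>ketbra (A g) a\<close>; evaluating
    at \<open>a\<close> and dividing by \<open>cinner a a\<close> extracts the ket.\<close>
  define A where "A g = (1 / cinner a a) *\<^sub>C L g e a" for g
  define B where "B g = (1 / cinner b b) *\<^sub>C L g f b" for g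
  have eA: "L e g = ketbra a (A g)" for g
  proof (rule op_eqI)
    fix x y
    have "L e g y = (cinner a (L e g y) / cinner a a) *\<^sub>C a"
      using self[of e g e] self[of e g f]
      by (intro wedge_zero_range[OF ind]) (simp_all add: ee ef)
    also have "cinner a (L e g y) / cinner a a = cinner (A g) y"
      by (simp add: A_def cinner_simps L_adj cinner_self)
    finally show "cinner x (L e g y) = cinner x (ketbra a (A g) y)" by simp
  qed
  have fB: "L f g = ketbra b (B g)" for g
  proof (rule op_eqI)
    fix x y
    have "L f g y = (cinner b (L f g y) / cinner b b) *\<^sub>C b"
      using self[of f g f] self[of f g e]
      by (intro wedge_zero_range[OF ind']) (simp_all add: ff fe)
    also have "cinner b (L f g y) / cinner b b = cinner (B g) y"
      by (simp add: B_def cinner_simps L_adj cinner_self)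
    finally show "cinner x (L f g y) = cinner x (ketbra b (B g) y)" by simp
  qed
  have Ae: "A e = a" and Af: "A f = b"
    using a0 by (simp_all add: A_def ee fe scaleC_scaleC scaleC_one)
  have Be: "B e = a" and Bf: "B f = b"
    using b0 by (simp_all add: B_def ff ef scaleC_scaleC scaleC_one)
  obtain p q where pq: "cinner p a = 1" "cinner p b = 0" "cinner q a = 0" "cinner q b = 1"
    using independent2_dual[OF ind] .
  have qp: "cinner a p = 1" "cinner b p = 0" "cinner a q = 0" "cinner b q = 1"
    using pq by (metis cinner_commute complex_cnj_zero complex_cnj_one)+
  have BA: "B g = A g" for g
  proof -
    \<comment> \<open>The dual pair removes the kets \<open>a\<close> and \<open>b\<close> and
      leaves an identity between bras. For \<open>h = e\<close> it makes \<open>A g - B g\<close>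
      proportional to \<open>a\<close>, for \<open>h = f\<close> to \<open>b\<close>.\<close>
    have 1: "cinner (A g) x * cinner (B h) y - cinner (A g) y * cinner (B h) x
        + cinner (A h) x * cinner (B g) y - cinner (A h) y * cinner (B g) x = 0" for h x y
      using W[of e g f h p q x y] pq qp
      by (simp add: eA fB wedge_def cinner_simps algebra_simps)
    have "cinner (A g) x = cinner (B g) x" for x
      using 1[where h = e and x = x and y = p] 1[where h = f and x = p and y = q] qp
      by (simp add: Ae Be Af Bf)
    then show ?thesis by (metis cinner_commute cinner_ext_right)
  qed
  have gh: "L g h = ketbra (A g) (A h)" for g h
  proof -
    define D where "D = L g h - ketbra (A g) (A h)"
    have Lg: "L g e = ketbra (A g) a" "L g f = ketbra (A g) b" for g
      by (rule op_eqI, metis L_adj eA fB BA adj_pair_ketbra adj_pair_cinner)+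
    have diff: "wedge D N x y x' y' = wedge (L g h) N x y x' y' - wedge (ketbra (A g) (A h)) N x y x' y'"
      for N x y x' y'
      by (simp add: wedge_def D_def op_simps cinner_simps algebra_simps)
    \<comment> \<open>\<open>ketbra (A g) (A h)\<close> obeys the same exchange rule as
      \<open>L g h\<close>, so the wedges of \<open>D\<close> with the four known operators vanish.
      The range of \<open>D\<close> then lies in the line of \<open>a\<close> and in that of
      \<open>b\<close>.\<close>
    have swap: "wedge (ketbra k l) (ketbra m n) x y x' y' = - wedge (ketbra k n) (ketbra m l) x y x' y'"
      for k l m n x y x' y' :: 'h
      by (simp add: wedge_def cinner_simps algebra_simps)
    have "wedge D (ketbra a a) x y x' y' = 0" for x y x' y'
      using W[of g h e e x y x' y'] swap[of "A g" "A h" a a x y x' y']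
      by (simp add: diff ee Lg eA Ae)
    moreover have "wedge D (ketbra a b) x y x' y' = 0" for x y x' y'
      using W[of g h e f x y x' y'] swap[of "A g" "A h" a b x y x' y']
      by (simp add: diff ef Lg eA Ae)
    ultimately have 1: "D v = (cinner a (D v) / cinner a a) *\<^sub>C a" for v
      by (rule wedge_zero_range[OF ind])
    have "wedge D (ketbra b b) x y x' y' = 0" for x y x' y'
      using W[of g h f f x y x' y'] swap[of "A g" "A h" b b x y x' y']
      by (simp add: diff ff Lg fB BA Af)
    moreover have "wedge D (ketbra b a) x y x' y' = 0" for x y x' y'
      using W[of g h f e x y x' y'] swap[of "A g" "A h" b a x y x' y']
      by (simp add: diff fe Lg fB BA Af)
    ultimately have 2: "D v = (cinner b (D v) / cinner b b) *\<^sub>C b" for v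
      by (rule wedge_zero_range[OF ind'])
    have "D v = 0" for v
    proof -
      have "cinner q (D v) = 0"
        by (subst 1) (simp add: cinner_simps pq)
      then have "cinner b (D v) / cinner b b = 0"
        using arg_cong[OF 2[of v], of "cinner q"] by (simp add: cinner_simps pq)
      with 2[of v] show ?thesis by simp
    qed
    then have "D = 0" by (intro blinfun_eqI) simp
    then show ?thesis by (simp add: D_def)
  qed
  show ?thesis
  proof (intro exI[of _ A] conjI allI)
    show "A (x + y) = A x + A y" for x y
      by (simp add: A_def L_add_left op_simps scaleC_add_right)
    show "A (c *\<^sub>C x) = c *\<^sub>C A x" for c x
      by (simp add: A_def L_scaleC_left scaleC_scaleC mult.commute)
    show "L g h = ketbra (A g) (A h)" for g h by (rule gh)
  qed
qed

lemma ketbra_phase: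
  assumes "cmod c = 1"
  shows "ketbra (c *\<^sub>C x) (c *\<^sub>C x) = ketbra x x"
proof -
  have "c * cnj c = 1" using assms complex_norm_square[of c] by simp
  then show ?thesis by (simp add: mult.commute ketbra_scaleC_left ketbra_scaleC_right scaleC_op_scaleC_op)
qed

lemma independent2_scaleC: "independent2 a b \<Longrightarrow> c \<noteq> 0 \<Longrightarrow> independent2 a (c *\<^sub>C b)"
proof -
  assume ind: "independent2 a b" and c: "c \<noteq> 0"
  have "c *\<^sub>C b \<noteq> d *\<^sub>C a" for d
  proof
    assume "c *\<^sub>C b = d *\<^sub>C a"
    then have "(1 / c) *\<^sub>C c *\<^sub>C b = (1 / c) *\<^sub>C d *\<^sub>C a" by (rule arg_cong)
    then have "b = (d / c) *\<^sub>C a" using c by (simp add: scaleC_scaleC scaleC_one)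
    then show False using ind by (auto simp: independent2_def)
  qed
  then show ?thesis using ind by (simp add: independent2_def)
qed

text \<open>Tangency at both diagonal values leaves coefficients \<open>c\<close> of
  \<open>ketbra a b\<close> and \<open>d\<close> of \<open>ketbra b a\<close>. The exchange rule
  gives \<open>c * d = 0\<close> and total squared modulus one, so one term survives with a unit
  coefficient, which can be absorbed into \<open>b\<close> without changing
  \<open>ketbra b b\<close>.\<close>

lemma cross_term_cases:
  assumes rank_one: "\<And>g. \<exists>\<xi>. L g g = ketbra \<xi> \<xi>"
    and ind: "independent2 a b"
    and ee: "L e e = ketbra a a" and ff: "L f f = ketbra b b"
  obtains b' where "independent2 a b'" "L f f = ketbra b' b'" "L e f = ketbra a b' \<or> L e f = ketbra b' a"
proof -
  note W = L_wedge[OF rank_one]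
  have "wedge (L e f) (ketbra a a) x y x' y' = 0" for x y x' y'
    using W[of e f e e x y x' y'] wedge_commute[of "L e f" "L e e" x y x' y'] by (simp add: ee)
  moreover have "wedge (L e f) (ketbra b b) x y x' y' = 0" for x y x' y'
    using W[of e f f f x y x' y'] by (simp add: ff)
  ultimately obtain c d where cd: "L e f = scaleC_op c (ketbra a b) + scaleC_op d (ketbra b a)"
    using wedge_zero_cross[OF ind] by metis
  have fe: "L f e = scaleC_op (cnj d) (ketbra a b) + scaleC_op (cnj c) (ketbra b a)"
    by (rule op_eqI)
      (simp flip: L_adj, simp add: cd op_simps cinner_simps flip: cinner_commute)
  obtain p q where pq: "cinner p a = 1" "cinner p b = 0" "cinner q a = 0" "cinner q b = 1"
    using independent2_dual[OF ind] .
  have qp: "cinner a p = 1" "cinner b p = 0" "cinner a q = 0" "cinner b q = 1"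
    using pq by (metis cinner_commute complex_cnj_zero complex_cnj_one)+
  have "wedge (L e f) (L e f) p q p q = 0"
    using W[of e f e f p q p q] by simp
  then have prod: "c * d = 0"
    by (simp add: wedge_def cd op_simps cinner_simps pq qp)
  have "wedge (L e f) (L f e) p q p q = - wedge (L e e) (L f f) p q p q"
    by (rule W)
  then have "c * cnj c + d * cnj d = 1"
    by (simp add: wedge_def cd fe ee ff op_simps cinner_simps pq qp algebra_simps)
  then have "complex_of_real ((cmod c)\<^sup>2 + (cmod d)\<^sup>2) = of_real 1"
    by (simp only: of_real_add complex_norm_square of_real_1)
  then have cd1: "(cmod c)\<^sup>2 + (cmod d)\<^sup>2 = 1"
    by (simp only: of_real_eq_iff)
  consider "d = 0" "cmod c = 1" | "c = 0" "cmod d = 1"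
    using prod cd1 power2_eq_imp_eq[of _ 1] by fastforce
  then show ?thesis
  proof cases
    case 1
    show ?thesis
    proof (rule that[of "cnj c *\<^sub>C b"])
      show "independent2 a (cnj c *\<^sub>C b)" using 1 ind by (intro independent2_scaleC) auto
      show "L f f = ketbra (cnj c *\<^sub>C b) (cnj c *\<^sub>C b)" using 1 by (simp add: ff ketbra_phase)
      show "L e f = ketbra a (cnj c *\<^sub>C b) \<or> L e f = ketbra (cnj c *\<^sub>C b) a"
        using 1 by (simp add: cd ketbra_scaleC_right)
    qed
  next
    case 2
    show ?thesis
    proof (rule that[of "d *\<^sub>C b"])
      show "independent2 a (d *\<^sub>C b)" using 2 ind by (intro independent2_scaleC) auto
      show "L f f = ketbra (d *\<^sub>C b) (d *\<^sub>C b)" using 2 by (simp add: ff ketbra_phase)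
      show "L e f = ketbra a (d *\<^sub>C b) \<or> L e f = ketbra (d *\<^sub>C b) a"
        using 2 by (simp add: cd ketbra_scaleC_left)
    qed
  qed
qed

text \<open>Complex polarisation writes \<open>L g h\<close> through four diagonal values, and an
  orthonormal expansion of \<open>Z\<close> writes its image through values
  \<open>L g h\<close>.\<close>

lemma complex_extension_rank_one:
  assumes diag: "\<And>g. \<exists>c. L g g = scaleC_op c (ketbra \<psi> \<psi>)"
    and Z: "clinear_op Z"
  shows "\<exists>c. complex_extension T Z = scaleC_op c (ketbra \<psi> \<psi>)"
proof -
  have "\<exists>c. L g h = scaleC_op c (ketbra \<psi> \<psi>)" for g h
  proof -
    obtain k where k: "\<And>z. L (g + z *\<^sub>C h) (g + z *\<^sub>C h) = scaleC_op (k z) (ketbra \<psi> \<psi>)"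
      using choice[of "\<lambda>z c. L (g + z *\<^sub>C h) (g + z *\<^sub>C h) = scaleC_op c (ketbra \<psi> \<psi>)"] diag
      by blast
    have "L g h = scaleC_op (1/4) (L (g + 1 *\<^sub>C h) (g + 1 *\<^sub>C h))
       + scaleC_op (-1/4) (L (g + (-1) *\<^sub>C h) (g + (-1) *\<^sub>C h))
       + scaleC_op (\<i>/4) (L (g + \<i> *\<^sub>C h) (g + \<i> *\<^sub>C h))
       + scaleC_op (-\<i>/4) (L (g + (-\<i>) *\<^sub>C h) (g + (-\<i>) *\<^sub>C h))"
      unfolding L_add_left L_add_right L_scaleC_left L_scaleC_right
      by (rule op_eqI) (simp add: op_simps cinner_simps algebra_simps)
    then show ?thesis
      unfolding k scaleC_op_scaleC_op scaleC_op_add_left[symmetric] by blast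
  qed
  then obtain k where "\<And>g h. L g h = scaleC_op (k g h) (ketbra \<psi> \<psi>)" by metis
  then have "complex_extension T Z = (\<Sum>b\<in>onb. scaleC_op (k (Z b) b) (ketbra \<psi> \<psi>))"
    using L_expansion[OF Z] by simp
  also have "\<dots> = scaleC_op (\<Sum>b\<in>onb. k (Z b) b) (ketbra \<psi> \<psi>)"
    by (rule blinfun_eqI) (simp add: op_simps cvec.scale_sum_left sum_distrib_right scaleC_scaleC)
  finally show ?thesis by blast
qed

end

lemma pure_operation_rank_one:
  assumes "pure_operation T"
  shows "\<exists>\<xi>. L T g g = ketbra \<xi> \<xi>"
proof (cases "g = 0")
  case True
  then have "ketbra g g = scaleC_op 0 (ketbra g g)" by (intro blinfun_eqI) simp
  then have "L T g g = ketbra 0 0"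
    using assms L_scaleC_left[of T 0 g g] by (intro blinfun_eqI) (simp add: True pure_operation_def)
  then show ?thesis by blast
next
  case False
  have T: "operation T" using assms by (simp add: pure_operation_def)
  define u where "u = (1 / of_real (norm g)) *\<^sub>C g"
  have g: "g = of_real (norm g) *\<^sub>C u"
    using False by (simp add: u_def scaleC_scaleC scaleC_one)
  have "norm u = 1" using unit_multiple[OF False] by (simp add: u_def)
  then obtain \<psi> r where r: "0 \<le> r" "T (ketbra u u) = r *\<^sub>R ketbra \<psi> \<psi>"
    using assms unfolding pure_operation_def by blast
  define \<xi> where "\<xi> = of_real (norm g * sqrt r) *\<^sub>C \<psi>"
  have "L T g g = scaleC_op (of_real (norm g)) (scaleC_op (of_real (norm g)) (L T u u))"
    by (subst (1 2) g) (simp add: L_scaleC_left[OF T] L_scaleC_right[OF T])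
  also have "\<dots> = scaleC_op (of_real (norm g)) (scaleC_op (of_real (norm g)) (scaleC_op (of_real (sqrt r)) (scaleC_op (of_real (sqrt r)) (ketbra \<psi> \<psi>))))"
    using r(1) by (simp add: L_diag[OF T] r(2) scaleC_op_of_real flip: of_real_mult)
  also have "\<dots> = ketbra \<xi> \<xi>"
    by (simp add: \<xi>_def ketbra_scaleC_left ketbra_scaleC_right scaleC_op_scaleC_op mult_ac)
  finally show ?thesis by blast
qed

text \<open>The dichotomy behind it is whether two of the vectors \<open>\<xi> g\<close> are
  independent; if so, the single value \<open>L T e f\<close> decides between the last two cases.
  The last case records one pair only, since one plane is enough to refute both properties.\<close>

lemma pure_operation_trichotomy:
  assumes "pure_operation T"
  obtains \<psi> where "\<And>Z. clinear_op Z \<Longrightarrow> \<exists>c. complex_extension T Z = scaleC_op c (ketbra \<psi> \<psi>)"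
  | A where "\<And>x y. A (x + y) = A x + A y" "\<And>c x. A (c *\<^sub>C x) = c *\<^sub>C A x"
      "\<And>g h. L T g h = ketbra (A g) (A h)"
  | a b e f where "independent2 a b" "L T e e = ketbra a a" "L T f f = ketbra b b" "L T e f = ketbra b a"
proof -
  have T: "operation T" using assms by (simp add: pure_operation_def)
  obtain \<xi> where \<xi>: "\<And>g. L T g g = ketbra (\<xi> g) (\<xi> g)"
    using pure_operation_rank_one[OF assms] by metis
  show ?thesis
  proof (cases "\<exists>e f. independent2 (\<xi> e) (\<xi> f)")
    case True
    then obtain e f where ef: "independent2 (\<xi> e) (\<xi> f)" by blast
    obtain b where b: "independent2 (\<xi> e) b" "L T f f = ketbra b b"
      "L T e f = ketbra (\<xi> e) b \<or> L T e f = ketbra b (\<xi> e)"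
      using cross_term_cases[OF T _ ef \<xi> \<xi>] \<xi> by metis
    from b(3) show ?thesis
    proof
      assume "L T e f = ketbra (\<xi> e) b"
      from conjugation_form[OF T _ b(1) \<xi> b(2) this] \<xi> that(2) show ?thesis by metis
    next
      assume "L T e f = ketbra b (\<xi> e)"
      with b \<xi> that(3) show ?thesis by metis
    qed
  next
    case False
    have "\<exists>\<psi>. \<forall>g. \<exists>c. L T g g = scaleC_op c (ketbra \<psi> \<psi>)"
    proof (cases "\<exists>e. \<xi> e \<noteq> 0")
      case True
      then obtain e where e: "\<xi> e \<noteq> 0" by blast
      have "\<exists>c. L T g g = scaleC_op c (ketbra (\<xi> e) (\<xi> e))" for g
      proof -
        obtain c where "\<xi> g = c *\<^sub>C \<xi> e" using False e by (auto simp: independent2_def)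
        then have "L T g g = scaleC_op (c * cnj c) (ketbra (\<xi> e) (\<xi> e))"
          by (simp add: \<xi> ketbra_scaleC_left ketbra_scaleC_right scaleC_op_scaleC_op mult.commute)
        then show ?thesis by blast
      qed
      then show ?thesis by blast
    next
      case False
      then have "L T g g = scaleC_op 0 (ketbra 0 0)" for g
        by (intro blinfun_eqI) (simp add: \<xi>)
      then show ?thesis by blast
    qed
    then show ?thesis using complex_extension_rank_one[OF T] that(1) by metis
  qed
qed

section \<open>Complete positivity of pure operations\<close>

text \<open>The value of the compressed operator at \<open>x\<close> is that of \<open>A\<close> at
  the product vector with components \<open>c i *\<^sub>C x\<close>.\<close>

lemma block_pos_compression:
  assumes A: "A \<in> block_pos n"
  shows "(\<Sum>i<n. \<Sum>j<n. scaleC_op (cnj (c i) * c j) (A i j)) \<in> pos_herm"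
proof -
  let ?Z = "\<Sum>i<n. \<Sum>j<n. scaleC_op (cnj (c i) * c j) (A i j)"
  have A': "A \<in> block_herm n" using A by (simp add: block_pos_def)
  have "adj_pair ?Z (\<Sum>i<n. \<Sum>j<n. scaleC_op (cnj (cnj (c i) * c j)) (A j i))"
    using A' by (intro adj_pair_sum adj_pair_scaleC_op) (auto simp: block_herm_def adj_pair_def)
  also have "(\<Sum>i<n. \<Sum>j<n. scaleC_op (cnj (cnj (c i) * c j)) (A j i)) = ?Z"
    by (subst sum.swap) (simp add: mult.commute)
  finally have "?Z \<in> herm" by (simp add: herm_iff_adj_pair)
  moreover have "0 \<le> Re (cinner x (?Z x))" for x
  proof -
    have "cinner x (?Z x) = (\<Sum>i<n. \<Sum>j<n. cinner (c i *\<^sub>C x) (A i j (c j *\<^sub>C x)))"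
      unfolding op_simps cinner_sum_right
    proof (intro sum.cong refl)
      fix i j assume "i \<in> {..<n}" "j \<in> {..<n}"
      then have "clinear_op (A i j)" using A' by (simp add: block_herm_def)
      then show "cinner x (scaleC_op (cnj (c i) * c j) (A i j) x) = cinner (c i *\<^sub>C x) (A i j (c j *\<^sub>C x))"
        by (simp add: clinear_op_def cinner_simps)
    qed
    then show ?thesis using A by (simp add: block_pos_def)
  qed
  ultimately show ?thesis by (simp add: pos_herm_def)
qed

text \<open>Such a \<open>T\<close> is a positive functional times a fixed operator, and positive
  functionals are completely positive: testing the image at \<open>v\<close> amounts to applying
  \<open>T\<close> to the compression of \<open>A\<close> by the coefficients
  \<open>cinner \<psi> (v i)\<close>.\<close>

lemma completely_positive_rank_one:
  assumes T: "operation T"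
    and R: "\<And>Z. clinear_op Z \<Longrightarrow> \<exists>c. complex_extension T Z = scaleC_op c (ketbra \<psi> \<psi>)"
  shows "completely_positive T"
  unfolding completely_positive_def
proof (intro conjI allI subsetI T)
  fix n B assume "B \<in> tensor_id T ` block_pos n"
  then obtain A where A: "A \<in> block_pos n" and B: "B = tensor_id T A" by blast
  have Ah: "A \<in> block_herm n" using A by (simp add: block_pos_def)
  have Acl: "clinear_op (A i j)" if "i < n" "j < n" for i j
    using Ah that by (simp add: block_herm_def)
  have "0 \<le> Re (\<Sum>i<n. \<Sum>j<n. cinner (v i) (B i j (v j)))" for v
  proof (cases "\<psi> = 0")
    case True
    have "cinner (v i) (B i j (v j)) = 0" if "i < n" "j < n" for i j
      using R[OF Acl[OF that]] by (auto simp: B tensor_id_def True)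
    then show ?thesis by simp
  next
    case False
    \<comment> \<open>The compression is tested at \<open>\<psi>\<close> itself, which produces
      \<open>cinner \<psi> \<psi>\<close> twice.\<close>
    define s where "s = norm \<psi> ^ 4"
    have s: "s > 0" "cinner \<psi> \<psi> * cinner \<psi> \<psi> = of_real s"
      using False by (simp_all add: s_def cinner_self flip: of_real_mult power_add)
    let ?c = "\<lambda>i. cinner \<psi> (v i)"
    let ?Z = "\<Sum>i<n. \<Sum>j<n. scaleC_op (cnj (?c i) * ?c j) (A i j)"
    have "complex_extension T ?Z =
        (\<Sum>i<n. complex_extension T (\<Sum>j<n. scaleC_op (cnj (?c i) * ?c j) (A i j)))"
      by (intro complex_extension_sum[OF T] clinear_op_sum clinear_op_scaleC_op Acl) auto
    also have "\<dots> = (\<Sum>i<n. \<Sum>j<n. complex_extension T (scaleC_op (cnj (?c i) * ?c j) (A i j)))"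
      by (intro sum.cong refl complex_extension_sum[OF T] clinear_op_scaleC_op Acl) auto
    also have "\<dots> = (\<Sum>i<n. \<Sum>j<n. scaleC_op (cnj (?c i) * ?c j) (B i j))"
      by (intro sum.cong refl) (simp add: complex_extension_scaleC[OF T] Acl B tensor_id_def)
    finally have "cinner \<psi> (complex_extension T ?Z \<psi>) =
        (\<Sum>i<n. \<Sum>j<n. cnj (?c i) * ?c j * cinner \<psi> (B i j \<psi>))"
      by (simp add: op_simps cinner_sum_right cinner_simps)
    also have "\<dots> = (\<Sum>i<n. \<Sum>j<n. of_real s * cinner (v i) (B i j (v j)))"
    proof (intro sum.cong refl)
      fix i j assume "i \<in> {..<n}" "j \<in> {..<n}"
      then obtain c where "B i j = scaleC_op c (ketbra \<psi> \<psi>)"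
        using R[OF Acl] by (auto simp: B tensor_id_def)
      then show "cnj (?c i) * ?c j * cinner \<psi> (B i j \<psi>) = of_real s * cinner (v i) (B i j (v j))"
        by (simp add: cinner_simps flip: cinner_commute s(2))
    qed
    finally have "Re (cinner \<psi> (complex_extension T ?Z \<psi>)) =
        s * Re (\<Sum>i<n. \<Sum>j<n. cinner (v i) (B i j (v j)))"
      by (simp flip: sum_distrib_left)
    moreover have "0 \<le> Re (cinner \<psi> (complex_extension T ?Z \<psi>))"
      using block_pos_compression[OF A, of ?c] operation_pos[OF T]
      by (auto simp: pos_herm_def complex_extension_herm[OF T])
    ultimately show ?thesis using s(1) by (simp add: zero_le_mult_iff)
  qed
  then show "B \<in> block_pos n"
    using tensor_id_block_herm[OF T Ah] by (simp add: block_pos_def B)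
qed

text \<open>With \<open>A'\<close> the adjoint of \<open>A\<close>, the form of the image at
  \<open>v\<close> equals the form of the original block operator at the family
  \<open>A' (v i)\<close>.\<close>

lemma completely_positive_conjugation:
  assumes T: "operation T"
    and add: "\<And>x y. A (x + y) = A x + A y" and scale: "\<And>c x. A (c *\<^sub>C x) = c *\<^sub>C A x"
    and L: "\<And>g h. L T g h = ketbra (A g) (A h)"
  shows "completely_positive T"
  unfolding completely_positive_def
proof (intro conjI allI subsetI T)
  fix n B assume "B \<in> tensor_id T ` block_pos n"
  then obtain X where X: "X \<in> block_pos n" and B: "B = tensor_id T X" by blast
  have Xh: "X \<in> block_herm n" using X by (simp add: block_pos_def)
  define A' where "A' y = (\<Sum>b\<in>onb. cinner (A b) y *\<^sub>C b)" for y
  have A_sum: "A (\<Sum>i\<in>I. f i) = (\<Sum>i\<in>I. A (f i))" for I and f :: "'a \<Rightarrow> 'a"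
    using scale[of 0 0] by (induction I rule: infinite_finite_induct) (simp_all add: add)
  have A': "cinner x (A y) = cinner (A' x) y" for x y
  proof -
    have "cinner (A' x) y = (\<Sum>b\<in>onb. cinner x (A b) * cinner b y)"
      by (simp add: A'_def cinner_sum_left cinner_simps flip: cinner_commute)
    also have "\<dots> = cinner x (A (\<Sum>b\<in>onb. cinner b y *\<^sub>C b))"
      by (simp add: A_sum scale cinner_sum_right cinner_simps mult.commute)
    finally show ?thesis by (simp add: onb_expansion)
  qed
  have B_apply: "cinner x (B i j y) = cinner (A' x) (X i j (A' y))" if "i < n" "j < n" for i j x y
  proof -
    have cl: "clinear_op (X i j)" using Xh that by (simp add: block_herm_def)
    have "B i j y = (\<Sum>b\<in>onb. cinner (A b) y *\<^sub>C A (X i j b))"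
      using L_expansion[OF T cl] by (simp add: B tensor_id_def L op_simps)
    also have "\<dots> = A (X i j (A' y))"
      using cl by (simp add: A'_def blinfun.sum_right clinear_op_def A_sum scale)
    finally show ?thesis by (simp add: A')
  qed
  have "0 \<le> Re (\<Sum>i<n. \<Sum>j<n. cinner (v i) (B i j (v j)))" for v
    using X by (simp add: B_apply block_pos_def)
  then show "B \<in> block_pos n"
    using tensor_id_block_herm[OF T Xh] by (simp add: block_pos_def B)
qed

text \<open>The rank-one block operator of the family \<open>e\<close>, \<open>f\<close> is
  positive; its image is a flip of the two tensor factors, written in terms of \<open>a\<close> and
  \<open>b\<close>, and a flip is negative on antisymmetric vectors.\<close>

lemma not_completely_positive_antilinear:
  assumes T: "operation T" and ind: "independent2 a b"
    and ee: "L T e e = ketbra a a" and ff: "L T f f = ketbra b b" and ef: "L T e f = ketbra b a"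
  shows "\<not> completely_positive T"
proof
  assume CP: "completely_positive T"
  have fe: "L T f e = ketbra a b"
    by (rule op_eqI) (metis L_adj[OF T] ef adj_pair_ketbra adj_pair_cinner)
  obtain p q where pq: "cinner p a = 1" "cinner p b = 0" "cinner q a = 0" "cinner q b = 1"
    using independent2_dual[OF ind] .
  have qp: "cinner a p = 1" "cinner b p = 0" "cinner a q = 0" "cinner b q = 1"
    using pq by (metis cinner_commute complex_cnj_zero complex_cnj_one)+
  define g where "g i = (if i = 0 then e else f)" for i :: nat
  define A where "A i j = ketbra (g i) (g j)" for i j
  have "0 \<le> Re (\<Sum>i<2. \<Sum>j<2. cinner (v i) (A i j (v j)))" for v
  proof -
    have "(\<Sum>i<2. \<Sum>j<2. cinner (v i) (A i j (v j)))
        = (\<Sum>i<2. cinner (v i) (g i)) * (\<Sum>j<2. cinner (g j) (v j))"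
      by (simp add: A_def cinner_simps numeral_2_eq_2 algebra_simps)
    also have "\<dots> = cnj (\<Sum>j<2. cinner (g j) (v j)) * (\<Sum>j<2. cinner (g j) (v j))"
      by (simp flip: cinner_commute)
    also have "\<dots> = of_real ((cmod (\<Sum>j<2. cinner (g j) (v j)))\<^sup>2)"
      by (simp only: complex_norm_square mult.commute)
    finally show ?thesis by simp
  qed
  moreover have "A \<in> block_herm 2"
    using adj_pair_ketbra by (auto simp: block_herm_def A_def adj_pair_def)
  ultimately have "A \<in> block_pos 2" by (simp add: block_pos_def)
  then have pos: "tensor_id T A \<in> block_pos 2" using CP by (auto simp: completely_positive_def)
  \<comment> \<open>The antisymmetric vector in terms of the dual pair: the diagonal blocks
    contribute nothing and each off-diagonal block contributes -1.\<close>
  define v where "v i = (if i = 0 then q else - p)" for i :: nat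
  have "(\<Sum>i<2. \<Sum>j<2. cinner (v i) (tensor_id T A i j (v j))) = - 2"
    by (simp add: numeral_2_eq_2 tensor_id_def A_def g_def v_def ee ff ef fe cinner_simps pq qp)
  moreover have "0 \<le> Re (\<Sum>i<2. \<Sum>j<2. cinner (v i) (tensor_id T A i j (v j)))"
    using pos by (simp add: block_pos_def)
  ultimately show False by simp
qed

section \<open>Alternating forms in four arguments\<close>

lemma alternating_form_add:
  "alternating_form V D \<Longrightarrow> X \<in> UNIV \<rightarrow> V \<Longrightarrow> Y \<in> V \<Longrightarrow> Z \<in> V \<Longrightarrow>
    D (X(i := Y + Z)) = D (X(i := Y)) + D (X(i := Z))"
  and alternating_form_scale:
  "alternating_form V D \<Longrightarrow> X \<in> UNIV \<rightarrow> V \<Longrightarrow> Y \<in> V \<Longrightarrow> D (X(i := r *\<^sub>R Y)) = r * D (X(i := Y))"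
  by (auto simp: alternating_form_def)

lemma alternating_form_eq:
  "alternating_form V D \<Longrightarrow> X \<in> UNIV \<rightarrow> V \<Longrightarrow> i \<noteq> j \<Longrightarrow> X i = X j \<Longrightarrow> D X = 0"
  by (simp add: alternating_form_def) metis

lemma alternating_form_swap:
  assumes D: "alternating_form (span S) D" and X: "X \<in> UNIV \<rightarrow> span S" and ij: "i \<noteq> j"
  shows "D (X(i := X j, j := X i)) = - D X"
proof -
  have in_span: "X k \<in> span S" for k using X by auto
  define f where "f u v = D (X(i := u, j := v))" for u v
  have add1: "f (u + u') v = f u v + f u' v" if "u \<in> span S" "u' \<in> span S" "v \<in> span S" for u u' v
    using alternating_form_add[OF D, of "X(j := v)" u u' i] that X ij
    by (simp add: f_def fun_upd_twist Pi_iff)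
  have add2: "f u (v + v') = f u v + f u v'" if "u \<in> span S" "v \<in> span S" "v' \<in> span S" for u v v'
    using alternating_form_add[OF D, of "X(i := u)" v v' j] that X
    by (simp add: f_def Pi_iff)
  have diag: "f u u = 0" if "u \<in> span S" for u
    using alternating_form_eq[OF D, of "X(i := u, j := u)" i j] that X ij
    by (simp add: f_def Pi_iff)
  have "f (X i + X j) (X i + X j) = f (X i) (X i) + f (X i) (X j) + (f (X j) (X i) + f (X j) (X j))"
    by (simp add: add1 add2 span_add in_span)
  moreover have "f (X i + X j) (X i + X j) = 0"
    using in_span by (intro diag span_add)
  ultimately have "f (X j) (X i) = - f (X i) (X j)"
    using in_span by (simp add: diag)
  then show ?thesis using ij by (simp add: f_def fun_upd_twist)
qed

text \<open>A repeated index gives zero by alternation; otherwise \<open>k\<close> is a product of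
  transpositions, each of which only changes the sign.\<close>

lemma alternating_form_basis_zero:
  fixes \<sigma> :: "4 \<Rightarrow> 'v::real_vector" and k :: "4 \<Rightarrow> 4"
  assumes D: "alternating_form (span (range \<sigma>)) D" and zero: "D \<sigma> = 0"
  shows "D (\<sigma> \<circ> k) = 0"
proof (cases "inj k")
  case False
  then obtain i j where "i \<noteq> j" "k i = k j" by (auto simp: inj_def)
  then show ?thesis
    using alternating_form_eq[OF D, of "\<sigma> \<circ> k" i j] by (auto simp: span_base)
next
  case True
  then have permutes: "k permutes UNIV"
    by (intro bij_imp_permutes) (simp_all add: bij_betw_def finite_UNIV_inj_surj)
  have "finite (UNIV :: 4 set)" by simp
  from this permutes show ?thesis
  proof (induction rule: permutes_rev_induct)
    case id
    show ?case using zero by simp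
  next
    case (swap a b p)
    show ?case
    proof (cases "a = b")
      case True
      then show ?thesis using swap by simp
    next
      case False
      have "\<sigma> \<circ> (p \<circ> Transposition.transpose a b) = (\<sigma> \<circ> p)(a := (\<sigma> \<circ> p) b, b := (\<sigma> \<circ> p) a)"
        using False by (auto simp: Transposition.transpose_def)
      moreover have "D ((\<sigma> \<circ> p)(a := (\<sigma> \<circ> p) b, b := (\<sigma> \<circ> p) a)) = - D (\<sigma> \<circ> p)"
        by (rule alternating_form_swap[OF D _ False]) (auto simp: span_base)
      ultimately show ?thesis using swap.IH by (simp only: minus_zero)
    qed
  qed
qed

lemma alternating_form_zero:
  fixes \<sigma> :: "4 \<Rightarrow> 'v::real_vector"
  assumes D: "alternating_form (span (range \<sigma>)) D" and zero: "D \<sigma> = 0"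
    and X: "X \<in> UNIV \<rightarrow> span (range \<sigma>)"
  shows "D X = 0"
proof -
  \<comment> \<open>\<open>S\<close> collects the positions with arbitrary entries, and linearity in
    one position removes it from \<open>S\<close>.\<close>
  have "D X = 0" if "finite S" "\<forall>i. i \<notin> S \<longrightarrow> X i \<in> range \<sigma>" "X \<in> UNIV \<rightarrow> span (range \<sigma>)" for S X
    using that
  proof (induction S arbitrary: X rule: finite_induct)
    case empty
    then have "\<forall>i. \<exists>j. X i = \<sigma> j" by auto
    then obtain k where "\<forall>i. X i = \<sigma> (k i)" by (rule choice[THEN exE])
    then have "X = \<sigma> \<circ> k" by auto
    then show ?case using alternating_form_basis_zero[OF D zero] by simp
  next
    case (insert i S)
    have X: "X \<in> UNIV \<rightarrow> span (range \<sigma>)" by (rule insert.prems(2))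
    have "v \<in> span (range \<sigma>) \<and> D (X(i := v)) = 0" if "v \<in> span (range \<sigma>)" for v
      using that
    proof (rule span_induct[where P = "\<lambda>v. v \<in> span (range \<sigma>) \<and> D (X(i := v)) = 0"])
      show "subspace {v. v \<in> span (range \<sigma>) \<and> D (X(i := v)) = 0}"
        using alternating_form_add[OF D X] alternating_form_scale[OF D X]
          alternating_form_scale[OF D X span_zero, of i 0]
        by (auto intro!: subspaceI simp: span_zero span_add span_scale)
      show "v \<in> span (range \<sigma>) \<and> D (X(i := v)) = 0" if "v \<in> range \<sigma>" for v
        using that insert.prems by (intro conjI insert.IH) (auto simp: span_base)
    qed
    from this[of "X i"] show ?case using insert.prems by auto
  qed
  from this[of UNIV X] X show ?thesis by simp
qed

text \<open>Subtracting the right multiple of the normalised form \<open>E\<close> kills the value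
  at \<open>\<sigma>\<close>, hence the whole form. This both evaluates \<open>Det\<close> and
  extracts the scalar by which an operation multiplies it.\<close>

lemma alternating_form_unique:
  fixes \<sigma> :: "4 \<Rightarrow> 'v::real_vector"
  assumes D: "alternating_form (span (range \<sigma>)) D" and E: "alternating_form (span (range \<sigma>)) E"
    and "E \<sigma> = 1" and X: "X \<in> UNIV \<rightarrow> span (range \<sigma>)"
  shows "D X = D \<sigma> * E X"
proof -
  have "alternating_form (span (range \<sigma>)) (\<lambda>X. D X - D \<sigma> * E X)"
    unfolding alternating_form_def
  proof (intro conjI ballI allI impI)
    fix Y :: "4 \<Rightarrow> 'v" and i j assume "Y \<in> UNIV \<rightarrow> span (range \<sigma>)" "i \<noteq> j \<and> Y i = Y j"
    then show "D Y - D \<sigma> * E Y = 0"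
      using alternating_form_eq[OF D, of Y i j] alternating_form_eq[OF E, of Y i j] by simp
  qed (simp_all add: alternating_form_add[OF D] alternating_form_add[OF E]
        alternating_form_scale[OF D] alternating_form_scale[OF E] algebra_simps)
  from alternating_form_zero[OF this _ X] show ?thesis using \<open>E \<sigma> = 1\<close> by simp
qed

section \<open>The determinant in coordinates\<close>

text \<open>Laplace expansion, along rows \<open>i\<close> and \<open>j\<close>, of the determinant with columns \<open>p, q, r, s\<close> and
  rows \<open>i, j, k, l\<close>.\<close>

definition det4 :: "('i \<Rightarrow> real) \<Rightarrow> ('i \<Rightarrow> real) \<Rightarrow> ('i \<Rightarrow> real) \<Rightarrow> ('i \<Rightarrow> real) \<Rightarrow> 'i \<Rightarrow> 'i \<Rightarrow> 'i \<Rightarrow> 'i \<Rightarrow> real" where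
  "det4 p q r s i j k l =
    (let m = (\<lambda>x y. x i * y j - x j * y i); n = (\<lambda>x y. x k * y l - x l * y k)
     in m p q * n r s - m p r * n q s + m p s * n q r + m q r * n p s - m q s * n p r + m r s * n p q)"

lemma UNIV_index: "(i :: 4) = 0 \<or> i = 1 \<or> i = 2 \<or> i = 3"
  using exhaust_4[of i] by auto

lemma alternating_form_det4:
  assumes "linear p" "linear q" "linear r" "linear s"
  shows "alternating_form V (\<lambda>X. c * det4 (p \<circ> X) (q \<circ> X) (r \<circ> X) (s \<circ> X) 0 1 2 3)"
  unfolding alternating_form_def
proof (intro conjI ballI allI impI)
  note lin = assms[THEN linear_add] assms[THEN linear_scale]
  fix X :: "4 \<Rightarrow> 'a" and i :: 4
  show "c * det4 (p \<circ> X(i := Y + Z)) (q \<circ> X(i := Y + Z)) (r \<circ> X(i := Y + Z)) (s \<circ> X(i := Y + Z)) 0 1 2 3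
      = c * det4 (p \<circ> X(i := Y)) (q \<circ> X(i := Y)) (r \<circ> X(i := Y)) (s \<circ> X(i := Y)) 0 1 2 3
      + c * det4 (p \<circ> X(i := Z)) (q \<circ> X(i := Z)) (r \<circ> X(i := Z)) (s \<circ> X(i := Z)) 0 1 2 3" for Y Z
    using UNIV_index[of i] by (elim disjE) (simp_all add: det4_def Let_def lin algebra_simps)
  show "c * det4 (p \<circ> X(i := t *\<^sub>R Y)) (q \<circ> X(i := t *\<^sub>R Y)) (r \<circ> X(i := t *\<^sub>R Y)) (s \<circ> X(i := t *\<^sub>R Y)) 0 1 2 3
      = t * (c * det4 (p \<circ> X(i := Y)) (q \<circ> X(i := Y)) (r \<circ> X(i := Y)) (s \<circ> X(i := Y)) 0 1 2 3)" for t Y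
    using UNIV_index[of i] by (elim disjE) (simp_all add: det4_def Let_def lin algebra_simps)
  show "c * det4 (p \<circ> X) (q \<circ> X) (r \<circ> X) (s \<circ> X) 0 1 2 3 = 0" if "i \<noteq> j \<and> X i = X j" for j
    using that UNIV_index[of i] UNIV_index[of j]
    by (elim disjE) (simp_all add: det4_def Let_def algebra_simps)
qed

text \<open>The factor \<open>2\<close> makes the value on \<open>std_basis \<phi> \<psi>\<close> equal to \<open>1\<close>.\<close>

definition plane_det :: "'h::fin_dim_complex_hilbert \<Rightarrow> 'h \<Rightarrow> (4 \<Rightarrow> 'h op) \<Rightarrow> real" where
  "plane_det \<phi> \<psi> X = 2 * det4 ((\<lambda>Y :: 'h op. Re (cinner \<phi> (Y \<phi>))) \<circ> X) ((\<lambda>Y :: 'h op. Re (cinner \<psi> (Y \<psi>))) \<circ> X)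
     ((\<lambda>Y :: 'h op. Re (cinner \<phi> (Y \<psi>))) \<circ> X) ((\<lambda>Y :: 'h op. Im (cinner \<phi> (Y \<psi>))) \<circ> X) 0 1 2 3"

lemma alternating_form_plane_det: "alternating_form V (plane_det \<phi> \<psi>)"
proof -
  have "linear (\<lambda>Y :: 'a op. Re (cinner x (Y y)))" "linear (\<lambda>Y :: 'a op. Im (cinner x (Y y)))" for x y
    by (auto intro!: linearI simp: op_simps cinner_simps)
  then show ?thesis
    unfolding plane_det_def by (intro alternating_form_det4)
qed

lemma det4_scale:
  "det4 (\<lambda>x. c * p x) (\<lambda>x. c * q x) (\<lambda>x. c * r x) (\<lambda>x. c * s x) i j k l = c ^ 4 * det4 p q r s i j k l"
  by (simp add: det4_def Let_def power4_eq_xxxx algebra_simps)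

text \<open>In coordinates the quadruple arises from \<open>std_basis \<phi> \<psi>\<close> by
  congruence with the matrix of components of \<open>u\<close> and \<open>v\<close>. These vectors
  are arbitrary, so the formula yields the independence of \<open>Det\<close> from the basis, the
  nonnegative determinant of a congruence, and a positive value for independent vectors in the
  plane.\<close>

lemma plane_det_std_basis:
  "plane_det \<phi> \<psi> (std_basis u v) = cmod (cinner \<phi> u * cinner \<psi> v - cinner \<psi> u * cinner \<phi> v) ^ 4"
proof -
  define a1 a2 b1 b2 c1 c2 d1 d2 where abcd:
    "a1 = Re (cinner \<phi> u)" "a2 = Im (cinner \<phi> u)" "b1 = Re (cinner \<psi> u)" "b2 = Im (cinner \<psi> u)"
    "c1 = Re (cinner \<phi> v)" "c2 = Im (cinner \<phi> v)" "d1 = Re (cinner \<psi> v)" "d2 = Im (cinner \<psi> v)"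
  have conj: "cinner u \<phi> = cnj (cinner \<phi> u)" "cinner u \<psi> = cnj (cinner \<psi> u)"
    "cinner v \<phi> = cnj (cinner \<phi> v)" "cinner v \<psi> = cnj (cinner \<psi> v)"
    by (rule cinner_commute)+
  let ?s = "1 / sqrt 2"
  \<comment> \<open>Scaling by \<open>sqrt 2\<close> keeps roots out of the polynomial identity. The
    resulting factor \<open>1 / 4\<close> cancels against the \<open>2\<close> in
    \<open>plane_det\<close> and the \<open>2\<close> in the value of
    \<open>det4 p q r s 0 1 2 3\<close>.\<close>
  define p where "p i = (if i = 0 then a1*a1 + a2*a2 + (c1*c1 + c2*c2) else if i = 1 then 2 * (a1*c1 + a2*c2)
     else if i = 2 then 2 * (a2*c1 - a1*c2) else a1*a1 + a2*a2 - (c1*c1 + c2*c2))" for i :: 4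
  define q where "q i = (if i = 0 then b1*b1 + b2*b2 + (d1*d1 + d2*d2) else if i = 1 then 2 * (b1*d1 + b2*d2)
     else if i = 2 then 2 * (b2*d1 - b1*d2) else b1*b1 + b2*b2 - (d1*d1 + d2*d2))" for i :: 4
  define r where "r i = (if i = 0 then a1*b1 + a2*b2 + (c1*d1 + c2*d2) else if i = 1 then a1*d1 + a2*d2 + c1*b1 + c2*b2
     else if i = 2 then a2*d1 - a1*d2 - b1*c2 + b2*c1 else a1*b1 + a2*b2 - (c1*d1 + c2*d2))" for i :: 4
  define s where "s i = (if i = 0 then a2*b1 - a1*b2 + (c2*d1 - c1*d2) else if i = 1 then a2*d1 - a1*d2 + c2*b1 - c1*b2
     else if i = 2 then - a1*d1 - a2*d2 + b1*c1 + b2*c2 else a2*b1 - a1*b2 - (c2*d1 - c1*d2))" for i :: 4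
  have p: "(\<lambda>Y :: 'a op. Re (cinner \<phi> (Y \<phi>))) \<circ> std_basis u v = (\<lambda>i. ?s * p i)"
    by (rule ext) (simp add: std_basis_def p_def op_simps cinner_simps conj abcd field_simps)
  have q: "(\<lambda>Y :: 'a op. Re (cinner \<psi> (Y \<psi>))) \<circ> std_basis u v = (\<lambda>i. ?s * q i)"
    by (rule ext) (simp add: std_basis_def q_def op_simps cinner_simps conj abcd field_simps)
  have r: "(\<lambda>Y :: 'a op. Re (cinner \<phi> (Y \<psi>))) \<circ> std_basis u v = (\<lambda>i. ?s * r i)"
    by (rule ext) (simp add: std_basis_def r_def op_simps cinner_simps conj abcd field_simps)
  have s: "(\<lambda>Y :: 'a op. Im (cinner \<phi> (Y \<psi>))) \<circ> std_basis u v = (\<lambda>i. ?s * s i)"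
    by (rule ext) (simp add: std_basis_def s_def op_simps cinner_simps conj abcd field_simps)
  have "det4 p q r s 0 1 2 3 =
      2 * ((a1*d1 - a2*d2 - b1*c1 + b2*c2)^2 + (a1*d2 + a2*d1 - b1*c2 - b2*c1)^2)^2"
    by (simp add: det4_def Let_def p_def q_def r_def s_def) algebra
  moreover have "(a1*d1 - a2*d2 - b1*c1 + b2*c2)^2 + (a1*d2 + a2*d1 - b1*c2 - b2*c1)^2
      = (cmod (cinner \<phi> u * cinner \<psi> v - cinner \<psi> u * cinner \<phi> v))\<^sup>2"
    unfolding cmod_power2 abcd by (simp add: algebra_simps)
  moreover have "?s ^ 4 = 1 / 4"
    by (simp add: power_divide power4_eq_xxxx)
  moreover have "plane_det \<phi> \<psi> (std_basis u v) = 2 * (?s ^ 4 * det4 p q r s 0 1 2 3)"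
    by (simp only: plane_det_def p q r s det4_scale)
  ultimately show ?thesis by simp
qed

section \<open>Hermitian operators supported in a plane\<close>

definition orthonormal2 :: "'h::fin_dim_complex_hilbert \<Rightarrow> 'h \<Rightarrow> bool" where
  "orthonormal2 \<phi> \<psi> \<longleftrightarrow> norm \<phi> = 1 \<and> norm \<psi> = 1 \<and> cinner \<phi> \<psi> = 0"

lemma orthonormal2_cinner:
  assumes "orthonormal2 \<phi> \<psi>"
  shows "cinner \<phi> \<phi> = 1" "cinner \<psi> \<psi> = 1" "cinner \<phi> \<psi> = 0" "cinner \<psi> \<phi> = 0"
  using assms by (auto simp: orthonormal2_def cinner_unit intro: cinner_orthogonal_commute)

lemma in_span2_iff:
  assumes "orthonormal2 \<phi> \<psi>"
  shows "y \<in> cvec.span {\<phi>, \<psi>} \<longleftrightarrow> y = cinner \<phi> y *\<^sub>C \<phi> + cinner \<psi> y *\<^sub>C \<psi>"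
proof
  assume "y \<in> cvec.span {\<phi>, \<psi>}"
  then obtain k l where "y - k *\<^sub>C \<phi> - l *\<^sub>C \<psi> = 0"
    by (auto simp: cvec.span_insert)
  then have y: "y = k *\<^sub>C \<phi> + l *\<^sub>C \<psi>" by (simp add: algebra_simps)
  show "y = cinner \<phi> y *\<^sub>C \<phi> + cinner \<psi> y *\<^sub>C \<psi>"
    by (simp add: y cinner_simps orthonormal2_cinner[OF assms])
next
  assume "y = cinner \<phi> y *\<^sub>C \<phi> + cinner \<psi> y *\<^sub>C \<psi>"
  moreover have "k *\<^sub>C \<phi> + l *\<^sub>C \<psi> \<in> cvec.span {\<phi>, \<psi>}" for k l
    by (intro cvec.span_add cvec.span_scale cvec.span_base) auto
  ultimately show "y \<in> cvec.span {\<phi>, \<psi>}" by metis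
qed

text \<open>This is B(F) for the face of the plane, with a condition on the range in place of the
  support, since the former is visibly linear in the operator.\<close>

definition plane_herm :: "'h::fin_dim_complex_hilbert \<Rightarrow> 'h \<Rightarrow> 'h op set" where
  "plane_herm \<phi> \<psi> = {X \<in> herm. \<forall>x. X x \<in> cvec.span {\<phi>, \<psi>}}"

text \<open>\<open>op_support X\<close> is the orthogonal complement of the kernel, which for a
  Hermitian operator is the range.\<close>

lemma op_support_subset_iff:
  assumes on: "orthonormal2 \<phi> \<psi>" and X: "X \<in> herm"
  shows "op_support X \<subseteq> cvec.span {\<phi>, \<psi>} \<longleftrightarrow> X \<in> plane_herm \<phi> \<psi>"
proof
  assume "op_support X \<subseteq> cvec.span {\<phi>, \<psi>}"
  moreover have "X x \<in> op_support X" for x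
    unfolding op_support_def using herm_cinner[OF X, symmetric] by simp
  ultimately show "X \<in> plane_herm \<phi> \<psi>" using X by (auto simp: plane_herm_def)
next
  assume P: "X \<in> plane_herm \<phi> \<psi>"
  show "op_support X \<subseteq> cvec.span {\<phi>, \<psi>}"
  proof
    fix y assume y: "y \<in> op_support X"
    define r where "r = y - (cinner \<phi> y *\<^sub>C \<phi> + cinner \<psi> y *\<^sub>C \<psi>)"
    have r: "cinner \<phi> r = 0" "cinner \<psi> r = 0"
      by (simp_all add: r_def cinner_simps orthonormal2_cinner[OF on])
    have "X r = 0"
    proof (rule cinner_ext_right)
      fix z
      have Xz: "X z = cinner \<phi> (X z) *\<^sub>C \<phi> + cinner \<psi> (X z) *\<^sub>C \<psi>"
        using P in_span2_iff[OF on] by (auto simp: plane_herm_def)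
      have "cinner (X z) r = 0"
        by (subst Xz) (simp add: cinner_simps r)
      then show "cinner z (X r) = cinner z 0" by (simp add: herm_cinner[OF X])
    qed
    then have "cinner r y = 0" using y by (simp add: op_support_def)
    then have "cinner r r = 0"
      using r cinner_orthogonal_commute[OF r(1)] cinner_orthogonal_commute[OF r(2)]
      by (subst (2) r_def) (simp add: cinner_simps)
    then have "y = cinner \<phi> y *\<^sub>C \<phi> + cinner \<psi> y *\<^sub>C \<psi>" by (simp add: r_def)
    then show "y \<in> cvec.span {\<phi>, \<psi>}" using in_span2_iff[OF on] by blast
  qed
qed

lemma states_herm: "W \<in> states \<Longrightarrow> W \<in> herm"
  by (simp add: states_def pos_herm_def)

lemma plane_states_eq:
  assumes "orthonormal2 \<phi> \<psi>"
  shows "{W \<in> states. op_support W \<subseteq> cvec.span {\<phi>, \<psi>}} = states \<inter> plane_herm \<phi> \<psi>"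
  using op_support_subset_iff[OF assms] states_herm by blast

lemma face_basis_iff:
  "face_basis F \<phi> \<psi> \<longleftrightarrow> orthonormal2 \<phi> \<psi> \<and> F = states \<inter> plane_herm \<phi> \<psi>"
  using plane_states_eq[of \<phi> \<psi>] by (auto simp: face_basis_def orthonormal2_def)

lemma plane_herm_subspace: "subspace (plane_herm \<phi> \<psi>)"
  unfolding plane_herm_def
  by (rule subspaceI) (auto simp: herm_zero herm_add herm_scaleR op_simps scaleR_scaleC
      intro!: cvec.span_add cvec.span_scale cvec.span_zero)

text \<open>The sign of the last coefficient compensates the entry \<open>- \<i>\<close> that the
  last operator has between \<open>\<phi>\<close> and \<open>\<psi>\<close>.\<close>

lemma plane_herm_expansion:
  assumes on: "orthonormal2 \<phi> \<psi>" and X: "X \<in> plane_herm \<phi> \<psi>"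
  shows "X = Re (cinner \<phi> (X \<phi>)) *\<^sub>R ketbra \<phi> \<phi> + Re (cinner \<psi> (X \<psi>)) *\<^sub>R ketbra \<psi> \<psi>
    + Re (cinner \<phi> (X \<psi>)) *\<^sub>R (ketbra \<phi> \<psi> + ketbra \<psi> \<phi>)
    + (- Im (cinner \<phi> (X \<psi>))) *\<^sub>R scaleC_op \<i> (- ketbra \<phi> \<psi> + ketbra \<psi> \<phi>)"
proof (rule op_eqI)
  fix x y
  have Xh: "X \<in> herm" and span: "X z = cinner \<phi> (X z) *\<^sub>C \<phi> + cinner \<psi> (X z) *\<^sub>C \<psi>" for z
    using X in_span2_iff[OF on] by (auto simp: plane_herm_def)
  have real: "cinner z (X z) = of_real (Re (cinner z (X z)))" for z
    using herm_Im_zero[OF Xh] by (simp add: complex_eq_iff)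
  have cross: "cinner \<psi> (X \<phi>) = cnj (cinner \<phi> (X \<psi>))"
    using herm_cinner[OF Xh] cinner_commute by metis
  have row: "cinner z (X y) = cnj (cinner \<phi> (X z)) * cinner \<phi> y + cnj (cinner \<psi> (X z)) * cinner \<psi> y" for z
    by (subst herm_cinner[OF Xh, symmetric], subst span) (simp add: cinner_simps)
  have "cinner x (X y) = cinner \<phi> (X y) * cinner x \<phi> + cinner \<psi> (X y) * cinner x \<psi>"
    by (subst span) (simp add: cinner_simps)
  also have "\<dots> = (cinner \<phi> (X \<phi>) * cinner \<phi> y + cinner \<phi> (X \<psi>) * cinner \<psi> y) * cinner x \<phi>
      + (cnj (cinner \<phi> (X \<psi>)) * cinner \<phi> y + cinner \<psi> (X \<psi>) * cinner \<psi> y) * cinner x \<psi>"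
    using real[of \<phi>] real[of \<psi>] by (simp only: row cross complex_cnj_cnj) (metis complex_cnj_complex_of_real)
  also have "\<dots> = cinner x ((Re (cinner \<phi> (X \<phi>)) *\<^sub>R ketbra \<phi> \<phi> + Re (cinner \<psi> (X \<psi>)) *\<^sub>R ketbra \<psi> \<psi>
    + Re (cinner \<phi> (X \<psi>)) *\<^sub>R (ketbra \<phi> \<psi> + ketbra \<psi> \<phi>)
    + (- Im (cinner \<phi> (X \<psi>))) *\<^sub>R scaleC_op \<i> (- ketbra \<phi> \<psi> + ketbra \<psi> \<phi>)) y)"
    using herm_Im_zero[OF Xh, of \<phi>] herm_Im_zero[OF Xh, of \<psi>]
    by (simp add: op_simps cinner_simps complex_eq_iff algebra_simps)
  finally show "cinner x (X y) = cinner x ((Re (cinner \<phi> (X \<phi>)) *\<^sub>R ketbra \<phi> \<phi>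
    + Re (cinner \<psi> (X \<psi>)) *\<^sub>R ketbra \<psi> \<psi>
    + Re (cinner \<phi> (X \<psi>)) *\<^sub>R (ketbra \<phi> \<psi> + ketbra \<psi> \<phi>)
    + (- Im (cinner \<phi> (X \<psi>))) *\<^sub>R scaleC_op \<i> (- ketbra \<phi> \<psi> + ketbra \<psi> \<phi>)) y)" .
qed

lemma std_basis_2: "std_basis \<phi> \<psi> 2 = (1 / sqrt 2) *\<^sub>R scaleC_op \<i> (- ketbra \<phi> \<psi> + ketbra \<psi> \<phi>)"
  by (rule op_eqI) (simp add: std_basis_def op_simps cinner_simps)

lemma span_std_basis:
  fixes \<phi> \<psi> :: "'h::fin_dim_complex_hilbert"
  shows "ketbra \<phi> \<phi> \<in> span (range (std_basis \<phi> \<psi>))" (is "_ \<in> ?S")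
    and "ketbra \<psi> \<psi> \<in> span (range (std_basis \<phi> \<psi>))"
    and "ketbra \<phi> \<psi> + ketbra \<psi> \<phi> \<in> span (range (std_basis \<phi> \<psi>))"
    and "scaleC_op \<i> (- ketbra \<phi> \<psi> + ketbra \<psi> \<phi>) \<in> span (range (std_basis \<phi> \<psi>))"
proof -
  have in_S: "r *\<^sub>R std_basis \<phi> \<psi> j \<in> ?S" for r j by (simp add: span_base span_scale)
  have "ketbra \<phi> \<phi> = (1 / sqrt 2) *\<^sub>R std_basis \<phi> \<psi> 0 + (1 / sqrt 2) *\<^sub>R std_basis \<phi> \<psi> 3"
    by (rule op_eqI) (simp add: std_basis_def op_simps cinner_simps algebra_simps flip: of_real_mult)
  then show "ketbra \<phi> \<phi> \<in> ?S" using span_add[OF in_S in_S] by metis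
  have "ketbra \<psi> \<psi> = (1 / sqrt 2) *\<^sub>R std_basis \<phi> \<psi> 0 + (- (1 / sqrt 2)) *\<^sub>R std_basis \<phi> \<psi> 3"
    by (rule op_eqI) (simp add: std_basis_def op_simps cinner_simps algebra_simps flip: of_real_mult)
  then show "ketbra \<psi> \<psi> \<in> ?S" using span_add[OF in_S in_S] by metis
  have "ketbra \<phi> \<psi> + ketbra \<psi> \<phi> = sqrt 2 *\<^sub>R std_basis \<phi> \<psi> 1"
    by (simp add: std_basis_def)
  then show "ketbra \<phi> \<psi> + ketbra \<psi> \<phi> \<in> ?S" using in_S by metis
  have "scaleC_op \<i> (- ketbra \<phi> \<psi> + ketbra \<psi> \<phi>) = sqrt 2 *\<^sub>R std_basis \<phi> \<psi> 2"
    by (simp add: std_basis_2)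
  then show "scaleC_op \<i> (- ketbra \<phi> \<psi> + ketbra \<psi> \<phi>) \<in> ?S" using in_S by metis
qed

lemma plane_herm_subset_span_std_basis:
  assumes "orthonormal2 \<phi> \<psi>"
  shows "plane_herm \<phi> \<psi> \<subseteq> span (range (std_basis \<phi> \<psi>))"
proof
  fix X assume X: "X \<in> plane_herm \<phi> \<psi>"
  show "X \<in> span (range (std_basis \<phi> \<psi>))"
    by (subst plane_herm_expansion[OF assms X]) (intro span_add span_scale span_std_basis)
qed

section \<open>Trace and pure states of a plane\<close>

lemma op_trace_onb: "op_trace X = (\<Sum>b\<in>onb. cinner b (X b))"
  by (simp add: op_trace_def onb_def)

lemma op_trace_ketbra: "op_trace (ketbra x y) = cinner y x"
  using parseval[of y x] by (simp add: op_trace_onb cinner_simps)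

lemma op_trace_add: "op_trace (X + Y) = op_trace X + op_trace Y"
  and op_trace_diff: "op_trace (X - Y) = op_trace X - op_trace Y"
  and op_trace_scaleR: "op_trace (r *\<^sub>R X) = of_real r * op_trace X"
  and op_trace_scaleC_op: "op_trace (scaleC_op c X) = c * op_trace X"
  and op_trace_minus: "op_trace (- X) = - op_trace X"
  by (simp_all add: op_trace_onb op_simps cinner_simps sum.distrib sum_subtractf sum_distrib_left sum_negf)

lemmas op_trace_simps = op_trace_add op_trace_diff op_trace_scaleR op_trace_scaleC_op op_trace_minus
  op_trace_ketbra

lemma states_ketbra: "norm x = 1 \<Longrightarrow> ketbra x x \<in> states"
  by (simp add: states_def pos_herm_ketbra op_trace_ketbra cinner_unit)

lemma ketbra_self_in_plane_herm:
  "x \<in> cvec.span {\<phi>, \<psi>} \<Longrightarrow> ketbra x x \<in> plane_herm \<phi> \<psi>"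
  by (simp add: plane_herm_def herm_ketbra cvec.span_scale)

lemma in_span_if_ketbra_in_plane_herm:
  assumes "ketbra x x \<in> plane_herm \<phi> \<psi>"
  shows "x \<in> cvec.span {\<phi>, \<psi>}"
proof (cases "x = 0")
  case True
  then show ?thesis by (simp add: cvec.span_zero)
next
  case False
  have "cinner x x *\<^sub>C x \<in> cvec.span {\<phi>, \<psi>}"
    using assms by (auto simp: plane_herm_def)
  then have "(1 / cinner x x) *\<^sub>C cinner x x *\<^sub>C x \<in> cvec.span {\<phi>, \<psi>}"
    by (rule cvec.span_scale)
  then show ?thesis using False by (simp add: scaleC_scaleC scaleC_one)
qed

text \<open>\<open>\<eta>\<close> and \<open>\<zeta>\<close> are the points of the Bloch sphere on
  the axes of \<sigma>1 and \<sigma>2. Together with \<open>\<phi>\<close> and \<open>\<psi>\<close>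
  they express the off-diagonal operators as real combinations of states.\<close>

lemma plane_pure_states:
  assumes on: "orthonormal2 \<phi> \<psi>"
  defines "\<eta> \<equiv> (1 / of_real (sqrt 2)) *\<^sub>C (\<phi> + \<psi>)" and "\<zeta> \<equiv> (1 / of_real (sqrt 2)) *\<^sub>C (\<phi> + \<i> *\<^sub>C \<psi>)"
  shows "norm \<eta> = 1" "norm \<zeta> = 1" "\<eta> \<in> cvec.span {\<phi>, \<psi>}" "\<zeta> \<in> cvec.span {\<phi>, \<psi>}"
    "ketbra \<phi> \<psi> + ketbra \<psi> \<phi> = 2 *\<^sub>R ketbra \<eta> \<eta> - ketbra \<phi> \<phi> - ketbra \<psi> \<psi>"
    "scaleC_op \<i> (- ketbra \<phi> \<psi> + ketbra \<psi> \<phi>) = 2 *\<^sub>R ketbra \<zeta> \<zeta> - ketbra \<phi> \<phi> - ketbra \<psi> \<psi>"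
proof -
  have one: "norm x = 1" if "cinner x x = 1" for x :: 'a
  proof -
    have "(norm x)\<^sup>2 = 1\<^sup>2" using that cinner_self[of x] by (simp add: complex_eq_iff)
    then show ?thesis by (rule power2_eq_imp_eq) simp_all
  qed
  show "norm \<eta> = 1" "norm \<zeta> = 1"
    by (rule one, simp add: \<eta>_def \<zeta>_def cinner_simps orthonormal2_cinner[OF on] flip: of_real_mult)+
  show "\<eta> \<in> cvec.span {\<phi>, \<psi>}" "\<zeta> \<in> cvec.span {\<phi>, \<psi>}"
    unfolding \<eta>_def \<zeta>_def by (intro cvec.span_scale cvec.span_add cvec.span_base; simp)+
  have *: "complex_of_real (sqrt 2) * complex_of_real (sqrt 2) = 2"
    by (simp flip: of_real_mult)
  show "ketbra \<phi> \<psi> + ketbra \<psi> \<phi> = 2 *\<^sub>R ketbra \<eta> \<eta> - ketbra \<phi> \<phi> - ketbra \<psi> \<psi>"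
    unfolding \<eta>_def by (rule op_eqI) (simp add: op_simps cinner_simps field_simps *)
  show "scaleC_op \<i> (- ketbra \<phi> \<psi> + ketbra \<psi> \<phi>) = 2 *\<^sub>R ketbra \<zeta> \<zeta> - ketbra \<phi> \<phi> - ketbra \<psi> \<psi>"
    unfolding \<zeta>_def by (rule op_eqI) (simp add: op_simps cinner_simps field_simps *)
qed

text \<open>A cycle of inclusions: the standard basis consists of combinations of states, the states
  lie in \<open>plane_herm \<phi> \<psi>\<close>, and this is spanned by the standard basis.\<close>

lemma span_plane_states:
  assumes on: "orthonormal2 \<phi> \<psi>"
  shows "span (states \<inter> plane_herm \<phi> \<psi>) = plane_herm \<phi> \<psi>" (is "span ?F = _")
    and "span (range (std_basis \<phi> \<psi>)) = plane_herm \<phi> \<psi>"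
proof -
  have pure: "ketbra x x \<in> span ?F" if "norm x = 1" "x \<in> cvec.span {\<phi>, \<psi>}" for x
    using that by (intro span_base IntI states_ketbra ketbra_self_in_plane_herm)
  have P: "ketbra \<phi> \<phi> \<in> span ?F" "ketbra \<psi> \<psi> \<in> span ?F"
    using on by (auto intro!: pure simp: orthonormal2_def cvec.span_base)
  have K1: "ketbra \<phi> \<psi> + ketbra \<psi> \<phi> \<in> span ?F"
    unfolding plane_pure_states(5)[OF on] using plane_pure_states[OF on]
    by (intro span_diff span_scale P pure) auto
  have K2: "scaleC_op \<i> (- ketbra \<phi> \<psi> + ketbra \<psi> \<phi>) \<in> span ?F"
    unfolding plane_pure_states(6)[OF on] using plane_pure_states[OF on]
    by (intro span_diff span_scale P pure) auto
  have "std_basis \<phi> \<psi> j \<in> span ?F" for j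
    using UNIV_index[of j] P K1 K2 std_basis_2[of \<phi> \<psi>]
    by (elim disjE) (simp_all add: std_basis_def span_scale span_add span_diff)
  then have 1: "span (range (std_basis \<phi> \<psi>)) \<subseteq> span ?F"
    by (intro span_minimal subspace_span) auto
  have 2: "span ?F \<subseteq> plane_herm \<phi> \<psi>"
    by (intro span_minimal plane_herm_subspace) auto
  show "span ?F = plane_herm \<phi> \<psi>" "span (range (std_basis \<phi> \<psi>)) = plane_herm \<phi> \<psi>"
    using 1 2 plane_herm_subset_span_std_basis[OF on] by auto
qed

text \<open>The matrix of components is unitary, so its determinant times the conjugate is
  one.\<close>

lemma orthonormal2_change_det:
  assumes on: "orthonormal2 \<phi> \<psi>" and on': "orthonormal2 u v"
    and uv: "u \<in> cvec.span {\<phi>, \<psi>}" "v \<in> cvec.span {\<phi>, \<psi>}"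
  shows "cmod (cinner \<phi> u * cinner \<psi> v - cinner \<psi> u * cinner \<phi> v) = 1"
proof -
  define \<alpha> \<beta> \<gamma> \<delta> where d: "\<alpha> = cinner \<phi> u" "\<beta> = cinner \<psi> u" "\<gamma> = cinner \<phi> v" "\<delta> = cinner \<psi> v"
  have u: "u = \<alpha> *\<^sub>C \<phi> + \<beta> *\<^sub>C \<psi>" and v: "v = \<gamma> *\<^sub>C \<phi> + \<delta> *\<^sub>C \<psi>"
    using uv in_span2_iff[OF on] by (auto simp: d)
  have "cnj \<alpha> * \<alpha> + cnj \<beta> * \<beta> = 1" "cnj \<gamma> * \<gamma> + cnj \<delta> * \<delta> = 1"
    "cnj \<alpha> * \<gamma> + cnj \<beta> * \<delta> = 0" "cnj \<gamma> * \<alpha> + cnj \<delta> * \<beta> = 0"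
    using orthonormal2_cinner[OF on'] unfolding u v
    by (simp_all add: cinner_simps orthonormal2_cinner[OF on] mult.commute)
  then have "(\<alpha> * \<delta> - \<beta> * \<gamma>) * (cnj \<alpha> * cnj \<delta> - cnj \<beta> * cnj \<gamma>) = 1"
    by algebra
  then have "complex_of_real ((cmod (\<alpha> * \<delta> - \<beta> * \<gamma>))\<^sup>2) = of_real 1"
    unfolding complex_norm_square by simp
  then have "(cmod (\<alpha> * \<delta> - \<beta> * \<gamma>))\<^sup>2 = 1" by (simp only: of_real_eq_iff)
  then show ?thesis by (simp add: d power2_eq_1_iff) (metis norm_ge_zero neg_0_le_iff_le not_one_le_zero)
qed

text \<open>The choice in \<open>Det\<close> is meaningful because
  \<open>plane_det \<phi> \<psi>\<close> has the required property for every orthonormal basis of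
  the plane. Uniqueness of alternating forms then identifies the two on
  \<open>span F\<close>.\<close>

lemma Det_eq_plane_det:
  assumes F: "face_basis F \<phi> \<psi>" and X: "X \<in> UNIV \<rightarrow> span F"
  shows "Det F X = plane_det \<phi> \<psi> X"
proof -
  have on: "orthonormal2 \<phi> \<psi>" and F_eq: "F = states \<inter> plane_herm \<phi> \<psi>"
    using F by (auto simp: face_basis_iff)
  have "plane_det \<phi> \<psi> (std_basis u v) = 1" if uv: "face_basis F u v" for u v
  proof -
    have on': "orthonormal2 u v" and F_eq': "F = states \<inter> plane_herm u v"
      using uv by (auto simp: face_basis_iff)
    have "ketbra u u \<in> F" "ketbra v v \<in> F"
      unfolding F_eq' using on'
      by (auto intro!: states_ketbra ketbra_self_in_plane_herm simp: orthonormal2_def cvec.span_base)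
    then have "u \<in> cvec.span {\<phi>, \<psi>}" "v \<in> cvec.span {\<phi>, \<psi>}"
      unfolding F_eq by (auto intro: in_span_if_ketbra_in_plane_herm)
    then show ?thesis
      by (simp add: plane_det_std_basis orthonormal2_change_det[OF on on'])
  qed
  then have "alternating_form (span F) (plane_det \<phi> \<psi>) \<and>
      (\<forall>u v. face_basis F u v \<longrightarrow> plane_det \<phi> \<psi> (std_basis u v) = 1)"
    using alternating_form_plane_det by blast
  then have "alternating_form (span F) (Det F) \<and>
      (\<forall>u v. face_basis F u v \<longrightarrow> Det F (std_basis u v) = 1)"
    unfolding Det_def
    by (rule someI[where P = "\<lambda>D. alternating_form (span F) D \<and>
      (\<forall>u v. face_basis F u v \<longrightarrow> D (std_basis u v) = 1)"])
  then have D: "alternating_form (span F) (Det F)" "Det F (std_basis \<phi> \<psi>) = 1"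
    using F by auto
  have span: "span F = span (range (std_basis \<phi> \<psi>))"
    using span_plane_states[OF on] by (simp add: F_eq)
  have "plane_det \<phi> \<psi> (std_basis \<phi> \<psi>) = 1"
    by (simp add: plane_det_std_basis orthonormal2_cinner[OF on])
  from alternating_form_unique[OF D(1)[unfolded span] alternating_form_plane_det this X[unfolded span]]
  show ?thesis by (simp add: D(2))
qed

section \<open>Three-dimensional faces\<close>

lemma pos_herm_Cauchy_Schwarz:
  assumes X: "X \<in> pos_herm"
  shows "(cmod (cinner y (X x)))\<^sup>2 \<le> Re (cinner y (X y)) * Re (cinner x (X x))"
proof -
  have Xh: "X \<in> herm" and cl: "X (c *\<^sub>C z) = c *\<^sub>C X z" and pos: "0 \<le> Re (cinner z (X z))" for c z
    using X by (auto simp: pos_herm_def herm_def clinear_op_def)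
  define w N P Q where d: "w = cinner y (X x)" "N = (cmod w)\<^sup>2"
    "P = Re (cinner x (X x))" "Q = Re (cinner y (X y))"
  have wN: "w * cnj w = of_real N" by (simp only: d complex_norm_square)
  have xy: "cinner x (X y) = cnj w"
    by (metis d(1) herm_cinner[OF Xh] cinner_commute)
  have quad: "0 \<le> Q - 2 * t * N + t * t * N * P" for t
  proof -
    \<comment> \<open>The phase \<open>cnj w\<close> makes both cross terms real, which leaves a
      real polynomial in \<open>t\<close> with linear coefficient \<open>- 2 * N\<close>.\<close>
    define z where "z = - of_real t * cnj w"
    have "cinner (y + z *\<^sub>C x) (X (y + z *\<^sub>C x)) =
        cinner y (X y) + z * w + cnj z * cnj w + cnj z * z * cinner x (X x)"
      by (simp add: blinfun.add_right cl cinner_simps xy d(1) algebra_simps)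
    also have "\<dots> = cinner y (X y) - of_real (2 * t) * (w * cnj w) + of_real (t * t) * (w * cnj w) * cinner x (X x)"
      by (simp add: z_def algebra_simps)
    also have "Re \<dots> = Q - 2 * t * N + t * t * N * P"
      by (simp only: wN) (simp add: d)
    finally show ?thesis using pos[of "y + z *\<^sub>C x"] by simp
  qed
  have "N \<le> Q * P"
  proof (cases "P = 0")
    case True
    have "N = 0"
    proof (rule ccontr)
      assume "N \<noteq> 0"
      \<comment> \<open>For \<open>P = 0\<close> the polynomial is linear, and at this
        \<open>t\<close> its value is -1.\<close>
      then show False using quad[of "(Q + 1) / (2 * N)"] True by (simp add: field_simps)
    qed
    then show ?thesis using True by simp
  next
    case False
    then have "P > 0" using pos[of x] by (simp add: d)
    then show ?thesis using quad[of "1 / P"] by (simp add: field_simps)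
  qed
  then show ?thesis by (simp add: d)
qed

lemma pos_herm_kernel:
  assumes "X \<in> pos_herm" "Re (cinner x (X x)) = 0"
  shows "X x = 0"
  using pos_herm_Cauchy_Schwarz[OF assms(1), of "X x" x] assms(2) by simp

lemma Re_cinner_ketbra: "Re (cinner x (ketbra y y x)) = (cmod (cinner y x))\<^sup>2"
  by (simp add: cinner_simps cinner_mult_commute)

lemma convex_states: "convex states"
  by (auto simp: convex_alt states_def op_trace_simps intro!: pos_herm_add pos_herm_scaleR)

text \<open>Domination allows the segment from \<open>V\<close> to \<open>W\<close> to be prolonged
  beyond \<open>W\<close>: the normalised difference \<open>W'\<close> is a state, and
  \<open>W\<close> lies between \<open>V\<close> and \<open>W'\<close>.\<close>

lemma face_dominated:
  assumes face: "F face_of states" and W: "W \<in> F" and V: "V \<in> states"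
    and dom: "\<And>x. Re (cinner x (V x)) \<le> c * Re (cinner x (W x))"
  shows "V \<in> F"
proof -
  have Ws: "W \<in> states" using face W by (auto simp: face_of_def)
  \<comment> \<open>The maximum makes \<open>k - 1\<close>, the trace of
    \<open>k *\<^sub>R W - V\<close>, positive.\<close>
  define k where "k = max c 2"
  have k: "k \<ge> 2" "k \<ge> c" by (simp_all add: k_def)
  define W' where "W' = (1 / (k - 1)) *\<^sub>R (k *\<^sub>R W - V)"
  have "0 \<le> Re (cinner x ((k *\<^sub>R W - V) x))" for x
    using dom[of x] mult_right_mono[OF k(2), of "Re (cinner x (W x))"] Ws
    by (simp add: op_simps cinner_simps states_def pos_herm_def)
  then have "k *\<^sub>R W - V \<in> pos_herm"
    using Ws V by (simp add: pos_herm_def herm_diff herm_scaleR states_herm)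
  moreover have "op_trace W' = of_real ((1 / (k - 1)) * (k - 1))"
    using Ws V by (simp add: W'_def op_trace_simps states_def)
  then have "op_trace W' = 1" using k by simp
  ultimately have W': "W' \<in> states"
    using k by (simp add: states_def W'_def pos_herm_scaleR)
  have W_eq: "W = (1 - (k - 1) / k) *\<^sub>R V + ((k - 1) / k) *\<^sub>R W'"
    using k by (simp add: W'_def scaleR_diff_right field_simps)
  show ?thesis
  proof (cases "V = W'")
    case True
    then have "W = V" using W_eq by (simp flip: scaleR_add_left)
    then show ?thesis using W by simp
  next
    case False
    have "W \<in> open_segment V W'"
      unfolding in_segment using False k W_eq by (intro conjI exI[of _ "(k - 1) / k"]) auto
    then show ?thesis using face W V W' by (auto simp: face_of_def)
  qed
qed

text \<open>A vector killed by a mixture of positive operators is killed by each of them, so the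
  support of a component lies in the support of the mixture.\<close>

lemma plane_states_face_of:
  assumes on: "orthonormal2 \<phi> \<psi>"
  shows "states \<inter> plane_herm \<phi> \<psi> face_of states"
proof -
  have supp: "A \<in> plane_herm \<phi> \<psi>"
    if A: "A \<in> states" and B: "B \<in> states" and X: "X \<in> plane_herm \<phi> \<psi>"
      and u: "X = s *\<^sub>R A + t *\<^sub>R B" "0 < s" "0 < t" for A B X s t
  proof -
    have "A z = 0" if "X z = 0" for z
    proof (rule pos_herm_kernel)
      show "A \<in> pos_herm" using A by (simp add: states_def)
      have nn: "0 \<le> Re (cinner z (A z))" "0 \<le> Re (cinner z (B z))"
        using A B by (auto simp: states_def pos_herm_def)
      have "s * Re (cinner z (A z)) + t * Re (cinner z (B z)) = Re (cinner z (X z))"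
        by (simp add: u op_simps cinner_simps)
      then have "s * Re (cinner z (A z)) + t * Re (cinner z (B z)) = 0" using that by simp
      moreover have "0 \<le> s * Re (cinner z (A z))" "0 \<le> t * Re (cinner z (B z))"
        using u nn by simp_all
      ultimately have "s * Re (cinner z (A z)) = 0" by linarith
      then show "Re (cinner z (A z)) = 0" using u by simp
    qed
    then have "op_support A \<subseteq> op_support X" by (auto simp: op_support_def)
    moreover have "op_support X \<subseteq> cvec.span {\<phi>, \<psi>}"
      using X op_support_subset_iff[OF on] by (auto simp: plane_herm_def)
    ultimately show ?thesis
      using op_support_subset_iff[OF on states_herm[OF A]] by blast
  qed
  show ?thesis
    unfolding face_of_def
  proof (intro conjI ballI impI)
    show "convex (states \<inter> plane_herm \<phi> \<psi>)"
      by (intro convex_Int convex_states subspace_imp_convex plane_herm_subspace)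
    fix A B X assume AB: "A \<in> states" "B \<in> states" and "X \<in> states \<inter> plane_herm \<phi> \<psi>"
      and "X \<in> open_segment A B"
    then obtain u where u: "0 < u" "u < 1" "X = (1 - u) *\<^sub>R A + u *\<^sub>R B" and X: "X \<in> plane_herm \<phi> \<psi>"
      by (auto simp: in_segment)
    show "A \<in> states \<inter> plane_herm \<phi> \<psi>" "B \<in> states \<inter> plane_herm \<phi> \<psi>"
      using AB supp[OF AB X u(3)] supp[OF AB(2,1) X, of u "1 - u"] u by (simp_all add: add.commute)
  qed auto
qed

section \<open>Affine dimension and the classification of faces\<close>

lemma not_in_span_if_functional:
  fixes f :: "'v::real_vector \<Rightarrow> real"
  assumes "linear f" "\<And>s. s \<in> S \<Longrightarrow> f s = 0" "f d \<noteq> 0"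
  shows "d \<notin> span S"
  using linear_eq_0_on_span[OF assms(1,2)] assms(3) by blast

text \<open>A basis of the directions of the face, based at \<open>ketbra \<psi> \<psi>\<close>. The
  order is triangular: each element is detected by a matrix entry that vanishes on the elements
  listed after it.\<close>

definition plane_diffs :: "'h::fin_dim_complex_hilbert \<Rightarrow> 'h \<Rightarrow> 'h op set" where
  "plane_diffs \<phi> \<psi> =
    (let \<eta> = (1 / of_real (sqrt 2)) *\<^sub>C (\<phi> + \<psi>); \<zeta> = (1 / of_real (sqrt 2)) *\<^sub>C (\<phi> + \<i> *\<^sub>C \<psi>)
     in {ketbra \<zeta> \<zeta> - ketbra \<psi> \<psi>, ketbra \<eta> \<eta> - ketbra \<psi> \<psi>, ketbra \<phi> \<phi> - ketbra \<psi> \<psi>})"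

lemma linear_Re_cinner: "linear (\<lambda>Y :: 'h::fin_dim_complex_hilbert op. Re (cinner x (Y y)))"
  and linear_Im_cinner: "linear (\<lambda>Y :: 'h::fin_dim_complex_hilbert op. Im (cinner x (Y y)))"
  by (auto intro!: linearI simp: op_simps cinner_simps)

lemma plane_diffs_independent:
  assumes on: "orthonormal2 \<phi> \<psi>"
  shows "independent (plane_diffs \<phi> \<psi>)" "card (plane_diffs \<phi> \<psi>) = 3"
proof -
  define \<eta> \<zeta> where d: "\<eta> = (1 / of_real (sqrt 2)) *\<^sub>C (\<phi> + \<psi>)" "\<zeta> = (1 / of_real (sqrt 2)) *\<^sub>C (\<phi> + \<i> *\<^sub>C \<psi>)"
  let ?d1 = "ketbra \<phi> \<phi> - ketbra \<psi> \<psi>" and ?d2 = "ketbra \<eta> \<eta> - ketbra \<psi> \<psi>" and ?d3 = "ketbra \<zeta> \<zeta> - ketbra \<psi> \<psi>"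
  have eq: "plane_diffs \<phi> \<psi> = {?d3, ?d2, ?d1}" by (simp add: plane_diffs_def d Let_def)
  have e: "cinner \<phi> \<eta> = 1 / of_real (sqrt 2)" "cinner \<eta> \<psi> = 1 / of_real (sqrt 2)"
    "cinner \<phi> \<zeta> = 1 / of_real (sqrt 2)" "cinner \<zeta> \<psi> = - \<i> / of_real (sqrt 2)"
    by (simp_all add: d cinner_simps orthonormal2_cinner[OF on])
  note s = op_simps cinner_add_right cinner_minus_right cinner_diff_right cinner_scaleC_right
    orthonormal2_cinner[OF on] e
  have 1: "?d1 \<notin> span {}"
    by (rule not_in_span_if_functional[OF linear_Re_cinner[of \<phi> \<phi>]]) (simp_all add: s)
  have 2: "?d2 \<notin> span {?d1}"
    by (rule not_in_span_if_functional[OF linear_Re_cinner[of \<phi> \<psi>]]) (auto simp: s)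
  have 3: "?d3 \<notin> span {?d2, ?d1}"
    by (rule not_in_span_if_functional[OF linear_Im_cinner[of \<phi> \<psi>]]) (auto simp: s)
  show "independent (plane_diffs \<phi> \<psi>)"
    unfolding eq by (intro independent_insertI 1 2 3 independent_empty)
  have "?d2 \<notin> {?d1}" "?d3 \<notin> {?d2, ?d1}" by (rule contra_subsetD[OF span_superset 2], rule contra_subsetD[OF span_superset 3])
  then show "card (plane_diffs \<phi> \<psi>) = 3" unfolding eq by simp
qed

lemma plane_states_faces3:
  assumes on: "orthonormal2 \<phi> \<psi>"
  shows "states \<inter> plane_herm \<phi> \<psi> \<in> faces3"
proof -
  let ?F = "states \<inter> plane_herm \<phi> \<psi>"
  let ?D = "{V - W |V W. V \<in> ?F \<and> W \<in> ?F}"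
  define \<eta> \<zeta> where d: "\<eta> = (1 / of_real (sqrt 2)) *\<^sub>C (\<phi> + \<psi>)" "\<zeta> = (1 / of_real (sqrt 2)) *\<^sub>C (\<phi> + \<i> *\<^sub>C \<psi>)"
  let ?d1 = "ketbra \<phi> \<phi> - ketbra \<psi> \<psi>" and ?d2 = "ketbra \<eta> \<eta> - ketbra \<psi> \<psi>" and ?d3 = "ketbra \<zeta> \<zeta> - ketbra \<psi> \<psi>"
  have eq: "plane_diffs \<phi> \<psi> = {?d3, ?d2, ?d1}" by (simp add: plane_diffs_def d Let_def)
  note pp = plane_pure_states[OF on, folded d]
  have pure: "ketbra x x \<in> ?F" if "norm x = 1" "x \<in> cvec.span {\<phi>, \<psi>}" for x
    using that by (intro IntI states_ketbra ketbra_self_in_plane_herm)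
  have P: "ketbra \<phi> \<phi> \<in> ?F" "ketbra \<psi> \<psi> \<in> ?F" "ketbra \<eta> \<eta> \<in> ?F" "ketbra \<zeta> \<zeta> \<in> ?F"
    using on pp(1-4) by (simp_all only: pure orthonormal2_def cvec.span_base insert_iff simp_thms)
  have "dim ?D = 3"
  proof (rule dim_unique[of "plane_diffs \<phi> \<psi>"])
    show "plane_diffs \<phi> \<psi> \<subseteq> ?D" unfolding eq using P by blast
    show "?D \<subseteq> span (plane_diffs \<phi> \<psi>)"
    proof
      fix X assume "X \<in> ?D"
      then have X: "X \<in> plane_herm \<phi> \<psi>" and tr: "op_trace X = 0"
        using subspace_diff[OF plane_herm_subspace] by (auto simp: states_def op_trace_simps)
      define p q r s where pqrs: "p = Re (cinner \<phi> (X \<phi>))" "q = Re (cinner \<psi> (X \<psi>))"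
        "r = Re (cinner \<phi> (X \<psi>))" "s = - Im (cinner \<phi> (X \<psi>))"
      have X_eq: "X = p *\<^sub>R ketbra \<phi> \<phi> + q *\<^sub>R ketbra \<psi> \<psi> + r *\<^sub>R (ketbra \<phi> \<psi> + ketbra \<psi> \<phi>)
          + s *\<^sub>R scaleC_op \<i> (- ketbra \<phi> \<psi> + ketbra \<psi> \<phi>)"
        using plane_herm_expansion[OF on X] by (simp only: pqrs)
      have "op_trace X = of_real (p + q)"
        by (subst X_eq) (simp add: op_trace_simps orthonormal2_cinner[OF on])
      then have "p + q = 0" using tr by (metis of_real_eq_0_iff)
      then have q: "q = - p" by simp
      \<comment> \<open>\<open>pp\<close> replaces the off-diagonal operators by pure states;
        \<open>q = - p\<close>, which expresses trace zero, removes the fourth coordinate.\<close>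
      have "X = (p - r - s) *\<^sub>R ?d1 + (r + r) *\<^sub>R ?d2 + (s + s) *\<^sub>R ?d3"
        unfolding X_eq pp(5,6) q by (rule op_eqI) (simp add: op_simps cinner_simps algebra_simps)
      moreover have "?d1 \<in> span (plane_diffs \<phi> \<psi>)" "?d2 \<in> span (plane_diffs \<phi> \<psi>)" "?d3 \<in> span (plane_diffs \<phi> \<psi>)"
        unfolding eq by (auto intro: span_base)
      ultimately show "X \<in> span (plane_diffs \<phi> \<psi>)"
        by (metis span_add span_scale)
    qed
  qed (use plane_diffs_independent[OF on] in auto)
  then show ?thesis
    using plane_states_face_of[OF on] by (simp add: faces3_def)
qed

text \<open>The second vector is displayed as a combination of \<open>y\<close> and
  \<open>\<phi>\<close> so that it stays in every set of vectors that contains both and is closed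
  under linear combinations.\<close>

lemma unit_residual:
  assumes "norm \<phi> = 1" "\<And>c. y \<noteq> c *\<^sub>C \<phi>"
  obtains k l where "orthonormal2 \<phi> (k *\<^sub>C y + l *\<^sub>C \<phi>)" "y \<in> cvec.span {\<phi>, k *\<^sub>C y + l *\<^sub>C \<phi>}"
proof -
  define r where "r = y - cinner \<phi> y *\<^sub>C \<phi>"
  have r: "r \<noteq> 0" "cinner \<phi> r = 0"
    using assms by (auto simp: r_def cinner_simps cinner_unit)
  define n where "n = complex_of_real (norm r)"
  have n: "n \<noteq> 0" using r by (simp add: n_def)
  define \<psi> where "\<psi> = (1 / n) *\<^sub>C r"
  have \<psi>_eq: "\<psi> = (1 / n) *\<^sub>C y + (- (1 / n) * cinner \<phi> y) *\<^sub>C \<phi>"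
    by (simp add: \<psi>_def r_def cvec.scale_right_diff_distrib scaleC_scaleC cvec.scale_minus_left)
  have on: "orthonormal2 \<phi> \<psi>"
    using assms(1) r unit_multiple[OF r(1)] by (simp add: orthonormal2_def \<psi>_def n_def cinner_simps)
  have "y = n *\<^sub>C \<psi> + cinner \<phi> y *\<^sub>C \<phi>"
    using n by (simp add: \<psi>_def scaleC_scaleC scaleC_one r_def)
  moreover have "n *\<^sub>C \<psi> + cinner \<phi> y *\<^sub>C \<phi> \<in> cvec.span {\<phi>, \<psi>}"
    by (intro cvec.span_add cvec.span_scale cvec.span_base) auto
  ultimately have "y \<in> cvec.span {\<phi>, \<psi>}" by simp
  with on that show ?thesis unfolding \<psi>_eq by blast
qed

text \<open>The vectors whose projector is dominated by a multiple of a member of \<open>F\<close>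
  form a complex subspace, and its pure states belong to \<open>F\<close>. Counting directions makes
  it a plane: a line carries a single state, and three orthonormal vectors would give four
  independent differences.\<close>

lemma faces3_face_basis:
  fixes F :: "'h::fin_dim_complex_hilbert op set"
  assumes F: "F \<in> faces3"
  obtains \<phi> \<psi> where "face_basis F \<phi> \<psi>"
proof -
  have face: "F face_of states" using F by (simp add: faces3_def)
  then have sub: "F \<subseteq> states" and conv: "convex F" by (auto simp: face_of_def)
  let ?D = "{V - W |V W. V \<in> F \<and> W \<in> F}"
  have "dim ?D = 3" using F by (simp add: faces3_def)
  moreover obtain B where "B \<subseteq> ?D" "independent B" "?D \<subseteq> span B" "card B = dim ?D"
    by (rule basis_exists)
  ultimately have B: "B \<subseteq> ?D" "independent B" "?D \<subseteq> span B" "card B = 3" by simp_all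
  have B_fin: "finite B" using B(4) card.infinite by fastforce
  have not_trivial: "\<not> ?D \<subseteq> {0}"
  proof
    assume "?D \<subseteq> {0}"
    with B(1) have "B \<subseteq> {0}" by (rule subset_trans)
    moreover have "0 \<notin> B" using B(2) dependent_zero by metis
    ultimately have "B = {}" by auto
    then show False using B(4) by simp
  qed
  have pos: "0 \<le> Re (cinner x (W x))" and herm: "W \<in> herm" and W_pos: "W \<in> pos_herm"
    and tr: "op_trace W = 1" if "W \<in> F" for W x
    using subsetD[OF sub that] by (simp_all add: states_def pos_herm_def)
  \<comment> \<open>\<open>N\<close> turns out to be the plane to which \<open>F\<close> belongs.\<close>
  define N where "N = {\<xi> :: 'h. \<exists>W\<in>F. \<exists>c. \<forall>x. (cmod (cinner \<xi> x))\<^sup>2 \<le> c * Re (cinner x (W x))}"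
  have N_pure: "ketbra \<xi> \<xi> \<in> F" if "\<xi> \<in> N" "norm \<xi> = 1" for \<xi>
  proof -
    obtain W c where "W \<in> F" "\<And>x. (cmod (cinner \<xi> x))\<^sup>2 \<le> c * Re (cinner x (W x))"
      using \<open>\<xi> \<in> N\<close> unfolding N_def by blast
    then show ?thesis
      using face_dominated[OF face, of W "ketbra \<xi> \<xi>" c] states_ketbra[OF that(2)]
      by (simp only: Re_cinner_ketbra)
  qed
  have N_scale: "k *\<^sub>C \<xi> \<in> N" if \<xi>: "\<xi> \<in> N" for k \<xi>
  proof -
    obtain W c where W: "W \<in> F" "\<And>x. (cmod (cinner \<xi> x))\<^sup>2 \<le> c * Re (cinner x (W x))"
      using \<xi> unfolding N_def by blast
    have "(cmod (cinner (k *\<^sub>C \<xi>) x))\<^sup>2 \<le> ((cmod k)\<^sup>2 * c) * Re (cinner x (W x))" for x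
      using mult_left_mono[OF W(2)[of x], of "(cmod k)\<^sup>2"]
      by (simp add: cinner_simps norm_mult power_mult_distrib mult.assoc)
    then show ?thesis using W(1) unfolding N_def by blast
  qed
  have N_add: "\<xi> + \<xi>' \<in> N" if \<xi>: "\<xi> \<in> N" "\<xi>' \<in> N" for \<xi> \<xi>'
  proof -
    obtain W c where W: "W \<in> F" "\<And>x. (cmod (cinner \<xi> x))\<^sup>2 \<le> c * Re (cinner x (W x))"
      using \<xi> unfolding N_def by blast
    obtain W' c' where W': "W' \<in> F" "\<And>x. (cmod (cinner \<xi>' x))\<^sup>2 \<le> c' * Re (cinner x (W' x))"
      using \<xi> unfolding N_def by blast
    define C where "C = \<bar>c\<bar> + \<bar>c'\<bar>"
    \<comment> \<open>The midpoint dominates multiples of both states. Its weights and the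
      inequality (s + t)^2 \<le> 2 s^2 + 2 t^2 account for the factor \<open>4\<close>
      below.\<close>
    have M: "(1/2) *\<^sub>R W + (1/2) *\<^sub>R W' \<in> F"
      using conv W(1) W'(1) by (auto simp: convex_def)
    have "(cmod (cinner (\<xi> + \<xi>') x))\<^sup>2 \<le> (4 * C) * Re (cinner x (((1/2) *\<^sub>R W + (1/2) *\<^sub>R W') x))" for x
    proof -
      have "(cmod (cinner (\<xi> + \<xi>') x))\<^sup>2 \<le> (cmod (cinner \<xi> x) + cmod (cinner \<xi>' x))\<^sup>2"
        by (simp add: cinner_simps norm_triangle_ineq power_mono)
      also have "\<dots> \<le> 2 * (cmod (cinner \<xi> x))\<^sup>2 + 2 * (cmod (cinner \<xi>' x))\<^sup>2"
        using sum_squares_bound[of "cmod (cinner \<xi> x)" "cmod (cinner \<xi>' x)"]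
        by (simp add: power2_sum)
      also have "\<dots> \<le> 2 * (C * Re (cinner x (W x))) + 2 * (C * Re (cinner x (W' x)))"
      proof -
        have "c \<le> C" "c' \<le> C" by (simp_all add: C_def)
        then show ?thesis
          using W(2)[of x] W'(2)[of x] mult_right_mono[OF _ pos[OF W(1), of x], of c C]
            mult_right_mono[OF _ pos[OF W'(1), of x], of c' C]
          by linarith
      qed
      also have "\<dots> = (4 * C) * Re (cinner x (((1/2) *\<^sub>R W + (1/2) *\<^sub>R W') x))"
        by (simp add: op_simps cinner_simps algebra_simps)
      finally show ?thesis .
    qed
    then show ?thesis using M unfolding N_def by blast
  qed
  \<comment> \<open>By Cauchy-Schwarz for the form of \<open>W\<close>, the projector of
    \<open>W y\<close> is dominated by \<open>W\<close> with constant
    \<open>Re (cinner y (W y))\<close>.\<close>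
  have N_range: "W y \<in> N" if "W \<in> F" for W y
    using pos_herm_Cauchy_Schwarz[OF W_pos[OF that], of y] that
    unfolding N_def by (auto simp: herm_cinner[OF herm[OF that]])
  obtain W0 where W0: "W0 \<in> F" using not_trivial by blast
  have "\<exists>y. W0 y \<noteq> 0"
    using tr[OF W0] by (auto simp: op_trace_onb intro: ccontr)
  then obtain y0 where y0: "W0 y0 \<noteq> 0" by blast
  define \<phi> where "\<phi> = (1 / of_real (norm (W0 y0))) *\<^sub>C W0 y0"
  have \<phi>: "norm \<phi> = 1" "\<phi> \<in> N"
    using unit_multiple[OF y0] N_scale[OF N_range[OF W0]] by (simp_all add: \<phi>_def)
  have "\<exists>\<xi>\<in>N. \<forall>c. \<xi> \<noteq> c *\<^sub>C \<phi>"
  proof (rule ccontr)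
    assume "\<not> ?thesis"
    then have line: "\<exists>c. \<xi> = c *\<^sub>C \<phi>" if "\<xi> \<in> N" for \<xi> using that by blast
    have "W = ketbra \<phi> \<phi>" if W: "W \<in> F" for W
    proof -
      have Wx: "W x = cinner \<phi> (W x) *\<^sub>C \<phi>" for x
      proof -
        obtain c where "W x = c *\<^sub>C \<phi>" using line N_range[OF W] by blast
        then show ?thesis using \<phi>(1) by (simp add: cinner_simps cinner_unit)
      qed
      have Wx': "W x = (cnj (cinner \<phi> (W \<phi>)) * cinner \<phi> x) *\<^sub>C \<phi>" for x
      proof -
        have "cinner \<phi> (W x) = cinner (W \<phi>) x" by (simp add: herm_cinner[OF herm[OF that]])
        also have "\<dots> = cnj (cinner \<phi> (W \<phi>)) * cinner \<phi> x"
          by (subst Wx) (simp add: cinner_simps)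
        finally have inner: "cinner \<phi> (W x) = cnj (cinner \<phi> (W \<phi>)) * cinner \<phi> x" .
        show ?thesis by (subst Wx, subst inner) (rule refl)
      qed
      define w where "w = cnj (cinner \<phi> (W \<phi>))"
      have W_eq: "W = scaleC_op w (ketbra \<phi> \<phi>)"
        by (rule blinfun_eqI, subst Wx') (simp add: scaleC_scaleC w_def)
      then have "op_trace W = w"
        by (simp add: op_trace_simps cinner_unit \<phi>(1))
      then show ?thesis using tr[OF W] W_eq by simp
    qed
    then have "V - W = 0" if "V \<in> F" "W \<in> F" for V W
      using that by (metis diff_self)
    then have "?D \<subseteq> {0}" by blast
    then show False using not_trivial by blast
  qed
  then obtain \<xi> where \<xi>: "\<xi> \<in> N" "\<And>c. \<xi> \<noteq> c *\<^sub>C \<phi>" by blast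
  obtain k l where "orthonormal2 \<phi> (k *\<^sub>C \<xi> + l *\<^sub>C \<phi>)"
    using unit_residual[OF \<phi>(1) \<xi>(2)] by metis
  moreover define \<psi> where "\<psi> = k *\<^sub>C \<xi> + l *\<^sub>C \<phi>"
  ultimately have on: "orthonormal2 \<phi> \<psi>" and \<psi>: "\<psi> \<in> N"
    using \<xi> \<phi> by (auto intro: N_add N_scale)
  have N_span: "\<eta> \<in> N" if "\<eta> \<in> cvec.span {\<phi>, \<psi>}" for \<eta>
  proof -
    have "\<eta> = cinner \<phi> \<eta> *\<^sub>C \<phi> + cinner \<psi> \<eta> *\<^sub>C \<psi>" using that in_span2_iff[OF on] by blast
    then show ?thesis using N_add[OF N_scale[OF \<phi>(2)] N_scale[OF \<psi>]] by metis
  qed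
  have span_N: "\<eta> \<in> cvec.span {\<phi>, \<psi>}" if \<eta>: "\<eta> \<in> N" for \<eta>
  proof (rule ccontr)
    assume "\<eta> \<notin> cvec.span {\<phi>, \<psi>}"
    define r where "r = \<eta> + (- cinner \<phi> \<eta>) *\<^sub>C \<phi> + (- cinner \<psi> \<eta>) *\<^sub>C \<psi>"
    have r0: "r \<noteq> 0"
    proof
      assume "r = 0"
      then have "\<eta> = cinner \<phi> \<eta> *\<^sub>C \<phi> + cinner \<psi> \<eta> *\<^sub>C \<psi>"
        by (simp add: r_def cvec.scale_minus_left algebra_simps)
      then show False using \<open>\<eta> \<notin> cvec.span {\<phi>, \<psi>}\<close> in_span2_iff[OF on] by blast
    qed
    have rN: "r \<in> N" unfolding r_def by (intro N_add N_scale \<eta> \<phi>(2) \<psi>)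
    define \<omega> where "\<omega> = (1 / of_real (norm r)) *\<^sub>C r"
    have \<omega>: "norm \<omega> = 1" "\<omega> \<in> N" using unit_multiple[OF r0] N_scale[OF rN] by (simp_all add: \<omega>_def)
    have \<omega>_orth: "cinner \<phi> \<omega> = 0" "cinner \<psi> \<omega> = 0"
      by (simp_all add: \<omega>_def r_def cinner_simps orthonormal2_cinner[OF on])
    note \<omega>_orth' = \<omega>_orth[THEN cinner_orthogonal_commute]
    let ?d = "ketbra \<omega> \<omega> - ketbra \<psi> \<psi>"
    have pure: "ketbra x x \<in> F" if "norm x = 1" "x \<in> cvec.span {\<phi>, \<psi>}" for x
      using that N_pure N_span by blast
    have pd: "plane_diffs \<phi> \<psi> \<subseteq> ?D"
    proof -
      have "ketbra \<phi> \<phi> \<in> F" "ketbra \<psi> \<psi> \<in> F"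
        using on by (auto intro!: pure simp: orthonormal2_def cvec.span_base)
      then show ?thesis
        unfolding plane_diffs_def Let_def
        using pure[OF plane_pure_states(1,3)[OF on]] pure[OF plane_pure_states(2,4)[OF on]] by blast
    qed
    have d_in: "?d \<in> ?D"
      using N_pure[OF \<omega>(2,1)] N_pure[OF \<psi>] on by (auto simp: orthonormal2_def)
    \<comment> \<open>The diagonal entry at \<open>\<omega>\<close> vanishes on
      \<open>plane_diffs \<phi> \<psi>\<close> and is one on \<open>?d\<close>, which is thus a
      fourth independent direction.\<close>
    have d_span: "?d \<notin> span (plane_diffs \<phi> \<psi>)"
      by (rule not_in_span_if_functional[OF linear_Re_cinner[of \<omega> \<omega>]])
        (auto simp: plane_diffs_def Let_def op_simps cinner_simps \<omega>_orth \<omega>_orth' cinner_unit[OF \<omega>(1)])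
    then have ind: "independent (insert ?d (plane_diffs \<phi> \<psi>))"
      using plane_diffs_independent(1)[OF on] by (rule independent_insertI)
    have "?d \<notin> plane_diffs \<phi> \<psi>" by (rule contra_subsetD[OF span_superset d_span])
    moreover have "finite (plane_diffs \<phi> \<psi>)" by (simp add: plane_diffs_def Let_def)
    ultimately have "card (insert ?d (plane_diffs \<phi> \<psi>)) = 4"
      using plane_diffs_independent[OF on] by simp
    moreover have "insert ?d (plane_diffs \<phi> \<psi>) \<subseteq> span B"
      using B(3) pd d_in by blast
    ultimately show False
      using independent_span_bound[OF B_fin ind] B(4) by simp
  qed
  have "F = states \<inter> plane_herm \<phi> \<psi>"
  proof
    show "F \<subseteq> states \<inter> plane_herm \<phi> \<psi>"
      using sub herm N_range span_N by (auto simp: plane_herm_def)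
    show "states \<inter> plane_herm \<phi> \<psi> \<subseteq> F"
    proof
      fix V assume V: "V \<in> states \<inter> plane_herm \<phi> \<psi>"
      have P: "ketbra \<phi> \<phi> \<in> F" "ketbra \<psi> \<psi> \<in> F"
        using on N_pure \<phi> \<psi> by (auto simp: orthonormal2_def)
      \<comment> \<open>Half the projection onto the plane. The projection times
        \<open>norm V\<close> dominates \<open>V\<close>, whence the constant
        \<open>2 * norm V\<close>.\<close>
      have M: "(1/2) *\<^sub>R ketbra \<phi> \<phi> + (1/2) *\<^sub>R ketbra \<psi> \<psi> \<in> F"
        using conv P by (auto simp: convex_def)
      show "V \<in> F"
      proof (rule face_dominated[OF face M])
        show "V \<in> states" using V by simp
        fix x
        define y where "y = cinner \<phi> x *\<^sub>C \<phi> + cinner \<psi> x *\<^sub>C \<psi>"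
        have Vh: "V \<in> herm" and Vs: "V z = cinner \<phi> (V z) *\<^sub>C \<phi> + cinner \<psi> (V z) *\<^sub>C \<psi>" for z
          using V in_span2_iff[OF on] by (auto simp: plane_herm_def)
        have xy: "cinner x (V z) = cinner y (V z)" for z
          by (subst (1 2) Vs) (simp add: y_def cinner_simps orthonormal2_cinner[OF on] flip: cinner_commute)
        have "cinner x (V x) = cinner y (V x)" by (rule xy)
        also have "\<dots> = cnj (cinner x (V y))"
          by (metis herm_cinner[OF Vh] cinner_commute)
        also have "\<dots> = cnj (cinner y (V y))" by (simp only: xy)
        finally have "Re (cinner x (V x)) = inner y (V y)" by (simp add: inner_eq_Re_cinner)
        also have "\<dots> \<le> norm y * norm (V y)" by (rule norm_cauchy_schwarz)
        also have "\<dots> \<le> norm y * (norm V * norm y)" by (intro mult_left_mono norm_blinfun) simp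
        also have "\<dots> = norm V * (norm y)\<^sup>2" by (simp add: power2_eq_square)
        also have "(norm y)\<^sup>2 = Re (cinner y y)" by (simp add: cinner_self)
        also have "Re (cinner y y) = (cmod (cinner \<phi> x))\<^sup>2 + (cmod (cinner \<psi> x))\<^sup>2"
          unfolding y_def cmod_power2
          by (simp add: cinner_simps orthonormal2_cinner[OF on] power2_eq_square)
        also have "norm V * \<dots> = (2 * norm V) * Re (cinner x (((1/2) *\<^sub>R ketbra \<phi> \<phi> + (1/2) *\<^sub>R ketbra \<psi> \<psi>) x))"
          unfolding blinfun.add_left blinfun.scaleR_left cinner_add_right cinner_scaleR_right
          by (simp add: Re_cinner_ketbra[simplified] algebra_simps)
        finally show "Re (cinner x (V x)) \<le> (2 * norm V) * Re (cinner x (((1/2) *\<^sub>R ketbra \<phi> \<phi> + (1/2) *\<^sub>R ketbra \<psi> \<psi>) x))" .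
      qed
    qed
  qed
  then show ?thesis using on that face_basis_iff by blast
qed

section \<open>Orientation\<close>

text \<open>The given orthonormal pair guarantees a second dimension, so that dependent vectors
  \<open>a\<close> and \<open>b\<close> can be completed to a plane.\<close>

lemma ex_plane_through:
  fixes \<phi> \<psi> a b :: "'h::fin_dim_complex_hilbert"
  assumes "orthonormal2 \<phi> \<psi>"
  obtains u v where "orthonormal2 u v" "a \<in> cvec.span {u, v}" "b \<in> cvec.span {u, v}"
proof -
  have ex: "\<exists>u v. orthonormal2 u v \<and> a \<in> cvec.span {u, v} \<and> b \<in> cvec.span {u, v}" if a: "a \<noteq> 0" for a b :: 'h
  proof -
    define u where "u = (1 / of_real (norm a)) *\<^sub>C a"
    have u: "norm u = 1" using unit_multiple[OF a] by (simp add: u_def)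
    have a_eq: "a = of_real (norm a) *\<^sub>C u" using a by (simp add: u_def scaleC_scaleC scaleC_one)
    have a_in: "a \<in> cvec.span {u, v}" for v
      by (subst a_eq) (simp add: cvec.span_scale cvec.span_base)
    show ?thesis
    proof (cases "\<exists>c. b = c *\<^sub>C u")
      case True
      have "\<exists>y. \<forall>c. y \<noteq> c *\<^sub>C u"
      proof (rule ccontr)
        assume "\<not> ?thesis"
        then obtain k l where kl: "\<phi> = k *\<^sub>C u" "\<psi> = l *\<^sub>C u" by metis
        have "cinner \<phi> \<phi> = 1" "cinner \<psi> \<psi> = 1" "cinner \<phi> \<psi> = 0"
          using orthonormal2_cinner[OF assms] by auto
        then show False unfolding kl by (auto simp: cinner_simps cinner_unit[OF u])
      qed
      then obtain y v where "orthonormal2 u v" using unit_residual[OF u] by metis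
      moreover have "b \<in> cvec.span {u, v}" using True by (auto intro: cvec.span_scale cvec.span_base)
      ultimately show ?thesis using a_in by blast
    next
      case False
      then obtain v where "orthonormal2 u v" "b \<in> cvec.span {u, v}" using unit_residual[OF u] by metis
      then show ?thesis using a_in by blast
    qed
  qed
  consider "a \<noteq> 0" | "b \<noteq> 0" | "a = 0" "b = 0" by blast
  then show ?thesis
  proof cases
    case 1
    then show ?thesis using ex that by blast
  next
    case 2
    then show ?thesis using ex[of b a] that by blast
  next
    case 3
    then show ?thesis using that[OF assms] by (simp add: cvec.span_zero)
  qed
qed

section \<open>Reduction of orientation to one determinant\<close>

lemma std_basis_in_plane_herm:
  assumes "u \<in> cvec.span {\<phi>, \<psi>}" "v \<in> cvec.span {\<phi>, \<psi>}"
  shows "std_basis u v j \<in> plane_herm \<phi> \<psi>"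
proof -
  have K: "adj_pair (ketbra u v + ketbra v u) (ketbra v u + ketbra u v)"
    "adj_pair (scaleC_op \<i> (scaleC_op (-1) (ketbra u v) + ketbra v u))
      (scaleC_op (cnj \<i>) (scaleC_op (cnj (-1)) (ketbra v u) + ketbra u v))"
    by (intro adj_pair_scaleC_op adj_pair_add adj_pair_ketbra)+
  have "scaleC_op (cnj \<i>) (scaleC_op (cnj (-1)) (ketbra v u) + ketbra u v)
      = scaleC_op \<i> (scaleC_op (-1) (ketbra u v) + ketbra v u)"
    by (rule op_eqI) (simp add: op_simps cinner_simps algebra_simps)
  with K have herm: "ketbra u v + ketbra v u \<in> herm" "scaleC_op \<i> (- ketbra u v + ketbra v u) \<in> herm"
    by (simp_all add: herm_iff_adj_pair add.commute)
  have "std_basis u v j \<in> herm"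
    using UNIV_index[of j] herm std_basis_2[of u v]
    by (elim disjE) (simp_all add: std_basis_def herm_scaleR herm_add herm_diff herm_ketbra)
  moreover have "std_basis u v j x \<in> cvec.span {\<phi>, \<psi>}" for x
    using UNIV_index[of j] assms
    by (elim disjE) (simp_all add: std_basis_def op_simps scaleR_scaleC
        cvec.span_scale cvec.span_add cvec.span_diff cvec.span_neg)
  ultimately show ?thesis by (simp add: plane_herm_def)
qed

text \<open>The mixed ket-bras inside the standard basis need not be Hermitian, so \<open>T\<close>
  reaches them only through its complex-linear extension.\<close>

lemma T_std_basis:
  assumes T: "operation T" and j: "std_basis u v j \<in> herm"
  shows "T (std_basis u v j) =
    (if j = 0 then (1 / sqrt 2) *\<^sub>R (L T u u + L T v v)
     else if j = 1 then (1 / sqrt 2) *\<^sub>R (L T u v + L T v u)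
     else if j = 2 then scaleC_op (\<i> / complex_of_real (sqrt 2)) (- L T u v + L T v u)
     else (1 / sqrt 2) *\<^sub>R (L T u u - L T v v))"
proof -
  have scaleR: "complex_extension T (r *\<^sub>R Z) = r *\<^sub>R complex_extension T Z" if "clinear_op Z" for r Z
    using complex_extension_scaleC[OF T that, of "of_real r"] by (simp add: scaleC_op_of_real)
  have minus: "complex_extension T (- Z) = - complex_extension T Z" if "clinear_op Z" for Z
    using scaleR[OF that, of "-1"] by simp
  have diff: "complex_extension T (Z - W) = complex_extension T Z - complex_extension T W"
    if "clinear_op Z" "clinear_op W" for Z W
    using that complex_extension_add[OF T, of Z "- W"] by (simp add: minus clinear_op_minus)
  have "T (std_basis u v j) = complex_extension T (std_basis u v j)"
    using j by (simp add: complex_extension_herm[OF T])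
  then show ?thesis
    using UNIV_index[of j]
    by (elim disjE) (simp_all add: std_basis_def scaleR minus diff complex_extension_add[OF T]
        complex_extension_scaleC[OF T] clinear_op_ketbra clinear_op_add clinear_op_diff clinear_op_minus)
qed

lemma std_basis_herm: "std_basis u v j \<in> herm"
  using std_basis_in_plane_herm[of u u v v j] by (simp add: plane_herm_def cvec.span_base)

text \<open>The determinant of \<open>T \<circ> X\<close> is again an alternating form in
  \<open>X\<close>, hence a multiple of \<open>Det F\<close>; the factor is its value on the
  standard basis. Orientation thus becomes the sign of one number.\<close>

lemma Det_image:
  assumes T: "operation T" and F: "face_basis F \<phi> \<psi>" and F': "face_basis F' \<phi>' \<psi>'"
    and sub: "T ` span F \<subseteq> span F'" and X: "X \<in> UNIV \<rightarrow> span F"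
  shows "Det F' (T \<circ> X) = plane_det \<phi>' \<psi>' (T \<circ> std_basis \<phi> \<psi>) * Det F X"
proof -
  have on: "orthonormal2 \<phi> \<psi>" and F_eq: "F = states \<inter> plane_herm \<phi> \<psi>"
    using F by (auto simp: face_basis_iff)
  have span: "span F = span (range (std_basis \<phi> \<psi>))"
    using span_plane_states[OF on] by (simp add: F_eq)
  have herm: "Y \<in> herm" if "Y \<in> span F" for Y
    using that span_plane_states(1)[OF on] by (simp add: F_eq plane_herm_def)
  note H = alternating_form_plane_det[of UNIV \<phi>' \<psi>']
  have upd: "T \<circ> Z(i := Y) = (T \<circ> Z)(i := T Y)" for Z :: "4 \<Rightarrow> 'a op" and i Y
    by auto
  have "alternating_form (span F) (\<lambda>X. plane_det \<phi>' \<psi>' (T \<circ> X))"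
    unfolding alternating_form_def
  proof (intro conjI ballI allI impI)
    fix Z :: "4 \<Rightarrow> 'a op" and i j assume "i \<noteq> j \<and> Z i = Z j"
    then show "plane_det \<phi>' \<psi>' (T \<circ> Z) = 0"
      using alternating_form_eq[OF H, of "T \<circ> Z" i j] by simp
  qed (simp_all only: upd herm operation_add[OF T] operation_scaleR[OF T]
      alternating_form_add[OF H] alternating_form_scale[OF H] UNIV_I Pi_I)
  from alternating_form_unique[OF this[unfolded span] alternating_form_plane_det _ X[unfolded span], of \<phi> \<psi>]
  have "plane_det \<phi>' \<psi>' (T \<circ> X) = plane_det \<phi>' \<psi>' (T \<circ> std_basis \<phi> \<psi>) * plane_det \<phi> \<psi> X"
    by (simp add: plane_det_std_basis orthonormal2_cinner[OF on])
  moreover have "T \<circ> X \<in> UNIV \<rightarrow> span F'"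
    using X sub by (auto simp: image_subset_iff Pi_iff)
  ultimately show ?thesis
    using Det_eq_plane_det[OF F X] Det_eq_plane_det[OF F'] by simp
qed

text \<open>The determinant is required to be nonnegative for all target pairs \<open>u\<close>,
  \<open>v\<close>, because \<open>F'\<close> need not be determined by \<open>T\<close> and
  \<open>F\<close>.\<close>

lemma orientation_preservingI:
  assumes T: "operation T"
    and planes: "\<And>\<phi> \<psi>. orthonormal2 \<phi> \<psi> \<Longrightarrow> \<exists>u v. orthonormal2 u v \<and> T ` plane_herm \<phi> \<psi> \<subseteq> plane_herm u v"
    and det: "\<And>\<phi> \<psi> u v. orthonormal2 \<phi> \<psi> \<Longrightarrow> orthonormal2 u v \<Longrightarrow> 0 \<le> plane_det u v (T \<circ> std_basis \<phi> \<psi>)"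
  shows "orientation_preserving T"
  unfolding orientation_preserving_def
proof (intro conjI ballI impI)
  fix F :: "'a op set" assume "F \<in> faces3"
  then obtain \<phi> \<psi> where "face_basis F \<phi> \<psi>" by (rule faces3_face_basis)
  then have on: "orthonormal2 \<phi> \<psi>" and F_eq: "F = states \<inter> plane_herm \<phi> \<psi>"
    by (auto simp: face_basis_iff)
  obtain u v where uv: "orthonormal2 u v" "T ` plane_herm \<phi> \<psi> \<subseteq> plane_herm u v"
    using planes[OF on] by blast
  then show "\<exists>F'\<in>faces3. T ` span F \<subseteq> span F'"
    unfolding F_eq span_plane_states(1)[OF on]
    by (intro bexI[OF _ plane_states_faces3[OF uv(1)]]) (simp add: span_plane_states(1))
next
  fix F F' :: "'a op set" and X
  assume FF': "F \<in> faces3" "F' \<in> faces3" and sub: "T ` span F \<subseteq> span F'"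
    and X: "X \<in> UNIV \<rightarrow> span F" and pos: "0 \<le> Det F X"
  obtain \<phi> \<psi> where F: "face_basis F \<phi> \<psi>" using FF'(1) by (rule faces3_face_basis)
  obtain u v where F': "face_basis F' u v" using FF'(2) by (rule faces3_face_basis)
  have "0 \<le> plane_det u v (T \<circ> std_basis \<phi> \<psi>)"
    using F F' by (intro det) (auto simp: face_basis_iff)
  then show "0 \<le> Det F' (T \<circ> X)"
    using pos by (simp add: Det_image[OF T F F' sub X])
qed

text \<open>Any plane containing \<open>\<eta>\<close> serves as target. The images of the standard
  basis are real multiples of one operator, so their determinant vanishes in all
  coordinates.\<close>

lemma orientation_preserving_rank_one:
  assumes T: "operation T"
    and R: "\<And>Z. clinear_op Z \<Longrightarrow> \<exists>c. complex_extension T Z = scaleC_op c (ketbra \<eta> \<eta>)"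
  shows "orientation_preserving T"
proof (rule orientation_preservingI[OF T])
  have R': "\<exists>c. T X = scaleC_op c (ketbra \<eta> \<eta>)" if "X \<in> herm" for X
    using R[OF herm_clinear[OF that]] by (simp add: complex_extension_herm[OF T that])
  show "\<exists>u v. orthonormal2 u v \<and> T ` plane_herm \<phi> \<psi> \<subseteq> plane_herm u v" if on: "orthonormal2 \<phi> \<psi>" for \<phi> \<psi>
  proof -
    obtain u v where uv: "orthonormal2 u v" "\<eta> \<in> cvec.span {u, v}"
      using ex_plane_through[OF on] by metis
    have "T X \<in> plane_herm u v" if "X \<in> plane_herm \<phi> \<psi>" for X
    proof -
      have X: "X \<in> herm" using that by (simp add: plane_herm_def)
      then obtain c where "T X = scaleC_op c (ketbra \<eta> \<eta>)" using R' by blast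
      then show ?thesis
        using operation_herm[OF T X] uv(2) by (auto simp: plane_herm_def cvec.span_scale)
    qed
    then show ?thesis using uv(1) by blast
  qed
  have real: "\<exists>r. T X = r *\<^sub>R ketbra \<eta> \<eta>" if X: "X \<in> herm" for X
  proof (cases "\<eta> = 0")
    case True
    obtain c where "T X = scaleC_op c (ketbra \<eta> \<eta>)" using R'[OF X] by blast
    then have "T X = 0 *\<^sub>R ketbra \<eta> \<eta>" by (intro blinfun_eqI) (simp add: True op_simps)
    then show ?thesis by blast
  next
    case False
    obtain c where c: "T X = scaleC_op c (ketbra \<eta> \<eta>)" using R'[OF X] by blast
    have "Im (c * of_real ((norm \<eta>)\<^sup>2 * (norm \<eta>)\<^sup>2)) = 0"
      using herm_Im_zero[OF operation_herm[OF T X], of \<eta>] by (simp add: c cinner_simps cinner_self)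
    then have "c = of_real (Re c)" using False by (simp add: complex_eq_iff)
    then have "T X = Re c *\<^sub>R ketbra \<eta> \<eta>" by (metis c scaleC_op_of_real)
    then show ?thesis by blast
  qed
  fix \<phi> \<psi> u v :: 'a
  obtain t where "\<And>j. T (std_basis \<phi> \<psi> j) = t j *\<^sub>R ketbra \<eta> \<eta>"
    using choice[of "\<lambda>j r. T (std_basis \<phi> \<psi> j) = r *\<^sub>R ketbra \<eta> \<eta>"] real[OF std_basis_herm] by blast
  then have "plane_det u v (T \<circ> std_basis \<phi> \<psi>) = 0"
    by (simp add: plane_det_def det4_def Let_def op_simps cinner_scaleR_right del: ketbra_apply)
  then show "0 \<le> plane_det u v (T \<circ> std_basis \<phi> \<psi>)" by simp
qed

text \<open>The standard quadruple of \<open>\<phi>\<close>, \<open>\<psi>\<close> goes to that of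
  \<open>A \<phi>\<close>, \<open>A \<psi>\<close>, whose determinant is a fourth power of a
  modulus. The target plane only has to contain these two vectors, which may be dependent.\<close>

lemma orientation_preserving_conjugation:
  assumes T: "operation T" and L: "\<And>g h. L T g h = ketbra (A g) (A h)"
  shows "orientation_preserving T"
proof (rule orientation_preservingI[OF T])
  have std: "T (std_basis \<phi> \<psi> j) = std_basis (A \<phi>) (A \<psi>) j" for \<phi> \<psi> j
    by (subst T_std_basis[OF T std_basis_herm]) (simp add: L std_basis_def)
  show "\<exists>u v. orthonormal2 u v \<and> T ` plane_herm \<phi> \<psi> \<subseteq> plane_herm u v" if on: "orthonormal2 \<phi> \<psi>" for \<phi> \<psi>
  proof -
    obtain u v where uv: "orthonormal2 u v" "A \<phi> \<in> cvec.span {u, v}" "A \<psi> \<in> cvec.span {u, v}"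
      using ex_plane_through[OF on] by metis
    have "X \<in> herm \<and> T X \<in> plane_herm u v" if "X \<in> span (range (std_basis \<phi> \<psi>))" for X
      using that
    proof (rule span_induct[where P = "\<lambda>X. X \<in> herm \<and> T X \<in> plane_herm u v"])
      show "subspace {X. X \<in> herm \<and> T X \<in> plane_herm u v}"
        using plane_herm_subspace[of u v]
        by (auto intro!: subspaceI simp: herm_zero herm_add herm_scaleR operation_zero[OF T]
            operation_add[OF T] operation_scaleR[OF T] subspace_0 subspace_add subspace_scale)
    qed (auto simp: std std_basis_herm std_basis_in_plane_herm[OF uv(2,3)])
    then show ?thesis using uv(1) span_plane_states(2)[OF on] by blast
  qed
  show "0 \<le> plane_det u v (T \<circ> std_basis \<phi> \<psi>)" for \<phi> \<psi> u v
  proof -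
    have "T \<circ> std_basis \<phi> \<psi> = std_basis (A \<phi>) (A \<psi>)" using std by auto
    then show ?thesis by (simp add: plane_det_std_basis)
  qed
qed

text \<open>The products of the dual pair with \<open>a\<close> and \<open>b\<close> form the
  identity matrix, which factors through the matrix of components in \<open>\<phi>\<close>,
  \<open>\<psi>\<close>; determinants are multiplicative.\<close>

lemma independent2_det:
  assumes ind: "independent2 a b" and on: "orthonormal2 \<phi> \<psi>"
    and ab: "a \<in> cvec.span {\<phi>, \<psi>}" "b \<in> cvec.span {\<phi>, \<psi>}"
  shows "cinner \<phi> a * cinner \<psi> b - cinner \<psi> a * cinner \<phi> b \<noteq> 0"
proof
  assume det: "cinner \<phi> a * cinner \<psi> b - cinner \<psi> a * cinner \<phi> b = 0"
  obtain p q where pq: "cinner p a = 1" "cinner p b = 0" "cinner q a = 0" "cinner q b = 1"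
    using independent2_dual[OF ind] .
  have a: "a = cinner \<phi> a *\<^sub>C \<phi> + cinner \<psi> a *\<^sub>C \<psi>" and b: "b = cinner \<phi> b *\<^sub>C \<phi> + cinner \<psi> b *\<^sub>C \<psi>"
    using ab in_span2_iff[OF on] by auto
  have e: "cinner z a = cinner \<phi> a * cinner z \<phi> + cinner \<psi> a * cinner z \<psi>"
    "cinner z b = cinner \<phi> b * cinner z \<phi> + cinner \<psi> b * cinner z \<psi>" for z
    by (subst a, simp add: cinner_simps, subst b, simp add: cinner_simps)
  have "cinner p a * cinner q b - cinner p b * cinner q a =
      (cinner \<phi> a * cinner \<psi> b - cinner \<psi> a * cinner \<phi> b) * (cinner p \<phi> * cinner q \<psi> - cinner p \<psi> * cinner q \<phi>)"
    by (subst e(1)[of p], subst e(2)[of q], subst e(2)[of p], subst e(1)[of q]) (simp add: algebra_simps)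
  then show False by (simp add: det pq)
qed

text \<open>The test quadruple is \<open>std_basis e f\<close>: its determinant is nonnegative even
  if \<open>e\<close> and \<open>f\<close> are not orthonormal. Its image is the quadruple of
  \<open>a\<close>, \<open>b\<close> with one sign reversed, and independence makes that determinant
  strictly negative.\<close>

lemma not_orientation_preserving_antilinear:
  assumes T: "operation T" and ind: "independent2 a b"
    and ee: "L T e e = ketbra a a" and ff: "L T f f = ketbra b b" and ef: "L T e f = ketbra b a"
  shows "\<not> orientation_preserving T"
proof
  assume OP: "orientation_preserving T"
  have fe: "L T f e = ketbra a b"
    by (rule op_eqI) (metis L_adj[OF T] ef adj_pair_ketbra adj_pair_cinner)
  obtain p q where pq: "cinner p a = 1" "cinner p b = 0" "cinner q a = 0" "cinner q b = 1"
    using independent2_dual[OF ind] .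
  have e0: "e \<noteq> 0"
  proof
    assume "e = 0"
    then have "ketbra a a = scaleC_op 0 (L T e e)" using L_scaleC_left[OF T, of 0 e e] ee by simp
    then have "cinner p (ketbra a a p) = 0" by simp
    moreover have "cinner a p = 1" using pq by (metis cinner_commute complex_cnj_one)
    ultimately show False using pq by (simp add: cinner_simps)
  qed
  define \<phi> where "\<phi> = (1 / of_real (norm e)) *\<^sub>C e"
  have \<phi>: "norm \<phi> = 1" using unit_multiple[OF e0] by (simp add: \<phi>_def)
  \<comment> \<open>If \<open>f\<close> were a multiple of \<open>e\<close>, then
    \<open>ketbra b b\<close> would be a multiple of \<open>ketbra a a\<close>, which evaluation at
    \<open>q\<close> refutes. Hence \<open>e\<close> and \<open>f\<close> span a plane.\<close>
  have "f \<noteq> c *\<^sub>C \<phi>" for c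
  proof
    assume "f = c *\<^sub>C \<phi>"
    then have "f = (c / of_real (norm e)) *\<^sub>C e" by (simp add: \<phi>_def scaleC_scaleC)
    then obtain k where "f = k *\<^sub>C e" by blast
    then have "ketbra b b = scaleC_op (k * cnj k) (ketbra a a)"
      using ff by (simp add: L_scaleC_left[OF T] L_scaleC_right[OF T] scaleC_op_scaleC_op ee mult.commute)
    then have "cinner q (ketbra b b q) = cinner q (scaleC_op (k * cnj k) (ketbra a a) q)" by simp
    moreover have "cinner b q = 1" using pq by (metis cinner_commute complex_cnj_one)
    ultimately show False using pq by (simp add: cinner_simps)
  qed
  then obtain \<psi> where on: "orthonormal2 \<phi> \<psi>" and f_in: "f \<in> cvec.span {\<phi>, \<psi>}"
    using unit_residual[OF \<phi>] by metis
  have "e = of_real (norm e) *\<^sub>C \<phi>" using e0 by (simp add: \<phi>_def scaleC_scaleC scaleC_one)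
  then have e_in: "e \<in> cvec.span {\<phi>, \<psi>}"
    by (metis cvec.span_base cvec.span_scale insertI1)
  let ?F = "states \<inter> plane_herm \<phi> \<psi>"
  have F: "?F \<in> faces3" "face_basis ?F \<phi> \<psi>" and span_F: "span ?F = plane_herm \<phi> \<psi>"
    using on plane_states_faces3[OF on] span_plane_states(1)[OF on] by (simp_all add: face_basis_iff)
  obtain F' where F'3: "F' \<in> faces3" and sub: "T ` span ?F \<subseteq> span F'"
    using OP F(1) unfolding orientation_preserving_def by blast
  obtain u v where F': "face_basis F' u v" using F'3 by (rule faces3_face_basis)
  then have on': "orthonormal2 u v" and span_F': "span F' = plane_herm u v"
    using span_plane_states(1) by (auto simp: face_basis_iff)
  have X: "std_basis e f \<in> UNIV \<rightarrow> span ?F"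
    using std_basis_in_plane_herm[OF e_in f_in] by (simp add: span_F)
  have "Det ?F (std_basis e f) \<ge> 0"
    by (simp add: Det_eq_plane_det[OF F(2) X] plane_det_std_basis)
  then have "0 \<le> Det F' (T \<circ> std_basis e f)"
    using OP F(1) F'3 sub X unfolding orientation_preserving_def by blast
  moreover have "T \<circ> std_basis e f \<in> UNIV \<rightarrow> span F'"
    using X sub by (auto simp: image_subset_iff Pi_iff)
  ultimately have "0 \<le> plane_det u v (T \<circ> std_basis e f)"
    using Det_eq_plane_det[OF F'] by simp
  \<comment> \<open>Exchanging the two mixed ket-bras changes only the element of index
    \<open>2\<close>, which is antisymmetric in them.\<close>
  also have "T \<circ> std_basis e f = (std_basis a b)(2 := (-1) *\<^sub>R std_basis a b 2)"
  proof
    show "(T \<circ> std_basis e f) j = ((std_basis a b)(2 := (-1) *\<^sub>R std_basis a b 2)) j" for j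
      unfolding comp_apply T_std_basis[OF T std_basis_herm] using UNIV_index[of j]
      by (elim disjE) (simp_all add: ee ff ef fe std_basis_def add.commute flip: scaleC_op_minus_right)
  qed
  also have "plane_det u v \<dots> = - plane_det u v (std_basis a b)"
    using alternating_form_scale[OF alternating_form_plane_det[of UNIV u v], of "std_basis a b" "std_basis a b 2" 2 "-1"]
    by simp
  finally have "cmod (cinner u a * cinner v b - cinner v a * cinner u b) ^ 4 \<le> 0"
    by (simp add: plane_det_std_basis)
  then have "cinner u a * cinner v b - cinner v a * cinner u b = 0"
    by (metis norm_eq_zero power_eq_0_iff zero_le_power norm_ge_zero order_antisym)
  moreover have "ketbra a a \<in> plane_herm u v" "ketbra b b \<in> plane_herm u v"
    using sub ketbra_self_in_plane_herm[OF e_in] ketbra_self_in_plane_herm[OF f_in] ee ff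
    unfolding span_F span_F' L_diag[OF T] by (metis image_subset_iff)+
  ultimately show False
    using independent2_det[OF ind on'] in_span_if_ketbra_in_plane_herm by blast
qed

theorem theorem2:
  fixes T :: "('h::fin_dim_complex_hilbert \<Rightarrow>\<^sub>L 'h) \<Rightarrow> ('h \<Rightarrow>\<^sub>L 'h)"
  assumes "pure_operation T"
  shows "completely_positive T \<longleftrightarrow> orientation_preserving T"
proof -
  have T: "operation T" using assms by (simp add: pure_operation_def)
  show ?thesis
  proof (rule pure_operation_trichotomy[OF assms])
    fix \<psi> assume "\<And>Z. clinear_op Z \<Longrightarrow> \<exists>c. complex_extension T Z = scaleC_op c (ketbra \<psi> \<psi>)"
    then show ?thesis
      using completely_positive_rank_one[OF T] orientation_preserving_rank_one[OF T] by blast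
  next
    fix A assume "\<And>x y. A (x + y) = A x + A y" "\<And>c x. A (c *\<^sub>C x) = c *\<^sub>C A x"
      "\<And>g h. L T g h = ketbra (A g) (A h)"
    then show ?thesis
      using completely_positive_conjugation[OF T] orientation_preserving_conjugation[OF T] by blast
  next
    fix a b e f
    assume "independent2 a b" "L T e e = ketbra a a" "L T f f = ketbra b b" "L T e f = ketbra b a"
    then show ?thesis
      using not_completely_positive_antilinear[OF T] not_orientation_preserving_antilinear[OF T] by blast
  qed
qed

end
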